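(* Let $x\in\mathbb{R}^n$, $k\ge1$ and $\epsilon\in(0,1)$. There exists a randomized algorithm that either (i) uses $\mathcal{O}\!\left(\frac{k}{\epsilon}\log\log\frac{1}{\epsilon}+k\log\log\frac{n}{k}\right)$ linear measurements on $x$ in $\mathcal{O}\!\left(\log\log\frac{n}{k}\cdot\log^*(k)\right)$ rounds, or (ii) uses $\mathcal{O}\!\left(\frac{k}{\epsilon}\log\log\frac{n\log(n\epsilon)}{k}\right)$ linear measurements on $x$ in $\mathcal{O}\!\left(\log\log\left(\epsilon n\log\frac{n}{k}\right)\right)$ rounds, and with constant probability returns a vector $\hat{x}$ such that $\|x-\hat{x}\|_2\le(1+\epsilon)\|x_{-k}\|_2$.
   Context: The algorithm accesses $x$ only through adaptive linear measurements $\langle a_i,x\rangle$, made in rounds, where the vectors used in a round may depend on outcomes of earlier rounds. $x_{-k}$ is $x$ with its $k$ largest coordinates in absolute value zeroed out; $\log^*$ is the iterated logarithm. *)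

theory Defs
  imports "HOL-Probability.Probability"
begin

text \<open>Vectors of R^n are represented as functions nat => real; only coordinates i < n matter.\<close>

definition inner_n :: "nat \<Rightarrow> (nat \<Rightarrow> real) \<Rightarrow> (nat \<Rightarrow> real) \<Rightarrow> real" where
  "inner_n n a x = (\<Sum>i<n. a i * x i)"

definition l2 :: "nat \<Rightarrow> (nat \<Rightarrow> real) \<Rightarrow> real" where
  "l2 n v = sqrt (\<Sum>i<n. (v i)^2)"

definition top_k_set :: "nat \<Rightarrow> nat \<Rightarrow> (nat \<Rightarrow> real) \<Rightarrow> nat set" where
  "top_k_set n k x = (SOME S. S \<subseteq> {..<n} \<and> card S = min k n \<and>
      (\<forall>i\<in>S. \<forall>j\<in>{..<n} - S. \<bar>x j\<bar> \<le> \<bar>x i\<bar>))"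

definition drop_top :: "nat \<Rightarrow> nat \<Rightarrow> (nat \<Rightarrow> real) \<Rightarrow> (nat \<Rightarrow> real)" where
  "drop_top n k x = (\<lambda>i. if i \<in> top_k_set n k x then 0 else x i)"

text \<open>Adaptive measurement protocol. meas w r t = measurement vectors of round r, given the
  random seed w and the transcript t of outcomes of rounds 0..r-1.
  transcript n meas w x r = outcomes of rounds 0..r-1.\<close>
fun transcript :: "nat \<Rightarrow> ('s \<Rightarrow> nat \<Rightarrow> real list list \<Rightarrow> (nat \<Rightarrow> real) list)
     \<Rightarrow> 's \<Rightarrow> (nat \<Rightarrow> real) \<Rightarrow> nat \<Rightarrow> real list list" where
  "transcript n meas w x 0 = []"
| "transcript n meas w x (Suc r) =
     transcript n meas w x r @ [map (\<lambda>a. inner_n n a x) (meas w r (transcript n meas w x r))]"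

definition num_meas :: "nat \<Rightarrow> ('s \<Rightarrow> nat \<Rightarrow> real list list \<Rightarrow> (nat \<Rightarrow> real) list)
     \<Rightarrow> 's \<Rightarrow> (nat \<Rightarrow> real) \<Rightarrow> nat \<Rightarrow> nat" where
  "num_meas n meas w x R = (\<Sum>r<R. length (meas w r (transcript n meas w x r)))"

definition clog :: "real \<Rightarrow> real" where
  "clog x = log 2 (max 2 x)"

definition cloglog :: "real \<Rightarrow> real" where
  "cloglog x = clog (clog x)"

definition log_star :: "real \<Rightarrow> nat" where
  "log_star x = (LEAST i. ((log 2) ^^ i) x \<le> 1)"

definition clog_star :: "real \<Rightarrow> real" where
  "clog_star x = max 1 (real (log_star x))"

definition good_alg :: "nat \<Rightarrow> nat \<Rightarrow> real \<Rightarrow> real \<Rightarrow> real \<Rightarrow> real \<Rightarrow> bool" where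
  "good_alg n k eps c Mb Rb \<longleftrightarrow>
    (\<exists>(M :: (nat \<Rightarrow> real) measure) (R :: nat)
       (meas :: (nat \<Rightarrow> real) \<Rightarrow> nat \<Rightarrow> real list list \<Rightarrow> (nat \<Rightarrow> real) list)
       (out :: (nat \<Rightarrow> real) \<Rightarrow> real list list \<Rightarrow> (nat \<Rightarrow> real)).
       prob_space M \<and>
       real R \<le> Rb \<and>
       (\<forall>w\<in>space M. \<forall>x. real (num_meas n meas w x R) \<le> Mb) \<and>
       (\<forall>x. measure M {w \<in> space M.
              l2 n (\<lambda>i. x i - out w (transcript n meas w x R) i)
                \<le> (1 + eps) * l2 n (drop_top n k x)} \<ge> c))"

end

theory Submission
  imports Defs
begin

text \<open>
  A single adaptive procedure proves both bounds; it does not need the \<open>log\<^sup>*\<close> factor. It maintains a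
  set \<open>S\<close> of surviving coordinates that contains \<open>k\<close> coordinates whose complement has energy at most
  \<open>1 + eps\<close> times the optimum, and whose energy outside a set of \<open>O(K)\<close> heavy coordinates is at most \<open>\<eta>\<close>.
  A stage with scale \<open>\<Delta>\<close> hashes \<open>S\<close> into \<open>\<Delta> ^ 8 * K\<close> cells, compresses every cell by four random
  weightings to a vector of cell values, recovers these vectors from \<open>O(K)\<close> measurements, and keeps the
  coordinates in the \<open>K'\<close> cells of largest estimated value. With so many cells collisions are rare,
  sparse least squares has an error of order \<open>\<eta>\<close> up to powers of \<open>\<Delta>\<close>, and each of the \<open>k\<close>
  coordinates that is lost can be exchanged for a representative of a kept cell of nearly the same size.
  So a stage succeeds with probability \<open>1 - O(1 / \<Delta>)\<close>, improves \<open>\<eta>\<close> by \<open>\<Delta> ^ 2\<close>, and costs a fraction of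
  order \<open>k / (K' * \<Delta> ^ 2)\<close> of the tail energy. Hence \<open>\<Delta>\<close> may be raised to the power \<open>21 / 20\<close> from stage
  to stage, and \<open>O(log log (n / K))\<close> stages leave \<open>O(K)\<close> coordinates, which are measured directly.
\<close>

section \<open>Finitely supported distributions\<close>

text \<open>The first obstacle is the number of rows. Recovering vectors of sparsity
  \<open>4 * K\<close> in dimension \<open>\<Delta> ^ 8 * K\<close> usually takes order
  \<open>K * log \<Delta>\<close> measurements, but a stage may spend only \<open>O(K)\<close>. So
  the matrix is allowed the tiny lower isometry constant \<open>1 / \<Delta> ^ 20\<close>. This
  costs a fixed power of \<open>\<Delta>\<close>, which is paid by the invariant that
  \<open>\<eta>\<close> is, up to a constant, at most the tail energy divided by
  \<open>\<Delta> ^ 40\<close>. A stage gains \<open>\<Delta> ^ 2\<close>, and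
  \<open>40 * 21 / 20 = 42\<close>, so the invariant survives the change of scale. The second
  obstacle is a wanted coordinate that shares its cell with a heavy one: its value cannot be read
  off, only the fact that the cell is large. Three of the four weightings are nearly uniform on an
  interval. Together they make a small ball of radius \<open>\<tau>\<close> have probability of
  order \<open>\<tau> ^ 3\<close>, so the inverse energy of the cell has a bounded mean, down to the
  resolution of the weights. The fourth weighting is a random sign, which keeps the modulus of a
  coordinate alone in its cell.\<close>

abbreviation E :: "'a pmf \<Rightarrow> ('a \<Rightarrow> real) \<Rightarrow> real" where
  "E p f \<equiv> measure_pmf.expectation p f"

lemma E_finite: "finite (set_pmf p) \<Longrightarrow> E p f = (\<Sum>a\<in>set_pmf p. pmf p a * f a)"
  by (subst integral_measure_pmf[of "set_pmf p"]) auto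

lemma E_mono: "finite (set_pmf p) \<Longrightarrow> (\<And>a. a \<in> set_pmf p \<Longrightarrow> f a \<le> g a) \<Longrightarrow> E p f \<le> E p g"
  by (auto simp: E_finite intro!: sum_mono mult_left_mono)

lemma E_add: "finite (set_pmf p) \<Longrightarrow> E p (\<lambda>a. f a + g a) = E p f + E p g"
  by (auto simp: E_finite algebra_simps sum.distrib)

lemma E_sum: "finite (set_pmf p) \<Longrightarrow> E p (\<lambda>a. \<Sum>i\<in>I. f i a) = (\<Sum>i\<in>I. E p (f i))"
  by (simp add: integrable_measure_pmf_finite)

lemma E_nonneg: "(\<And>a. a \<in> set_pmf p \<Longrightarrow> 0 \<le> f a) \<Longrightarrow> 0 \<le> E p f"
  by (intro integral_nonneg_AE) (auto simp: AE_measure_pmf_iff)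

lemma E_pair:
  assumes "finite (set_pmf p)" "finite (set_pmf q)"
  shows "E (pair_pmf p q) f = E p (\<lambda>a. E q (\<lambda>b. f (a, b)))"
proof -
  have "E (pair_pmf p q) f = (\<Sum>s\<in>set_pmf p \<times> set_pmf q. pmf (pair_pmf p q) s * f s)"
    using assms by (subst E_finite) auto
  also have "\<dots> = (\<Sum>a\<in>set_pmf p. \<Sum>b\<in>set_pmf q. pmf (pair_pmf p q) (a, b) * f (a, b))"
    by (subst sum.cartesian_product) (simp add: case_prod_beta)
  also have "\<dots> = E p (\<lambda>a. E q (\<lambda>b. f (a, b)))"
    using assms by (simp add: E_finite pmf_pair sum_distrib_left mult.assoc)
  finally show ?thesis .
qed

lemma finite_set_Pi_pmf:
  "finite A \<Longrightarrow> (\<And>i. i \<in> A \<Longrightarrow> finite (set_pmf (p i))) \<Longrightarrow> finite (set_pmf (Pi_pmf A d p))"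
  by (subst set_Pi_pmf) auto

lemma E_Pi_insert:
  assumes "finite A" "i \<notin> A" "finite (set_pmf (p i))" "\<And>j. j \<in> A \<Longrightarrow> finite (set_pmf (p j))"
  shows "E (Pi_pmf (insert i A) d p) f = E (p i) (\<lambda>y. E (Pi_pmf A d p) (\<lambda>g. f (g(i := y))))"
  using assms by (simp add: Pi_pmf_insert E_pair finite_set_Pi_pmf)

lemma E_Pi_component:
  assumes "finite A" "i \<in> A"
  shows "E (Pi_pmf A d p) (\<lambda>f. g (f i)) = E (p i) g"
proof -
  have "E (p i) g = E (map_pmf (\<lambda>f. f i) (Pi_pmf A d p)) g"
    using assms by (simp add: Pi_pmf_component)
  then show ?thesis by simp
qed

lemma prob_eq_E_indicator: "measure_pmf.prob p {a. Q a} = E p (\<lambda>a. if Q a then 1 else 0)"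
proof -
  have "measure_pmf.prob p {a. Q a} = E p (indicator {a. Q a})" by simp
  also have "\<dots> = E p (\<lambda>a. if Q a then 1 else 0)"
    by (intro Bochner_Integration.integral_cong) (auto simp: indicator_def)
  finally show ?thesis .
qed

lemma prob_mono:
  "(\<And>a. a \<in> set_pmf p \<Longrightarrow> Q a \<Longrightarrow> R a) \<Longrightarrow> measure_pmf.prob p {a. Q a} \<le> measure_pmf.prob p {a. R a}"
  by (intro measure_pmf.finite_measure_mono_AE) (auto simp: AE_measure_pmf_iff)

lemma prob_disj:
  "measure_pmf.prob p {a. Q a \<or> R a} \<le> measure_pmf.prob p {a. Q a} + measure_pmf.prob p {a. R a}"
proof -
  have "{a. Q a \<or> R a} = {a. Q a} \<union> {a. R a}" by auto
  then show ?thesis using measure_Un_le[of "{a. Q a}" "measure_pmf p" "{a. R a}"] by simp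
qed

lemma prob_Bex:
  assumes "finite I"
  shows "measure_pmf.prob p {a. \<exists>i\<in>I. Q i a} \<le> (\<Sum>i\<in>I. measure_pmf.prob p {a. Q i a})"
proof -
  have "{a. \<exists>i\<in>I. Q i a} = (\<Union>i\<in>I. {a. Q i a})" by auto
  then show ?thesis using assms by (simp add: measure_pmf.finite_measure_subadditive_finite)
qed

lemma prob_not_le:
  "measure_pmf.prob p {a. \<not> Q a} = 1 - measure_pmf.prob p {a. Q a}"
proof -
  have "{a. \<not> Q a} = space (measure_pmf p) - {a. Q a}" by auto
  then show ?thesis by (simp only: measure_pmf.prob_compl sets_measure_pmf UNIV_I)
qed

lemma E_le_const: "(\<And>a. a \<in> set_pmf p \<Longrightarrow> f a \<le> c) \<Longrightarrow> finite (set_pmf p) \<Longrightarrow> E p f \<le> c"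
  using E_mono[of p f "\<lambda>_. c"] by simp

text \<open>Fubini for events: the parts of a seed are drawn one after the other, and a bound valid
  for every earlier draw survives averaging.\<close>

lemma prob_pair_le:
  assumes "finite (set_pmf p)" "finite (set_pmf q)"
    and "\<And>a. a \<in> set_pmf p \<Longrightarrow> measure_pmf.prob q {b. Q a b} \<le> c"
  shows "measure_pmf.prob (pair_pmf p q) {s. Q (fst s) (snd s)} \<le> c"
proof -
  have "measure_pmf.prob (pair_pmf p q) {s. Q (fst s) (snd s)} = E p (\<lambda>a. measure_pmf.prob q {b. Q a b})"
    unfolding prob_eq_E_indicator using assms(1,2) by (subst E_pair) auto
  also have "\<dots> \<le> c" by (rule E_le_const) (use assms in auto)
  finally show ?thesis .
qed

lemma prob_pair_fst: "measure_pmf.prob (pair_pmf p q) {s. Q (fst s)} = measure_pmf.prob p {a. Q a}"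
proof -
  have "measure_pmf.prob p {a. Q a} = measure_pmf.prob (map_pmf fst (pair_pmf p q)) {a. Q a}"
    by (simp add: map_fst_pair_pmf)
  then show ?thesis by (simp add: vimage_def)
qed

text \<open>The threshold is a multiple of a bound \<mu> on the mean, not a free level, so that a
  vanishing mean is covered too: then \<open>f\<close> is zero on the support and the strict
  inequality never holds.\<close>

lemma markov:
  fixes f :: "'a \<Rightarrow> real"
  assumes "finite (set_pmf p)" and nn: "\<And>a. a \<in> set_pmf p \<Longrightarrow> 0 \<le> f a" and "E p f \<le> \<mu>" and "0 < t"
  shows "measure_pmf.prob p {a. f a > \<mu> * t} \<le> 1 / t"
proof (cases "\<mu> \<le> 0")
  case True
  have "E p f = 0" using assms E_nonneg[of p f] True by auto
  then have "\<forall>a\<in>set_pmf p. pmf p a * f a = 0"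
    using assms by (simp add: E_finite sum_nonneg_eq_0_iff)
  then have z: "f a = 0" if "a \<in> set_pmf p" for a using that by (auto simp: set_pmf_iff)
  have m0: "\<mu> = 0" using True assms E_nonneg[of p f] by fastforce
  have "measure_pmf.prob p {a. f a > \<mu> * t} \<le> measure_pmf.prob p {a. False}"
    by (rule prob_mono) (use z m0 in auto)
  then show ?thesis using \<open>0 < t\<close> by (simp add: order_trans)
next
  case False
  have "\<mu> * t * measure_pmf.prob p {a. f a > \<mu> * t} = E p (\<lambda>a. \<mu> * t * (if f a > \<mu> * t then 1 else 0))"
    unfolding prob_eq_E_indicator by simp
  also have "\<dots> \<le> E p f"
    by (rule E_mono) (use assms in auto)
  also have "\<dots> \<le> \<mu>" by fact
  finally have "t * measure_pmf.prob p {a. f a > \<mu> * t} \<le> 1"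
    using False by (simp add: mult.assoc)
  then show ?thesis using \<open>0 < t\<close> by (simp add: field_simps)
qed

text \<open>Independence and mean zero kill the cross terms; the induction sees this one weight at a
  time. Second moments at most 1 fit random signs, grid weights and rounded normal variables
  alike.\<close>

lemma E_weighted_sum_sq:
  fixes t :: "'i \<Rightarrow> real"
  assumes "finite I"
    and "\<And>i. i \<in> I \<Longrightarrow> finite (set_pmf (q i))"
    and "\<And>i. i \<in> I \<Longrightarrow> E (q i) (\<lambda>u. u) = 0"
    and "\<And>i. i \<in> I \<Longrightarrow> E (q i) (\<lambda>u. u\<^sup>2) \<le> 1"
  shows "E (Pi_pmf I 0 q) (\<lambda>u. (\<Sum>i\<in>I. u i * t i)\<^sup>2) \<le> (\<Sum>i\<in>I. (t i)\<^sup>2)"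
  using assms
proof (induction I rule: finite_induct)
  case empty then show ?case by simp
next
  case (insert i I)
  let ?P = "Pi_pmf I 0 q"
  have fin: "finite (set_pmf ?P)" "finite (set_pmf (q i))"
    using insert by (auto intro!: finite_set_Pi_pmf)
  define X where "X = (\<lambda>u. \<Sum>j\<in>I. u j * t j)"
  have X: "(\<Sum>j\<in>I. (g(i := y)) j * t j) = X g" for g y
    unfolding X_def using insert.hyps by (intro sum.cong) auto
  have lin: "E ?P (\<lambda>g. (y * t i + X g)\<^sup>2) = y\<^sup>2 * (t i)\<^sup>2 + 2 * (y * t i) * E ?P X + E ?P (\<lambda>g. (X g)\<^sup>2)" for y
  proof -
    have "E ?P (\<lambda>g. (y * t i + X g)\<^sup>2) = E ?P (\<lambda>g. (y\<^sup>2 * (t i)\<^sup>2 + 2 * (y * t i) * X g) + (X g)\<^sup>2)"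
      by (simp add: power2_sum power_mult_distrib algebra_simps)
    also have "\<dots> = y\<^sup>2 * (t i)\<^sup>2 + 2 * (y * t i) * E ?P X + E ?P (\<lambda>g. (X g)\<^sup>2)"
      using fin(1) by (subst E_add, simp, subst E_add) auto
    finally show ?thesis .
  qed
  have "E (Pi_pmf (insert i I) 0 q) (\<lambda>u. (\<Sum>i\<in>insert i I. u i * t i)\<^sup>2)
      = E (q i) (\<lambda>y. E ?P (\<lambda>g. (y * t i + X g)\<^sup>2))"
    using insert by (subst E_Pi_insert) (auto simp: X fun_upd_same simp del: fun_upd_apply)
  also have "\<dots> = (t i)\<^sup>2 * E (q i) (\<lambda>y. y\<^sup>2) + 2 * t i * E ?P X * E (q i) (\<lambda>y. y) + E ?P (\<lambda>g. (X g)\<^sup>2)"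
  proof -
    have "E (q i) (\<lambda>y. E ?P (\<lambda>g. (y * t i + X g)\<^sup>2))
      = E (q i) (\<lambda>y. (y\<^sup>2 * (t i)\<^sup>2 + y * (2 * t i * E ?P X)) + E ?P (\<lambda>g. (X g)\<^sup>2))"
      unfolding lin by (intro Bochner_Integration.integral_cong) auto
    also have "\<dots> = E (q i) (\<lambda>y. y\<^sup>2) * (t i)\<^sup>2 + E (q i) (\<lambda>y. y) * (2 * t i * E ?P X) + E ?P (\<lambda>g. (X g)\<^sup>2)"
      using fin(2) by (subst E_add, simp, subst E_add) auto
    finally show ?thesis by (simp add: mult_ac)
  qed
  also have "\<dots> \<le> (t i)\<^sup>2 * 1 + 0 + (\<Sum>i\<in>I. (t i)\<^sup>2)"
    using insert unfolding X_def by (intro add_mono mult_left_mono) auto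
  finally show ?case using insert by simp
qed

text \<open>The coefficients may depend on the weights outside the summation range.\<close>

lemma E_weighted_sum_sq_subset:
  fixes t :: "('i \<Rightarrow> real) \<Rightarrow> 'i \<Rightarrow> real"
  assumes I0: "finite I" "I' \<subseteq> I"
    and q: "\<And>i. i \<in> I \<Longrightarrow> finite (set_pmf (q i))"
    and q0: "\<And>i. i \<in> I \<Longrightarrow> E (q i) (\<lambda>u. u) = 0"
    and q1: "\<And>i. i \<in> I \<Longrightarrow> E (q i) (\<lambda>u. u\<^sup>2) \<le> 1"
    and dep: "\<And>u v i. (\<And>j. j \<in> I - I' \<Longrightarrow> u j = v j) \<Longrightarrow> i \<in> I' \<Longrightarrow> t u i = t v i"
    and bd: "\<And>u. u \<in> set_pmf (Pi_pmf I 0 q) \<Longrightarrow> (\<Sum>i\<in>I'. (t u i)\<^sup>2) \<le> B"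
  shows "E (Pi_pmf I 0 q) (\<lambda>u. (\<Sum>i\<in>I'. u i * t u i)\<^sup>2) \<le> B"
proof -
  have fin: "finite I'" "finite (I - I')" using I0 by (auto dest: finite_subset)
  have I: "I = (I - I') \<union> I'" using I0 by auto
  have disj: "(I - I') \<inter> I' = {}" by auto
  let ?A = "Pi_pmf (I - I') 0 q" and ?B = "Pi_pmf I' 0 q"
  have fA: "finite (set_pmf ?A)" "finite (set_pmf ?B)" using q q0 q1 I0 fin by (auto intro!: finite_set_Pi_pmf)
  have eq: "Pi_pmf I 0 q = map_pmf (\<lambda>(f,g) x. if x \<in> I - I' then f x else g x) (pair_pmf ?A ?B)"
    using Pi_pmf_union[OF fin(2) fin(1) disj, of 0 q] unfolding I[symmetric] .
  define t' where "t' = (\<lambda>f i. t (\<lambda>x. if x \<in> I - I' then f x else 0) i)"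
  have "E (Pi_pmf I 0 q) (\<lambda>u. (\<Sum>i\<in>I'. u i * t u i)\<^sup>2)
     = E ?A (\<lambda>f. E ?B (\<lambda>g. (\<Sum>i\<in>I'. g i * t' f i)\<^sup>2))"
  proof -
    have "(\<Sum>i\<in>I'. (if i \<in> I - I' then f i else g i) * t (\<lambda>x. if x \<in> I - I' then f x else g x) i)
        = (\<Sum>i\<in>I'. g i * t' f i)" for f g
    proof (rule sum.cong[OF refl])
      fix i assume i: "i \<in> I'"
      have "t (\<lambda>x. if x \<in> I - I' then f x else g x) i = t' f i"
        unfolding t'_def by (rule dep) (use i in auto)
      then show "(if i \<in> I - I' then f i else g i) * t (\<lambda>x. if x \<in> I - I' then f x else g x) i = g i * t' f i"
        using i by simp
    qed
    then show ?thesis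
      unfolding eq integral_map_pmf by (subst E_pair[OF fA]) (simp only: prod.case)
  qed
  also have "\<dots> \<le> B"
  proof (rule E_le_const)
    fix f assume f: "f \<in> set_pmf ?A"
    \<comment> \<open>The bound \<open>bd\<close> on the coefficients speaks of the support of the
      joint law only, so \<open>f\<close> is completed by an arbitrary \<open>g\<close> from the
      support of the other factor.\<close>
    obtain g where g: "g \<in> set_pmf ?B" using set_pmf_not_empty by fast
    let ?u = "\<lambda>x. if x \<in> I - I' then f x else g x"
    have "?u = (\<lambda>(f, g) x. if x \<in> I - I' then f x else g x) (f, g)" by simp
    then have u: "?u \<in> set_pmf (Pi_pmf I 0 q)"
      unfolding eq set_map_pmf set_pair_pmf using f g by blast
    have "E ?B (\<lambda>g. (\<Sum>i\<in>I'. g i * t' f i)\<^sup>2) \<le> (\<Sum>i\<in>I'. (t' f i)\<^sup>2)"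
      using q q0 q1 I0 fin by (intro E_weighted_sum_sq) (auto simp: subset_iff)
    also have "\<dots> = (\<Sum>i\<in>I'. (t ?u i)\<^sup>2)"
    proof (rule sum.cong[OF refl])
      fix i assume i: "i \<in> I'"
      have "t' f i = t ?u i" unfolding t'_def by (rule dep) (use i in auto)
      then show "(t' f i)\<^sup>2 = (t ?u i)\<^sup>2" by simp
    qed
    also have "\<dots> \<le> B" by (rule bd[OF u])
    finally show "E ?B (\<lambda>g. (\<Sum>i\<in>I'. g i * t' f i)\<^sup>2) \<le> B" .
  qed (use fA in auto)
  finally show ?thesis .
qed

section \<open>Small ball probabilities\<close>

text \<open>Completing the square in \<open>g\<close>. Averaging over \<open>g\<close> thus keeps
  the shape of the kernel and only enlarges its variance \<open>a\<close> by the square of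
  \<open>d\<close>, so coordinates can be integrated out one at a time.\<close>

lemma std_normal_times_kernel:
  assumes "a > 0"
  shows "std_normal_density g * exp (- (v + d * g)\<^sup>2 / (2 * a)) =
    sqrt (a / (a + d\<^sup>2)) * exp (- v\<^sup>2 / (2 * (a + d\<^sup>2))) *
    normal_density (- v * d / (a + d\<^sup>2)) (sqrt (a / (a + d\<^sup>2))) g"
proof -
  define A where "A = a + d\<^sup>2"
  have A: "A > 0" unfolding A_def using assms by (simp add: add_pos_nonneg)
  have e: "- g\<^sup>2 / 2 + - (v + d * g)\<^sup>2 / (2 * a) = - v\<^sup>2 / (2 * A) + - (g - (- v * d / A))\<^sup>2 / (2 * (a / A))"
  proof -
    have "a * A * (A * g\<^sup>2 * a + (v + d * g)\<^sup>2 * A) = a * A * (v\<^sup>2 * a + (A * g + v * d)\<^sup>2)"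
      unfolding A_def by algebra
    then have *: "A * g\<^sup>2 * a + (v + d * g)\<^sup>2 * A = v\<^sup>2 * a + (A * g + v * d)\<^sup>2"
      using A assms by simp
    have "- g\<^sup>2 / 2 + - (v + d * g)\<^sup>2 / (2 * a) = - (A * g\<^sup>2 * a + (v + d * g)\<^sup>2 * A) / (2 * a * A)"
      using A assms by (simp add: field_simps)
    also have "\<dots> = - (v\<^sup>2 * a + (A * g + v * d)\<^sup>2) / (2 * a * A)" unfolding * ..
    also have "(A * g + v * d)\<^sup>2 = A\<^sup>2 * (g - (- v * d / A))\<^sup>2"
      using A by (simp add: power_mult_distrib[symmetric] field_simps)
    also have "- (v\<^sup>2 * a + A\<^sup>2 * w) / (2 * a * A) = - v\<^sup>2 / (2 * A) + - w / (2 * (a / A))" for w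
      using A assms by (simp add: field_simps power2_eq_square)
    finally show ?thesis .
  qed
  have s: "1 / sqrt (2 * pi) = sqrt (a / A) * (1 / sqrt (2 * pi * (sqrt (a / A))\<^sup>2))"
    using A assms by (simp add: real_sqrt_mult real_sqrt_divide)
  have "std_normal_density g * exp (- (v + d * g)\<^sup>2 / (2 * a))
      = 1 / sqrt (2 * pi) * exp (- g\<^sup>2 / 2 + - (v + d * g)\<^sup>2 / (2 * a))"
    unfolding exp_add by (simp add: std_normal_density_def)
  also have "\<dots> = sqrt (a / A) * (1 / sqrt (2 * pi * (sqrt (a / A))\<^sup>2))
      * (exp (- v\<^sup>2 / (2 * A)) * exp (- (g - (- v * d / A))\<^sup>2 / (2 * (sqrt (a / A))\<^sup>2)))"
    unfolding e s exp_add using A assms by simp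
  also have "\<dots> = sqrt (a / A) * exp (- v\<^sup>2 / (2 * A)) * normal_density (- v * d / A) (sqrt (a / A)) g"
    by (simp add: normal_density_def)
  finally show ?thesis unfolding A_def .
qed

lemma gauss_kernel_integral:
  assumes "a > 0"
  shows "integrable lborel (\<lambda>g. std_normal_density g * exp (- (v + d * g)\<^sup>2 / (2 * a)))"
    and "(\<integral>g. std_normal_density g * exp (- (v + d * g)\<^sup>2 / (2 * a)) \<partial>lborel)
      = sqrt (a / (a + d\<^sup>2)) * exp (- v\<^sup>2 / (2 * (a + d\<^sup>2)))"
proof -
  have "a / (a + d\<^sup>2) > 0" using assms by (simp add: add_pos_nonneg)
  then have s: "sqrt (a / (a + d\<^sup>2)) > 0" by simp
  show "integrable lborel (\<lambda>g. std_normal_density g * exp (- (v + d * g)\<^sup>2 / (2 * a)))"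
    unfolding std_normal_times_kernel[OF assms] using s by (intro integrable_mult_right integrable_normal_density)
  show "(\<integral>g. std_normal_density g * exp (- (v + d * g)\<^sup>2 / (2 * a)) \<partial>lborel)
      = sqrt (a / (a + d\<^sup>2)) * exp (- v\<^sup>2 / (2 * (a + d\<^sup>2)))"
    unfolding std_normal_times_kernel[OF assms] integral_mult_right_zero using s by simp
qed

text \<open>The derivative is bounded because \<open>exp\<close> of half the square of
  \<open>z\<close> dominates \<open>\<bar>z\<bar>\<close>. This controls how much the kernel changes
  when its argument is rounded.\<close>

lemma exp_square_lipschitz: "\<bar>exp (- s\<^sup>2 / 2) - exp (- t\<^sup>2 / 2 :: real)\<bar> \<le> \<bar>s - t\<bar>"
proof -
  have "norm (exp (- s\<^sup>2 / 2) - exp (- t\<^sup>2 / 2)) \<le> 1 * norm (s - t)"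
  proof (rule field_differentiable_bound[where S = UNIV and f' = "\<lambda>x. - x * exp (- x\<^sup>2 / 2)"])
    show "((\<lambda>x. exp (- x\<^sup>2 / 2)) has_field_derivative - z * exp (- z\<^sup>2 / 2)) (at z within UNIV)" for z :: real
      by (auto intro!: derivative_eq_intros)
    show "norm (- z * exp (- z\<^sup>2 / 2)) \<le> 1" for z :: real
    proof -
      have "\<bar>z\<bar> \<le> 1 + z\<^sup>2 / 2"
      proof -
        have "0 \<le> (\<bar>z\<bar> - 1)\<^sup>2" by simp
        then show ?thesis by (simp add: power2_diff)
      qed
      also have "\<dots> \<le> exp (z\<^sup>2 / 2)" by (rule exp_ge_add_one_self)
      finally show ?thesis by (simp add: abs_mult exp_minus field_simps)
    qed
  qed auto
  then show ?thesis by simp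
qed

text \<open>The seed of the algorithm has to be discrete, so a standard normal variable is rounded towards
  zero to a grid and truncated. The error \<open>\<theta>\<close> keeps the Gaussian kernel nearly stable.\<close>

lemma rounded_normal:
  fixes \<theta> \<tau> :: real
  assumes "\<theta> > 0" "\<tau> > 0"
  obtains p :: "real pmf" where "finite (set_pmf p)" "E p (\<lambda>g. g) = 0" "E p (\<lambda>g. g\<^sup>2) \<le> 1"
    "\<And>v d a. \<bar>d\<bar> \<le> 1 \<Longrightarrow> \<tau>\<^sup>2 \<le> a \<Longrightarrow>
      E p (\<lambda>g. exp (- (v + d * g)\<^sup>2 / (2 * a))) \<le> sqrt (a / (a + d\<^sup>2)) * exp (- v\<^sup>2 / (2 * (a + d\<^sup>2))) + \<theta>"
proof -
  \<comment> \<open>The kernel of variance at least the square of \<tau> has Lipschitz constant at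
    most \<open>1 / \<tau>\<close>, so a grid of width \<delta> costs at most
    \<open>\<theta> / 2\<close>. Beyond \<open>B\<close> the kernel is bounded by 1, hence by
    \<open>\<theta> / 2\<close> times the square of \<open>g\<close>, whose mean is again
    \<open>\<theta> / 2\<close>.\<close>
  define \<delta> where "\<delta> = \<tau> * \<theta> / 2"
  define B where "B = sqrt (2 / \<theta>)"
  have pos: "\<delta> > 0" "B > 0" using assms by (auto simp: \<delta>_def B_def)
  \<comment> \<open>Rounding towards zero is odd, which gives mean zero, and never increases the
    modulus, which keeps the second moment at most 1.\<close>
  define ro where "ro = (\<lambda>g::real. if \<bar>g\<bar> \<le> B then sgn g * (\<delta> * of_int \<lfloor>\<bar>g\<bar> / \<delta>\<rfloor>) else 0)"
  define R where "R = (\<lambda>i. \<delta> * of_int i) ` {- \<lceil>B / \<delta>\<rceil> .. \<lceil>B / \<delta>\<rceil>}"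
  have finR: "finite R" by (simp add: R_def)
  have inR: "ro g \<in> R" for g
  proof (cases "\<bar>g\<bar> \<le> B")
    case True
    define fl where "fl = \<lfloor>\<bar>g\<bar> / \<delta>\<rfloor>"
    let ?i = "(if g < 0 then -1 else if g = 0 then 0 else 1) * fl"
    have f: "0 \<le> fl" "fl \<le> \<lceil>B / \<delta>\<rceil>"
      using True pos unfolding fl_def by (auto intro!: order_trans[OF floor_mono floor_le_ceiling] divide_right_mono)
    have "ro g = \<delta> * of_int ?i" using True by (auto simp: ro_def sgn_if fl_def)
    moreover have "?i \<in> {- \<lceil>B / \<delta>\<rceil> .. \<lceil>B / \<delta>\<rceil>}" using f by (simp del: zero_le_ceiling)
    ultimately show ?thesis unfolding R_def by blast
  next
    case False
    have "0 < B / \<delta>" using pos by simp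
    then have "0 \<le> \<lceil>B / \<delta>\<rceil>" by linarith
    then show ?thesis using False unfolding R_def ro_def by (auto intro!: image_eqI[of _ _ 0])
  qed
  have ro_b[measurable]: "ro \<in> borel_measurable borel" unfolding ro_def by measurable
  have ro_odd: "ro (- g) = - ro g" for g by (auto simp: ro_def sgn_if)
  have ro_abs: "\<bar>ro g\<bar> \<le> \<bar>g\<bar>" and ro_close: "\<bar>g\<bar> \<le> B \<Longrightarrow> \<bar>ro g - g\<bar> \<le> \<delta>" for g
  proof -
    have 1: "\<delta> * of_int \<lfloor>\<bar>g\<bar> / \<delta>\<rfloor> \<le> \<bar>g\<bar>" "\<bar>g\<bar> < \<delta> * of_int \<lfloor>\<bar>g\<bar> / \<delta>\<rfloor> + \<delta>"
    proof -
      have "\<delta> * of_int \<lfloor>\<bar>g\<bar> / \<delta>\<rfloor> \<le> \<delta> * (\<bar>g\<bar> / \<delta>)"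
        using pos by (intro mult_left_mono of_int_floor_le) auto
      then show "\<delta> * of_int \<lfloor>\<bar>g\<bar> / \<delta>\<rfloor> \<le> \<bar>g\<bar>" using pos by simp
      have "\<delta> * (\<bar>g\<bar> / \<delta>) < \<delta> * (of_int \<lfloor>\<bar>g\<bar> / \<delta>\<rfloor> + 1)"
        using pos by (intro mult_strict_left_mono) linarith+
      then show "\<bar>g\<bar> < \<delta> * of_int \<lfloor>\<bar>g\<bar> / \<delta>\<rfloor> + \<delta>" using pos by (simp add: distrib_left)
    qed
    have 2: "0 \<le> \<delta> * of_int \<lfloor>\<bar>g\<bar> / \<delta>\<rfloor>" using pos by simp
    show "\<bar>ro g\<bar> \<le> \<bar>g\<bar>" using 1 2 by (auto simp: ro_def sgn_if abs_mult)
    show "\<bar>g\<bar> \<le> B \<Longrightarrow> \<bar>ro g - g\<bar> \<le> \<delta>" using 1 2 pos by (auto simp: ro_def sgn_if)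
  qed
  define Q where "Q = density lborel std_normal_density"
  interpret Q: prob_space Q unfolding Q_def by (rule prob_space_normal_density) simp
  have setsQ[measurable_cong, simp]: "sets Q = sets borel" by (simp add: Q_def)
  have spQ[simp]: "space Q = UNIV" by (simp add: Q_def)
  have ro_m[measurable]: "ro \<in> Q \<rightarrow>\<^sub>M count_space UNIV"
  proof (rule measurableI)
    fix X :: "real set"
    have "ro -` X \<inter> space Q = (\<Union>r\<in>X \<inter> R. ro -` {r} \<inter> space Q)" using inR by auto
    also have "\<dots> \<in> sets Q"
    proof (rule sets.finite_UN)
      show "finite (X \<inter> R)" using finR by simp
      have "ro \<in> borel_measurable Q" using ro_b by (simp add: Q_def)
      then show "\<And>r. ro -` {r} \<inter> space Q \<in> sets Q" by (rule measurable_sets) simp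
    qed
    finally show "ro -` X \<inter> space Q \<in> sets Q" .
  qed simp
  define D where "D = distr Q (count_space UNIV) ro"
  interpret D: prob_space D unfolding D_def by (rule Q.prob_space_distr) (rule ro_m)
  have setsD: "sets D = UNIV" by (simp add: D_def)
  \<comment> \<open>\<open>Abs_pmf\<close> wants a measure carried by its atoms: the law lives on
    the finite set \<open>R\<close>, and the points of \<open>R\<close> of measure zero are
    discarded.\<close>
  have aeD: "AE x in D. measure D {x} \<noteq> 0"
  proof -
    have "AE x in D. x \<in> R" unfolding D_def by (subst AE_distr_iff) (use inR in auto)
    moreover have "AE x in D. \<forall>r\<in>R. measure D {r} = 0 \<longrightarrow> x \<noteq> r"
    proof (subst AE_finite_all[OF finR], intro ballI)
      fix r assume "r \<in> R"
      show "AE x in D. measure D {r} = 0 \<longrightarrow> x \<noteq> r"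
      proof (cases "measure D {r} = 0")
        case True
        then have "{r} \<in> null_sets D" by (auto simp: null_sets_def setsD D.emeasure_eq_measure)
        then show ?thesis by (auto dest!: AE_not_in)
      qed simp
    qed
    ultimately show ?thesis by eventually_elim auto
  qed
  define p where "p = Abs_pmf D"
  have mp: "measure_pmf p = D"
    unfolding p_def by (rule Abs_pmf_inverse) (use D.prob_space_axioms setsD aeD in auto)
  have Ep: "E p f = (\<integral>g. std_normal_density g * f (ro g) \<partial>lborel)" for f :: "real \<Rightarrow> real"
  proof -
    have "E p f = (\<integral>g. f (ro g) \<partial>Q)"
      unfolding mp D_def by (rule integral_distr) (use ro_m in auto)
    also have "\<dots> = (\<integral>g. std_normal_density g * f (ro g) \<partial>lborel)"
      unfolding Q_def
    proof (subst integral_density)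
      have "(\<lambda>g. f (ro g)) \<in> borel_measurable Q"
        by (rule measurable_compose[OF ro_m]) simp
      then show "(\<lambda>g. f (ro g)) \<in> borel_measurable lborel" by (simp add: Q_def)
    qed auto
    finally show ?thesis .
  qed
  have setp: "set_pmf p \<subseteq> R"
  proof
    fix r assume "r \<in> set_pmf p"
    then have "measure D {r} \<noteq> 0" by (simp add: set_pmf.rep_eq mp)
    moreover have "measure D {r} = measure Q (ro -` {r} \<inter> space Q)"
      unfolding D_def by (rule measure_distr) (use ro_m in auto)
    ultimately have "ro -` {r} \<noteq> {}" by auto
    then show "r \<in> R" using inR by auto
  qed
  then have finp: "finite (set_pmf p)" using finR finite_subset by blast
  have frm: "(\<lambda>g. f (ro g)) \<in> borel_measurable borel" for f :: "real \<Rightarrow> real"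
  proof -
    have "(\<lambda>g. f (ro g)) \<in> borel_measurable Q"
      by (rule measurable_compose[OF ro_m]) simp
    then show ?thesis by (simp add: Q_def)
  qed
  have int_f: "integrable lborel (\<lambda>g. std_normal_density g * f (ro g))" for f :: "real \<Rightarrow> real"
  proof -
    have "\<bar>f (ro g)\<bar> \<le> (\<Sum>r\<in>R. \<bar>f r\<bar>)" for g
      by (rule member_le_sum[of _ _ "\<lambda>r. \<bar>f r\<bar>"]) (use inR finR in auto)
    note b = this
    show ?thesis
    proof (rule Bochner_Integration.integrable_bound)
      show "integrable lborel (\<lambda>g. std_normal_density g * (\<Sum>r\<in>R. \<bar>f r\<bar>))"
        by (intro integrable_mult_left integrable_normal_density) simp
      show "(\<lambda>g. std_normal_density g * f (ro g)) \<in> borel_measurable lborel" using frm by simp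
      show "AE g in lborel. norm (std_normal_density g * f (ro g)) \<le> norm (std_normal_density g * (\<Sum>r\<in>R. \<bar>f r\<bar>))"
        using b by (intro AE_I2) (auto simp: abs_mult intro!: mult_left_mono order_trans[OF b])
    qed
  qed
  have zero: "E p (\<lambda>g. g) = 0"
  proof -
    have "E p (\<lambda>g. g) = (\<integral>g. std_normal_density (-g) * ro (- g) \<partial>lborel)"
      unfolding Ep by (subst lborel_integral_real_affine[where c = "-1" and t = 0]) auto
    also have "\<dots> = - E p (\<lambda>g. g)"
      unfolding Ep ro_odd by (simp add: std_normal_density_def)
    finally show ?thesis by simp
  qed
  have mom: "integrable lborel (\<lambda>g. std_normal_density g * g\<^sup>2)" "(\<integral>g. std_normal_density g * g\<^sup>2 \<partial>lborel) = 1"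
    using integrable_std_normal_moment[of 2] std_normal_moment_even[of 1] by (auto simp: has_bochner_integral_iff)
  have sq: "E p (\<lambda>g. g\<^sup>2) \<le> 1"
  proof -
    have "E p (\<lambda>g. g\<^sup>2) \<le> (\<integral>g. std_normal_density g * g\<^sup>2 \<partial>lborel)"
      unfolding Ep using int_f[of "\<lambda>r. r\<^sup>2"] mom(1) ro_abs
      by (intro integral_mono mult_left_mono) (auto simp: abs_le_square_iff)
    then show ?thesis using mom by simp
  qed
  have ker: "E p (\<lambda>g. exp (- (v + d * g)\<^sup>2 / (2 * a))) \<le> sqrt (a / (a + d\<^sup>2)) * exp (- v\<^sup>2 / (2 * (a + d\<^sup>2))) + \<theta>"
    if d: "\<bar>d\<bar> \<le> 1" and a: "\<tau>\<^sup>2 \<le> a" for v d a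
  proof -
    have a0: "a > 0" using less_le_trans[OF zero_less_power[OF assms(2)] a] .
    have sa: "\<tau> \<le> sqrt a" using a assms by (simp add: real_le_rsqrt)
    have pw: "exp (- (v + d * ro g)\<^sup>2 / (2 * a)) \<le> exp (- (v + d * g)\<^sup>2 / (2 * a)) + \<theta> / 2 + \<theta> / 2 * g\<^sup>2" for g
    proof (cases "\<bar>g\<bar> \<le> B")
      case True
      have k: "exp (- (v + d * r)\<^sup>2 / (2 * a)) = exp (- ((v + d * r) / sqrt a)\<^sup>2 / 2)" for r
        using a0 by (simp add: power_divide)
      have "exp (- (v + d * ro g)\<^sup>2 / (2 * a)) - exp (- (v + d * g)\<^sup>2 / (2 * a))
         \<le> \<bar>(v + d * ro g) / sqrt a - (v + d * g) / sqrt a\<bar>"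
        unfolding k using exp_square_lipschitz abs_le_D1 by blast
      also have "\<dots> = \<bar>d\<bar> * \<bar>ro g - g\<bar> / sqrt a"
        using a0 by (simp add: diff_divide_distrib[symmetric] right_diff_distrib[symmetric] abs_mult abs_divide)
      also have "\<dots> \<le> 1 * \<delta> / \<tau>"
        using d ro_close[OF True] sa assms a0 pos by (intro frac_le mult_mono) auto
      also have "\<dots> = \<theta> / 2" using assms by (simp add: \<delta>_def)
      finally have "exp (- (v + d * ro g)\<^sup>2 / (2 * a)) - exp (- (v + d * g)\<^sup>2 / (2 * a)) \<le> \<theta> / 2" .
      moreover have "0 \<le> \<theta> / 2 * g\<^sup>2" using assms(1) by simp
      ultimately show ?thesis by linarith
    next
      case False
      have "B\<^sup>2 \<le> g\<^sup>2" using False pos by (simp add: abs_le_square_iff[symmetric])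
      then have "1 \<le> \<theta> / 2 * g\<^sup>2" using assms by (simp add: B_def field_simps)
      moreover have "exp (- (v + d * ro g)\<^sup>2 / (2 * a)) \<le> 1" using a0 by simp
      moreover have "0 \<le> exp (- (v + d * g)\<^sup>2 / (2 * a))" by simp
      ultimately show ?thesis using assms by linarith
    qed
    let ?n = "std_normal_density"
    have i: "integrable lborel (\<lambda>g. ?n g * exp (- (v + d * g)\<^sup>2 / (2 * a)) + \<theta> / 2 * ?n g + \<theta> / 2 * (?n g * g\<^sup>2))"
      using gauss_kernel_integral(1)[OF a0, of v d] mom(1) by auto
    have "E p (\<lambda>g. exp (- (v + d * g)\<^sup>2 / (2 * a)))
        \<le> (\<integral>g. ?n g * exp (- (v + d * g)\<^sup>2 / (2 * a)) + \<theta> / 2 * ?n g + \<theta> / 2 * (?n g * g\<^sup>2) \<partial>lborel)"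
      unfolding Ep
    proof (rule integral_mono[OF int_f[of "\<lambda>r. exp (- (v + d * r)\<^sup>2 / (2 * a))"] i])
      fix g
      have "?n g * exp (- (v + d * ro g)\<^sup>2 / (2 * a)) \<le> ?n g * (exp (- (v + d * g)\<^sup>2 / (2 * a)) + \<theta> / 2 + \<theta> / 2 * g\<^sup>2)"
        using pw by (intro mult_left_mono) auto
      then show "?n g * exp (- (v + d * ro g)\<^sup>2 / (2 * a)) \<le> ?n g * exp (- (v + d * g)\<^sup>2 / (2 * a)) + \<theta> / 2 * ?n g + \<theta> / 2 * (?n g * g\<^sup>2)"
        by (simp add: algebra_simps)
    qed
    also have "\<dots> = sqrt (a / (a + d\<^sup>2)) * exp (- v\<^sup>2 / (2 * (a + d\<^sup>2))) + \<theta> / 2 + \<theta> / 2"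
      using gauss_kernel_integral[OF a0, of v d] mom by simp
    finally show ?thesis by simp
  qed
  show ?thesis by (rule that[OF finp zero sq ker])
qed

text \<open>Each coordinate adds the square of its coefficient to the variance and an error
  \<theta>. The errors are not amplified, because the prefactor \<open>t / sqrt A\<close> in front
  of them is at most 1.\<close>

lemma kernel_sum_Pi:
  fixes p :: "real pmf" and \<tau> \<theta> t :: real
  assumes "finite I" and fin: "finite (set_pmf p)" and "\<tau> > 0" "\<theta> \<ge> 0"
    and ker: "\<And>v d a. \<bar>d\<bar> \<le> 1 \<Longrightarrow> \<tau>\<^sup>2 \<le> a \<Longrightarrow>
      E p (\<lambda>g. exp (- (v + d * g)\<^sup>2 / (2 * a))) \<le> sqrt (a / (a + d\<^sup>2)) * exp (- v\<^sup>2 / (2 * (a + d\<^sup>2))) + \<theta>"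
    and "\<tau> \<le> t" "\<And>i. i \<in> I \<Longrightarrow> \<bar>d i\<bar> \<le> 1"
  shows "E (Pi_pmf I 0 (\<lambda>_. p)) (\<lambda>g. exp (- (v + (\<Sum>i\<in>I. g i * d i))\<^sup>2 / (2 * t\<^sup>2)))
    \<le> t / sqrt (t\<^sup>2 + (\<Sum>i\<in>I. (d i)\<^sup>2)) * exp (- v\<^sup>2 / (2 * (t\<^sup>2 + (\<Sum>i\<in>I. (d i)\<^sup>2)))) + card I * \<theta>"
  using \<open>finite I\<close> assms(7)
proof (induction I arbitrary: v rule: finite_induct)
  case empty
  then show ?case using assms(3,6) by simp
next
  case (insert i I)
  define A where "A = t\<^sup>2 + (\<Sum>i\<in>I. (d i)\<^sup>2)"
  have At: "t\<^sup>2 \<le> A" unfolding A_def by (simp add: sum_nonneg)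
  have t0: "t > 0" using assms by simp
  have tA: "\<tau>\<^sup>2 \<le> A" using At power_mono[OF assms(6), of 2] assms(3) by linarith
  have A0: "A > 0" using less_le_trans[OF zero_less_power[OF assms(3)] tA] .
  have sA: "t \<le> sqrt A" using At t0 by (simp add: real_le_rsqrt)
  have "(\<Sum>j\<in>I. (g(i := y)) j * d j) = (\<Sum>j\<in>I. g j * d j)" for g y
    using insert.hyps by (intro sum.cong) auto
  then have X: "v + (\<Sum>j\<in>insert i I. (g(i := y)) j * d j) = (v + d i * y) + (\<Sum>j\<in>I. g j * d j)" for g y
    using insert.hyps by simp
  have "E (Pi_pmf (insert i I) 0 (\<lambda>_. p)) (\<lambda>g. exp (- (v + (\<Sum>i\<in>insert i I. g i * d i))\<^sup>2 / (2 * t\<^sup>2)))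
     = E p (\<lambda>y. E (Pi_pmf I 0 (\<lambda>_. p)) (\<lambda>g. exp (- ((v + d i * y) + (\<Sum>i\<in>I. g i * d i))\<^sup>2 / (2 * t\<^sup>2))))"
    using insert.hyps fin by (subst E_Pi_insert) (auto simp only: X)
  also have "\<dots> \<le> E p (\<lambda>y. t / sqrt A * exp (- (v + d i * y)\<^sup>2 / (2 * A)) + card I * \<theta>)"
    unfolding A_def using insert.IH insert.prems by (intro E_mono fin) auto
  also have "\<dots> = t / sqrt A * E p (\<lambda>y. exp (- (v + d i * y)\<^sup>2 / (2 * A))) + card I * \<theta>"
    by (subst E_add[OF fin]) simp
  also have "\<dots> \<le> t / sqrt A * (sqrt (A / (A + (d i)\<^sup>2)) * exp (- v\<^sup>2 / (2 * (A + (d i)\<^sup>2))) + \<theta>) + card I * \<theta>"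
    using insert.prems tA t0 A0 by (intro add_mono mult_left_mono ker) auto
  also have "\<dots> = t / sqrt (A + (d i)\<^sup>2) * exp (- v\<^sup>2 / (2 * (A + (d i)\<^sup>2))) + t / sqrt A * \<theta> + card I * \<theta>"
    using A0 by (simp add: real_sqrt_divide field_simps)
  also have "\<dots> \<le> t / sqrt (A + (d i)\<^sup>2) * exp (- v\<^sup>2 / (2 * (A + (d i)\<^sup>2))) + 1 * \<theta> + card I * \<theta>"
    using sA A0 assms(4) by (intro add_mono mult_right_mono) auto
  also have "A + (d i)\<^sup>2 = t\<^sup>2 + (\<Sum>i\<in>insert i I. (d i)\<^sup>2)"
    unfolding A_def using insert.hyps by simp
  finally show ?case using insert.hyps by (simp add: algebra_simps)
qed

text \<open>On the ball of radius \<tau> the Gaussian kernel of variance \<tau> squared is at least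
  \<open>exp (- 1 / 2)\<close>, and its mean is about \<tau>. The law is discrete, so the estimate
  is claimed only down to the resolution \<open>\<tau>0\<close>; the same law serves all directions
  \<open>d\<close>.\<close>

lemma small_ball_pmf:
  assumes "\<tau>0 > 0"
  obtains p :: "real pmf" where "finite (set_pmf p)" "E p (\<lambda>g. g) = 0" "E p (\<lambda>g. g\<^sup>2) \<le> 1"
    "\<And>d \<tau>. \<tau>0 \<le> \<tau> \<Longrightarrow> (\<exists>i<N. d i \<noteq> 0) \<Longrightarrow>
      measure_pmf.prob (Pi_pmf {..<N} 0 (\<lambda>_. p)) {a. (inner_n N a d)\<^sup>2 \<le> \<tau>\<^sup>2 * (\<Sum>i<N. (d i)\<^sup>2)} \<le> 2 * \<tau>"
proof -
  \<comment> \<open>The rounding errors then add up to at most a fifth of \<open>\<tau>0\<close>,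
    and with \<open>exp (1 / 2) \<le> 5 / 3\<close> the final constant is
    \<open>5 / 3 * (6 / 5) = 2\<close>.\<close>
  define \<theta> where "\<theta> = \<tau>0 / (5 * (N + 1))"
  have \<theta>: "\<theta> > 0" "N * \<theta> \<le> \<tau>0 / 5" using assms by (auto simp: \<theta>_def field_simps)
  obtain p :: "real pmf" where p: "finite (set_pmf p)" "E p (\<lambda>g. g) = 0" "E p (\<lambda>g. g\<^sup>2) \<le> 1"
    "\<And>v d a. \<bar>d\<bar> \<le> 1 \<Longrightarrow> \<tau>0\<^sup>2 \<le> a \<Longrightarrow>
      E p (\<lambda>g. exp (- (v + d * g)\<^sup>2 / (2 * a))) \<le> sqrt (a / (a + d\<^sup>2)) * exp (- v\<^sup>2 / (2 * (a + d\<^sup>2))) + \<theta>"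
    using rounded_normal[OF \<theta>(1) assms] by metis
  have "measure_pmf.prob (Pi_pmf {..<N} 0 (\<lambda>_. p)) {a. (inner_n N a d)\<^sup>2 \<le> \<tau>\<^sup>2 * (\<Sum>i<N. (d i)\<^sup>2)} \<le> 2 * \<tau>"
    if \<tau>: "\<tau>0 \<le> \<tau>" and d: "\<exists>i<N. d i \<noteq> 0" for d \<tau>
  proof -
    define s where "s = (\<Sum>i<N. (d i)\<^sup>2)"
    have s0: "s > 0"
    proof -
      obtain i where i: "i < N" "d i \<noteq> 0" using d by auto
      have "0 < (d i)\<^sup>2" using i by simp
      also have "\<dots> \<le> s" unfolding s_def by (rule member_le_sum[of _ _ "\<lambda>i. (d i)\<^sup>2"]) (use i in auto)
      finally show ?thesis .
    qed
    define d' where "d' = (\<lambda>i. d i / sqrt s)"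
    have d's: "(\<Sum>i<N. (d' i)\<^sup>2) = 1"
      using s0 by (simp add: d'_def power_divide sum_divide_distrib[symmetric] s_def[symmetric])
    have d'1: "\<bar>d' i\<bar> \<le> 1" if "i \<in> {..<N}" for i
    proof -
      have "(d' i)\<^sup>2 \<le> (\<Sum>i<N. (d' i)\<^sup>2)" by (rule member_le_sum[of _ _ "\<lambda>i. (d' i)\<^sup>2"]) (use that in auto)
      then show ?thesis using d's by (simp add: abs_square_le_1)
    qed
    have \<tau>p: "\<tau> > 0" using \<tau> assms by simp
    let ?P = "Pi_pmf {..<N} 0 (\<lambda>_. p)"
    have fP: "finite (set_pmf ?P)" using p(1) by (intro finite_set_Pi_pmf) auto
    have inn: "inner_n N a d = sqrt s * (\<Sum>i<N. a i * d' i)" for a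
      using s0 by (simp add: inner_n_def d'_def sum_distrib_left)
    have "measure_pmf.prob ?P {a. (inner_n N a d)\<^sup>2 \<le> \<tau>\<^sup>2 * s}
      \<le> E ?P (\<lambda>a. exp (1/2) * exp (- (0 + (\<Sum>i<N. a i * d' i))\<^sup>2 / (2 * \<tau>\<^sup>2)))"
      unfolding prob_eq_E_indicator
    proof (rule E_mono[OF fP])
      fix a
      show "(if (inner_n N a d)\<^sup>2 \<le> \<tau>\<^sup>2 * s then 1 else 0)
        \<le> exp (1/2) * exp (- (0 + (\<Sum>i<N. a i * d' i))\<^sup>2 / (2 * \<tau>\<^sup>2))"
      proof (cases "(inner_n N a d)\<^sup>2 \<le> \<tau>\<^sup>2 * s")
        case True
        then have "(\<Sum>i<N. a i * d' i)\<^sup>2 \<le> \<tau>\<^sup>2" unfolding inn using s0 by (simp add: power_mult_distrib)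
        then have "(\<Sum>i<N. a i * d' i)\<^sup>2 / (2 * \<tau>\<^sup>2) \<le> 1/2" using \<tau>p by (simp add: field_simps)
        then have "1 \<le> exp (1/2 + - (\<Sum>i<N. a i * d' i)\<^sup>2 / (2 * \<tau>\<^sup>2))" by simp
        then show ?thesis using True by (simp add: exp_add[symmetric])
      qed simp
    qed
    also have "\<dots> = exp (1/2) * E ?P (\<lambda>a. exp (- (0 + (\<Sum>i<N. a i * d' i))\<^sup>2 / (2 * \<tau>\<^sup>2)))" by simp
    also have "\<dots> \<le> exp (1/2) * (\<tau> / sqrt (\<tau>\<^sup>2 + 1) * exp (- 0\<^sup>2 / (2 * (\<tau>\<^sup>2 + 1))) + N * \<theta>)"
      using kernel_sum_Pi[where I="{..<N}" and p=p and \<tau>=\<tau>0 and \<theta>=\<theta> and t=\<tau> and d=d' and v=0, OF _ p(1) assms _ p(4) \<tau> d'1] \<theta>(1) d's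
      by (intro mult_left_mono) auto
    also have "\<dots> \<le> exp (1/2) * (\<tau> / 1 * 1 + \<tau> / 5)"
      using \<theta> \<tau> \<tau>p by (intro mult_left_mono add_mono mult_mono divide_left_mono) (auto simp: add_nonneg_pos)
    also have "\<dots> \<le> (5 / 3) * (6 / 5 * \<tau>)"
    proof -
      have "exp (1/2 :: real) \<le> 5/3"
      proof -
        have "exp (1/2::real) ^ 2 = exp 1" by (simp add: exp_of_nat_mult[symmetric] power2_eq_square exp_add[symmetric])
        also have "\<dots> \<le> (5/3) ^ 2" using e_less_272 by (simp add: power2_eq_square)
        finally show ?thesis by (rule power2_le_imp_le) simp
      qed
      then show ?thesis using \<tau>p by (intro mult_mono) auto
    qed
    finally show ?thesis unfolding s_def by simp
  qed
  then show ?thesis by (rule that[OF p(1-3)])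
qed

section \<open>Sparse vectors and random matrices\<close>

definition sparse :: "nat \<Rightarrow> nat \<Rightarrow> (nat \<Rightarrow> 'a::zero) \<Rightarrow> bool" where
  "sparse N D d \<longleftrightarrow> (\<forall>c\<ge>N. d c = 0) \<and> card {c. d c \<noteq> 0} \<le> D"

lemma sparse_finite: "sparse N D d \<Longrightarrow> finite {c. d c \<noteq> 0}"
  by (rule finite_subset[of _ "{..<N}"]) (auto simp: sparse_def not_less[symmetric])

section \<open>Sparse lattice vectors: counting and rounding\<close>

lemma sum_powers_abs_le:
  fixes q :: real
  assumes "0 < q" "q < 1"
  shows "(\<Sum>z\<in>{- int W..int W}. if z = 0 then 1 else \<theta> * q ^ nat \<bar>z\<bar>) = 1 + 2 * \<theta> * (\<Sum>i=1..W. q ^ i)"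
proof -
  let ?w = "\<lambda>z. if z = 0 then 1 else \<theta> * q ^ nat \<bar>z\<bar>"
  have e: "{- int W..int W} = {0} \<union> (int ` {1..W} \<union> (\<lambda>i. - int i) ` {1..W})"
  proof (intro equalityI subsetI)
    fix z assume z: "z \<in> {- int W..int W}"
    consider "z = 0" | "z > 0" | "z < 0" by linarith
    then show "z \<in> {0} \<union> (int ` {1..W} \<union> (\<lambda>i. - int i) ` {1..W})"
    proof cases
      case 2 then have "z = int (nat z)" "nat z \<in> {1..W}" using z by auto
      then show ?thesis by blast
    next
      case 3 then have "z = - int (nat (- z))" "nat (- z) \<in> {1..W}" using z by auto
      then show ?thesis by blast
    qed auto
  qed auto
  have "sum ?w {- int W..int W} = ?w 0 + (sum ?w (int ` {1..W}) + sum ?w ((\<lambda>i. - int i) ` {1..W}))"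
    unfolding e by (subst sum.union_disjoint, simp, simp, fastforce, subst sum.union_disjoint) auto
  also have "sum ?w (int ` {1..W}) = \<theta> * (\<Sum>i=1..W. q ^ i)"
    by (subst sum.reindex) (auto simp: inj_on_def sum_distrib_left intro!: sum.cong)
  also have "sum ?w ((\<lambda>i. - int i) ` {1..W}) = \<theta> * (\<Sum>i=1..W. q ^ i)"
    by (subst sum.reindex) (auto simp: inj_on_def sum_distrib_left intro!: sum.cong)
  finally show ?thesis by simp
qed

definition lattice_vecs :: "nat \<Rightarrow> nat \<Rightarrow> nat \<Rightarrow> (nat \<Rightarrow> int) set" where
  "lattice_vecs N D W = {f. sparse N D f \<and> (\<Sum>c<N. \<bar>f c\<bar>) \<le> int W}"

lemma lattice_vecs_range:
  assumes "f \<in> lattice_vecs N D W"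
  shows "restrict f {..<N} \<in> PiE {..<N} (\<lambda>_. {- int W..int W})"
proof -
  have "\<bar>f c\<bar> \<le> int W" if "c < N" for c
  proof -
    have "\<bar>f c\<bar> \<le> (\<Sum>c<N. \<bar>f c\<bar>)" by (rule member_le_sum[of _ _ "\<lambda>c. \<bar>f c\<bar>"]) (use that in auto)
    then show ?thesis using assms by (simp add: lattice_vecs_def)
  qed
  then show ?thesis by (auto simp: abs_le_iff dest!: spec) (metis abs_le_iff add.inverse_inverse neg_le_iff_le)+
qed

lemma lattice_vecs_inj: "inj_on (\<lambda>f. restrict f {..<N}) (lattice_vecs N D W)"
proof (rule inj_onI)
  fix f g assume f: "f \<in> lattice_vecs N D W" "g \<in> lattice_vecs N D W"
    and e: "restrict f {..<N} = restrict g {..<N}"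
  show "f = g"
  proof
    fix c show "f c = g c"
      using f fun_cong[OF e, of c] by (cases "c < N") (auto simp: lattice_vecs_def sparse_def)
  qed
qed

lemma finite_lattice_vecs: "finite (lattice_vecs N D W)"
  by (rule inj_on_finite[OF lattice_vecs_inj]) (intro image_subsetI, erule lattice_vecs_range, intro finite_PiE, auto)

text \<open>Generating function bound: a lattice vector is charged the weight \<open>\<theta>\<close> per nonzero entry
  and \<open>q\<close> per unit of its l1-norm.\<close>

lemma card_lattice_vecs:
  assumes "1 \<le> b" "1 \<le> D" "D \<le> N"
  shows "real (card (lattice_vecs N D (b * D))) \<le> (18 * real b * real N / real D) ^ D"
proof -
  \<comment> \<open>The choice balances three factors: the geometric sum is at most
    \<open>b\<close>, so the sum over one coordinate is at most \<open>1 + D / N\<close>, whose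
    \<open>N\<close>-th power is at most \<open>exp D\<close>; and the charge \<open>q ^ W\<close>
    with \<open>W = b * D\<close> is at least \<open>exp (- D)\<close>. The remaining
    \<open>exp (2 * D)\<close> is at most \<open>9 ^ D\<close>.\<close>
  define q where "q = real b / (b + 1)"
  define \<theta> where "\<theta> = real D / (2 * b * N)"
  define W where "W = b * D"
  define w where "w = (\<lambda>z::int. if z = 0 then 1 else \<theta> * q ^ nat \<bar>z\<bar>)"
  have N: "N \<ge> 1" using assms by simp
  have q: "0 < q" "q < 1" using assms by (auto simp: q_def field_simps)
  have \<theta>: "0 < \<theta>" "\<theta> \<le> 1"
  proof -
    show "0 < \<theta>" using assms N by (simp add: \<theta>_def)
    have "real D \<le> 1 * real N" using assms by simp
    also have "\<dots> \<le> (2 * real b) * N" using assms by (intro mult_right_mono) auto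
    finally show "\<theta> \<le> 1" using assms N by (simp add: \<theta>_def field_simps)
  qed
  have wnn: "0 \<le> w z" for z using \<theta> q by (simp add: w_def)
  have prod: "\<theta> ^ D * q ^ W \<le> (\<Prod>c<N. w (f c))" if f: "f \<in> lattice_vecs N D W" for f
  proof -
    let ?S = "{c. f c \<noteq> 0}"
    have sp: "sparse N D f" using f by (simp add: lattice_vecs_def)
    have S: "finite ?S" "?S \<subseteq> {..<N}" "card ?S \<le> D"
      using sparse_finite[OF sp] sp by (auto simp: sparse_def not_less[symmetric])
    have "(\<Sum>c\<in>?S. nat \<bar>f c\<bar>) \<le> W"
    proof -
      have "int (\<Sum>c\<in>?S. nat \<bar>f c\<bar>) = (\<Sum>c\<in>?S. \<bar>f c\<bar>)" by simp
      also have "\<dots> \<le> (\<Sum>c<N. \<bar>f c\<bar>)" using S by (intro sum_mono2) auto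
      also have "\<dots> \<le> int W" using f by (simp add: lattice_vecs_def)
      finally show ?thesis by linarith
    qed
    then have "\<theta> ^ D * q ^ W \<le> \<theta> ^ card ?S * q ^ (\<Sum>c\<in>?S. nat \<bar>f c\<bar>)"
      using S q \<theta> by (intro mult_mono power_decreasing) auto
    also have "\<dots> = (\<Prod>c\<in>?S. w (f c))"
      by (simp add: w_def prod.distrib power_sum)
    also have "\<dots> = (\<Prod>c<N. w (f c))"
      using S by (intro prod.mono_neutral_left) (auto simp: w_def)
    finally show ?thesis .
  qed
  have "real (card (lattice_vecs N D W)) * (\<theta> ^ D * q ^ W) = (\<Sum>f\<in>lattice_vecs N D W. \<theta> ^ D * q ^ W)" by simp
  also have "\<dots> \<le> (\<Sum>f\<in>lattice_vecs N D W. \<Prod>c<N. w (restrict f {..<N} c))"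
    using prod by (intro sum_mono) simp
  also have "\<dots> = (\<Sum>g\<in>(\<lambda>f. restrict f {..<N}) ` lattice_vecs N D W. \<Prod>c<N. w (g c))"
    by (subst sum.reindex[OF lattice_vecs_inj]) simp
  also have "\<dots> \<le> (\<Sum>g\<in>PiE {..<N} (\<lambda>_. {- int W..int W}). \<Prod>c<N. w (g c))"
    by (intro sum_mono2 finite_PiE prod_nonneg image_subsetI lattice_vecs_range wnn) auto
  also have "\<dots> = (\<Prod>c<N. \<Sum>z\<in>{- int W..int W}. w z)"
    by (subst prod_sum_PiE) auto
  also have "\<dots> = (1 + 2 * \<theta> * (\<Sum>i=1..W. q ^ i)) ^ N"
    unfolding w_def by (simp only: sum_powers_abs_le[OF q]) simp
  also have "\<dots> \<le> (1 + 2 * \<theta> * b) ^ N"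
  proof -
    have "(\<Sum>i=1..W. q ^ i) \<le> b"
    proof -
      have "(\<Sum>i=1..W. q ^ i) = q * (\<Sum>i<W. q ^ i)"
        by (simp add: sum_distrib_left sum.atLeast1_atMost_eq)
      also have "\<dots> = q * ((1 - q ^ W) / (1 - q))" using q by (simp add: sum_gp_strict)
      also have "\<dots> \<le> q * (1 / (1 - q))" using q by (intro mult_left_mono divide_right_mono) auto
      also have "\<dots> = b" using assms by (simp add: q_def field_simps)
      finally show ?thesis .
    qed
    then show ?thesis using \<theta> q by (intro power_mono add_left_mono mult_left_mono) (auto intro!: sum_nonneg add_nonneg_nonneg mult_nonneg_nonneg)
  qed
  also have "\<dots> \<le> exp (real D)"
  proof -
    have "1 + 2 * \<theta> * b = 1 + D / N" using assms N by (simp add: \<theta>_def)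
    also have "\<dots> \<le> exp (D / N)" by (rule exp_ge_add_one_self)
    finally have "(1 + 2 * \<theta> * b) ^ N \<le> exp (D / N) ^ N" using \<theta> by (intro power_mono) auto
    also have "\<dots> = exp D" using N by (simp add: exp_of_nat_mult[symmetric])
    finally show ?thesis .
  qed
  finally have c: "real (card (lattice_vecs N D W)) * (\<theta> ^ D * q ^ W) \<le> exp (real D)" .
  have qW: "1 \<le> exp (real D) * q ^ W"
  proof -
    have "1 / q = 1 + 1 / b" using assms by (simp add: q_def field_simps)
    also have "\<dots> \<le> exp (1 / b)" by (rule exp_ge_add_one_self)
    finally have "1 \<le> exp (1 / b) * q" using q by (simp add: field_simps)
    then have "1 \<le> (exp (1 / b) * q) ^ W" by (rule one_le_power)
    also have "\<dots> = exp (real D) * q ^ W"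
      using assms by (simp add: power_mult_distrib exp_of_nat_mult[symmetric] W_def)
    finally show ?thesis .
  qed
  have "real (card (lattice_vecs N D W)) * \<theta> ^ D * 1 \<le> real (card (lattice_vecs N D W)) * \<theta> ^ D * (exp D * q ^ W)"
    using qW \<theta> by (intro mult_left_mono) auto
  also have "\<dots> \<le> exp D * exp D" using mult_left_mono[OF c, of "exp D"] by (simp add: mult_ac)
  also have "\<dots> = (exp 1 * exp 1) ^ D" by (simp add: power_mult_distrib exp_of_nat_mult[symmetric])
  also have "\<dots> \<le> 9 ^ D"
  proof -
    have "exp 1 * exp 1 \<le> (3::real) * 3" using e_less_272 by (intro mult_mono) auto
    then show ?thesis by (intro power_mono) auto
  qed
  finally have "real (card (lattice_vecs N D W)) \<le> 9 ^ D / \<theta> ^ D" using \<theta> by (simp add: field_simps)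
  also have "\<dots> = (18 * real b * real N / real D) ^ D"
    unfolding power_divide[symmetric] using assms by (simp add: \<theta>_def mult.assoc)
  finally show ?thesis unfolding W_def .
qed

text \<open>Coordinates are rounded one at a time, each in the direction that does not increase the
  inner product with the error accumulated so far.\<close>

lemma greedy_rounding:
  fixes A :: "nat \<Rightarrow> nat \<Rightarrow> real" and d :: "nat \<Rightarrow> real" and s :: real
  assumes "finite Y" "s > 0"
  shows "\<exists>n::nat \<Rightarrow> int. (\<forall>i. i \<notin> Y \<longrightarrow> n i = (0::int)) \<and> (\<forall>i\<in>Y. \<bar>d i - s * n i\<bar> \<le> s) \<and>
    (\<Sum>l<m. (\<Sum>i\<in>Y. A l i * (d i - s * n i))\<^sup>2) \<le> s\<^sup>2 * (\<Sum>l<m. \<Sum>i\<in>Y. (A l i)\<^sup>2)"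
  using assms(1)
proof (induction Y rule: finite_induct)
  case empty
  then show ?case by (intro exI[of _ "\<lambda>_. 0"]) auto
next
  case (insert j Y)
  then obtain n :: "nat \<Rightarrow> int" where n: "\<And>i. i \<notin> Y \<Longrightarrow> n i = 0" "\<And>i. i \<in> Y \<Longrightarrow> \<bar>d i - s * n i\<bar> \<le> s"
    "(\<Sum>l<m. (\<Sum>i\<in>Y. A l i * (d i - s * n i))\<^sup>2) \<le> s\<^sup>2 * (\<Sum>l<m. \<Sum>i\<in>Y. (A l i)\<^sup>2)" by blast
  define e where "e = (\<lambda>l. \<Sum>i\<in>Y. A l i * (d i - s * n i))"
  define C where "C = (\<Sum>l<m. e l * A l j)"
  define z where "z = \<lfloor>d j / s\<rfloor>"
  have z: "s * z \<le> d j" "d j \<le> s * (z + 1)"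
  proof -
    have "s * z \<le> s * (d j / s)" unfolding z_def using assms by (intro mult_left_mono of_int_floor_le) auto
    then show "s * z \<le> d j" using assms by simp
    have "s * (d j / s) \<le> s * (z + 1)" unfolding z_def using assms by (intro mult_left_mono) linarith+
    then show "d j \<le> s * (z + 1)" using assms by simp
  qed
  \<comment> \<open>The two grid neighbours of \<open>d j\<close> leave errors of opposite sign, so
    one of them makes the cross term with the accumulated error nonpositive.\<close>
  obtain k :: int where k: "\<bar>d j - s * k\<bar> \<le> s" "C * (d j - s * k) \<le> 0"
  proof (cases "C \<le> 0")
    case True
    have "\<bar>d j - s * z\<bar> \<le> s" using z assms by (simp add: algebra_simps)
    moreover have "C * (d j - s * z) \<le> 0" using True z by (simp add: mult_nonpos_nonneg)
    ultimately show ?thesis by (rule that)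
  next
    case False
    have "\<bar>d j - s * (z + 1)\<bar> \<le> s" using z assms by (simp add: algebra_simps)
    moreover have "C * (d j - s * (z + 1)) \<le> 0" using False z(2) by (simp add: mult_nonneg_nonpos)
    ultimately show ?thesis using that[of "z + 1"] by simp
  qed
  define n' where "n' = n(j := k)"
  have eq: "(\<Sum>i\<in>insert j Y. A l i * (d i - s * n' i)) = e l + A l j * (d j - s * k)" for l
  proof -
    have "(\<Sum>i\<in>Y. A l i * (d i - s * n' i)) = e l" unfolding e_def n'_def using insert.hyps by (intro sum.cong) auto
    then show ?thesis using insert.hyps by (simp add: n'_def)
  qed
  have "(\<Sum>l<m. (\<Sum>i\<in>insert j Y. A l i * (d i - s * n' i))\<^sup>2)
     = (\<Sum>l<m. (e l)\<^sup>2 + 2 * (d j - s * k) * (e l * A l j) + (d j - s * k)\<^sup>2 * (A l j)\<^sup>2)"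
    unfolding eq by (intro sum.cong refl) (simp add: power2_eq_square algebra_simps)
  also have "\<dots> = (\<Sum>l<m. (e l)\<^sup>2) + 2 * (C * (d j - s * k)) + (d j - s * k)\<^sup>2 * (\<Sum>l<m. (A l j)\<^sup>2)"
  proof -
    have "(\<Sum>l<m. (e l)\<^sup>2 + 2 * w * (e l * A l j) + w\<^sup>2 * (A l j)\<^sup>2)
      = (\<Sum>l<m. (e l)\<^sup>2) + 2 * (C * w) + w\<^sup>2 * (\<Sum>l<m. (A l j)\<^sup>2)" for w
      unfolding C_def by (simp add: sum.distrib sum_distrib_left[symmetric])
    then show ?thesis .
  qed
  also have "\<dots> \<le> s\<^sup>2 * (\<Sum>l<m. \<Sum>i\<in>Y. (A l i)\<^sup>2) + 0 + s\<^sup>2 * (\<Sum>l<m. (A l j)\<^sup>2)"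
    using n(3) k assms(2) unfolding e_def
    by (intro add_mono mult_right_mono) (auto intro!: sum_nonneg simp: abs_le_square_iff[symmetric])
  also have "\<dots> = s\<^sup>2 * (\<Sum>l<m. \<Sum>i\<in>insert j Y. (A l i)\<^sup>2)"
    using insert.hyps by (simp add: sum.distrib distrib_left)
  finally show ?case
    using n(1,2) k(1) by (intro exI[of _ n']) (auto simp: n'_def)
qed

lemma sum_square_le2: "(\<Sum>i\<in>I. (f i + g i :: real)\<^sup>2) \<le> 2 * (\<Sum>i\<in>I. (f i)\<^sup>2) + 2 * (\<Sum>i\<in>I. (g i)\<^sup>2)"
proof -
  have "(f i + g i)\<^sup>2 \<le> 2 * (f i)\<^sup>2 + 2 * (g i)\<^sup>2" for i
    using zero_le_power2[of "f i - g i"] by (simp add: power2_eq_square algebra_simps)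
  then have "(\<Sum>i\<in>I. (f i + g i)\<^sup>2) \<le> (\<Sum>i\<in>I. 2 * (f i)\<^sup>2 + 2 * (g i)\<^sup>2)" by (rule sum_mono)
  then show ?thesis by (simp add: sum.distrib sum_distrib_left)
qed

lemma sum_abs_le_sqrt:
  fixes f :: "'a \<Rightarrow> real"
  shows "(\<Sum>i\<in>I. \<bar>f i\<bar>) \<le> sqrt (card I * (\<Sum>i\<in>I. (f i)\<^sup>2))"
proof -
  have "(\<Sum>i\<in>I. \<bar>1::real\<bar> * \<bar>f i\<bar>) \<le> L2_set (\<lambda>_. 1) I * L2_set f I" by (rule L2_set_mult_ineq)
  then show ?thesis by (simp add: L2_set_def real_sqrt_mult)
qed

text \<open>Turns a failure on some real sparse vector into a failure on one of finitely many
  lattice vectors, ready for a union bound. Greedy rounding makes the image of the rounding error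
  cost only the sum of the squared entries of \<open>A\<close>; no bound on an operator norm
  enters.\<close>

lemma sparse_lower_bound_lattice:
  fixes A :: "nat \<Rightarrow> nat \<Rightarrow> real" and d :: "nat \<Rightarrow> real" and \<Delta> K :: nat
  assumes \<Delta>: "\<Delta> \<ge> 4" and K: "K \<ge> 1"
    and N: "N = \<Delta> ^ 8 * K" and D: "D = 4 * K"
    and sp: "sparse N D d" and d0: "d \<noteq> (\<lambda>_. 0)"
    and en: "(\<Sum>l<m. \<Sum>i<N. (A l i)\<^sup>2) \<le> m * N * \<Delta>"
    and small: "(\<Sum>l<m. (inner_n N (A l) d)\<^sup>2) < m / \<Delta> ^ 20 * (\<Sum>i<N. (d i)\<^sup>2)"
  shows "\<exists>f\<in>lattice_vecs N D (\<Delta> ^ 15 * D). (\<exists>i<N. f i \<noteq> 0) \<and>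
    (\<Sum>l<m. (inner_n N (A l) (\<lambda>i. real_of_int (f i)))\<^sup>2) < 16 * m / \<Delta> ^ 20 * (\<Sum>i<N. (real_of_int (f i))\<^sup>2)"
proof -
  define Q where "Q = (\<Sum>i<N. (d i)\<^sup>2)"
  define Y where "Y = {c. d c \<noteq> 0}"
  have Y: "finite Y" "Y \<subseteq> {..<N}" "card Y \<le> D"
    using sparse_finite[OF sp] sp by (auto simp: sparse_def not_less[symmetric] Y_def)
  have Q0: "Q > 0"
  proof -
    obtain i where "d i \<noteq> 0" using d0 by auto
    then have i: "i \<in> {..<N}" "0 < (d i)\<^sup>2" using Y(2) by (auto simp: Y_def)
    have "(d i)\<^sup>2 \<le> Q" unfolding Q_def by (rule member_le_sum[of _ _ "\<lambda>i. (d i)\<^sup>2"]) (use i in auto)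
    then show ?thesis using i by linarith
  qed
  have N0: "real N > 0" "real \<Delta> > 0" "real D > 0"
    using \<Delta> K by (simp_all add: N D)
  \<comment> \<open>With this mesh the image of the rounding error is at most
    \<open>m / \<Delta> ^ 20 * Q\<close>, matching \<open>small\<close>, while the rounding error
    itself has energy at most \<open>D\<close> times the squared mesh, which is
    \<open>4 * Q / \<Delta> ^ 29\<close>.\<close>
  define s where "s = sqrt (Q / (N * \<Delta> ^ 21))"
  have "Q / (N * \<Delta> ^ 21) > 0" using Q0 N0 by (intro divide_pos_pos) auto
  then have s2: "s\<^sup>2 = Q / (N * \<Delta> ^ 21)" and s0: "s > 0"
    unfolding s_def by (rule real_sqrt_pow2[OF less_imp_le], rule real_sqrt_gt_zero)
  obtain n :: "nat \<Rightarrow> int" where nn: "(\<forall>i. i \<notin> Y \<longrightarrow> n i = 0) \<and> (\<forall>i\<in>Y. \<bar>d i - s * n i\<bar> \<le> s) \<and>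
    (\<Sum>l<m. (\<Sum>i\<in>Y. A l i * (d i - s * n i))\<^sup>2) \<le> s\<^sup>2 * (\<Sum>l<m. \<Sum>i\<in>Y. (A l i)\<^sup>2)"
    using greedy_rounding[OF Y(1) s0, where d=d and m=m and A=A] by (elim exE) simp
  then have n: "\<And>i. i \<notin> Y \<Longrightarrow> n i = 0" "\<And>i. i \<in> Y \<Longrightarrow> \<bar>d i - s * n i\<bar> \<le> s"
    "(\<Sum>l<m. (\<Sum>i\<in>Y. A l i * (d i - s * n i))\<^sup>2) \<le> s\<^sup>2 * (\<Sum>l<m. \<Sum>i\<in>Y. (A l i)\<^sup>2)"
    by simp_all
  define n' where "n' = (\<lambda>i. real_of_int (n i))"
  have inY: "(\<Sum>i<N. g i * (d i - s * n i)) = (\<Sum>i\<in>Y. g i * (d i - s * n i))" for g :: "nat \<Rightarrow> real"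
    using Y n(1) by (intro sum.mono_neutral_right) (auto simp: Y_def)
  have dn: "L2_set (\<lambda>i. d i - s * n' i) {..<N} \<le> sqrt Q / 2"
  proof -
    have "(\<Sum>i<N. (d i - s * n' i)\<^sup>2) = (\<Sum>i\<in>Y. (d i - s * n' i)\<^sup>2)"
      using Y n(1) unfolding n'_def by (intro sum.mono_neutral_right) (auto simp: Y_def)
    also have "\<dots> \<le> (\<Sum>i\<in>Y. s\<^sup>2)"
      unfolding n'_def using n(2) s0 by (intro sum_mono) (auto simp: abs_le_square_iff[symmetric])
    also have "\<dots> = card Y * s\<^sup>2" by simp
    also have "\<dots> \<le> D * s\<^sup>2" using Y(3) by (intro mult_right_mono) auto
    also have "\<dots> = Q * (4 / \<Delta> ^ 29)"
      unfolding s2 D N using K N0 by (simp add: field_simps power_add[symmetric])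
    also have "\<dots> \<le> Q * (1 / 4)"
    proof -
      have "(4::real) ^ 29 \<le> real \<Delta> ^ 29" using \<Delta> by (intro power_mono) auto
      then have "16 \<le> real \<Delta> ^ 29" by simp
      then show ?thesis using Q0 N0 by (intro mult_left_mono) (auto simp: field_simps)
    qed
    also have "\<dots> = (sqrt Q / 2)\<^sup>2" using Q0 by (simp add: power_divide)
    finally show ?thesis unfolding L2_set_def using Q0 by (intro real_le_lsqrt) auto
  qed
  have sn: "L2_set (\<lambda>i. s * n' i) {..<N} = s * L2_set n' {..<N}"
    using s0 by (simp add: L2_set_def power_mult_distrib sum_distrib_left[symmetric] real_sqrt_mult)
  have dQ: "L2_set d {..<N} = sqrt Q" by (simp add: L2_set_def Q_def)
  have up: "s * L2_set n' {..<N} \<le> 3/2 * sqrt Q"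
  proof -
    have "L2_set (\<lambda>i. s * n' i) {..<N} = L2_set (\<lambda>i. d i + (s * n' i - d i)) {..<N}" by simp
    also have "\<dots> \<le> L2_set d {..<N} + L2_set (\<lambda>i. s * n' i - d i) {..<N}" by (rule L2_set_triangle_ineq)
    also have "L2_set (\<lambda>i. s * n' i - d i) {..<N} = L2_set (\<lambda>i. d i - s * n' i) {..<N}"
      by (simp add: L2_set_def power2_commute)
    finally show ?thesis using dn sn dQ by simp
  qed
  have lo: "sqrt Q / 2 \<le> s * L2_set n' {..<N}"
  proof -
    have "L2_set d {..<N} = L2_set (\<lambda>i. (d i - s * n' i) + s * n' i) {..<N}" by simp
    also have "\<dots> \<le> L2_set (\<lambda>i. d i - s * n' i) {..<N} + L2_set (\<lambda>i. s * n' i) {..<N}" by (rule L2_set_triangle_ineq)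
    finally show ?thesis using dn sn dQ by simp
  qed
  have lo2: "Q \<le> 4 * s\<^sup>2 * (\<Sum>i<N. (n' i)\<^sup>2)"
  proof -
    have "(sqrt Q)\<^sup>2 \<le> (2 * (s * L2_set n' {..<N}))\<^sup>2" using lo Q0 by (intro power_mono) auto
    then show ?thesis using Q0 by (simp add: power_mult_distrib L2_set_def sum_nonneg)
  qed
  have n0: "\<exists>i<N. n i \<noteq> 0"
  proof (rule ccontr)
    assume "\<not> ?thesis"
    then have "(\<Sum>i<N. (n' i)\<^sup>2) = 0" by (intro sum.neutral) (auto simp: n'_def)
    then show False using lo2 Q0 by simp
  qed
  have spn: "sparse N D n"
  proof -
    have "{c. n c \<noteq> 0} \<subseteq> Y" using n(1) by auto
    then have "card {c. n c \<noteq> 0} \<le> D" using card_mono[OF Y(1)] Y(3) order_trans by blast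
    then show ?thesis using n(1) Y(2) by (auto simp: sparse_def not_less[symmetric])
  qed
  \<comment> \<open>Cauchy-Schwarz on the support: the rounded vector, in units of the mesh, has
    energy at most \<open>9 / 4 * N * \<Delta> ^ 21\<close>, of order
    \<open>K * \<Delta> ^ 29\<close>. Multiplying by \<open>D\<close> and taking the root gives
    \<open>\<Delta> ^ 15 * D\<close>.\<close>
  have l1: "(\<Sum>c<N. \<bar>n c\<bar>) \<le> int (\<Delta> ^ 15 * D)"
  proof -
    have "real_of_int (\<Sum>c<N. \<bar>n c\<bar>) = (\<Sum>c\<in>Y. \<bar>n' c\<bar>)"
      unfolding n'_def of_int_sum of_int_abs using Y n(1) by (intro sum.mono_neutral_right) auto
    also have "\<dots> \<le> sqrt (card Y * (\<Sum>i\<in>Y. (n' i)\<^sup>2))" by (rule sum_abs_le_sqrt)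
    also have "\<dots> \<le> sqrt (D * (\<Sum>i<N. (n' i)\<^sup>2))"
      using Y by (intro real_sqrt_le_mono mult_mono sum_mono2) (auto intro!: sum_nonneg)
    also have "\<dots> \<le> sqrt ((\<Delta> ^ 15 * D)\<^sup>2)"
    proof (rule real_sqrt_le_mono)
      have "(s * L2_set n' {..<N})\<^sup>2 \<le> (3/2 * sqrt Q)\<^sup>2"
        using up s0 by (intro power_mono) auto
      then have "s\<^sup>2 * (\<Sum>i<N. (n' i)\<^sup>2) \<le> 9/4 * Q"
        using Q0 by (simp add: power_mult_distrib L2_set_def sum_nonneg power_divide)
      then have "(\<Sum>i<N. (n' i)\<^sup>2) \<le> 9/4 * (N * \<Delta> ^ 21)"
        unfolding s2 using Q0 N0 by (simp add: field_simps)
      then have "real D * (\<Sum>i<N. (n' i)\<^sup>2) \<le> real D * (9/4 * (N * \<Delta> ^ 21))" by (intro mult_left_mono) auto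
      also have "\<dots> = 9 / 16 * (real D)\<^sup>2 * \<Delta> ^ 29"
        unfolding N D by (simp add: power2_eq_square power_add[symmetric] mult_ac)
      also have "\<dots> \<le> (1 * (real D)\<^sup>2) * \<Delta> ^ 30"
        using \<Delta> N0 by (intro mult_mono power_increasing) auto
      also have "\<dots> = real ((\<Delta> ^ 15 * D)\<^sup>2)" by (simp add: power_mult_distrib power_mult[symmetric] mult.commute)
      finally show "real D * (\<Sum>i<N. (n' i)\<^sup>2) \<le> real ((\<Delta> ^ 15 * D)\<^sup>2)" .
    qed
    also have "\<dots> = real (\<Delta> ^ 15 * D)" by (simp only: real_sqrt_abs abs_of_nat of_nat_power)
    finally show ?thesis by linarith
  qed
  have mem: "n \<in> lattice_vecs N D (\<Delta> ^ 15 * D)" using spn l1 by (simp add: lattice_vecs_def)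
  have "s\<^sup>2 * (\<Sum>l<m. (inner_n N (A l) n')\<^sup>2) = (\<Sum>l<m. (inner_n N (A l) d + - (\<Sum>i\<in>Y. A l i * (d i - s * n i)))\<^sup>2)"
  proof -
    have "inner_n N (A l) d + - (\<Sum>i\<in>Y. A l i * (d i - s * n i)) = s * inner_n N (A l) n'" for l
      unfolding inY[symmetric] inner_n_def n'_def by (simp add: algebra_simps sum_subtractf sum_distrib_left)
    then show ?thesis by (simp add: power_mult_distrib sum_distrib_left)
  qed
  also have "\<dots> \<le> 2 * (\<Sum>l<m. (inner_n N (A l) d)\<^sup>2) + 2 * (\<Sum>l<m. (- (\<Sum>i\<in>Y. A l i * (d i - s * n i)))\<^sup>2)"
    by (rule sum_square_le2)
  also have "\<dots> < 2 * (m / \<Delta> ^ 20 * Q) + 2 * (m / \<Delta> ^ 20 * Q)"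
  proof -
    have "(\<Sum>l<m. (- (\<Sum>i\<in>Y. A l i * (d i - s * n i)))\<^sup>2) \<le> s\<^sup>2 * (\<Sum>l<m. \<Sum>i\<in>Y. (A l i)\<^sup>2)" using n(3) by simp
    also have "\<dots> \<le> s\<^sup>2 * (\<Sum>l<m. \<Sum>i<N. (A l i)\<^sup>2)"
      using Y by (intro mult_left_mono sum_mono sum_mono2) auto
    also have "\<dots> \<le> s\<^sup>2 * (m * N * \<Delta>)" using en by (intro mult_left_mono) auto
    also have "\<dots> = m / \<Delta> ^ 20 * Q" unfolding s2 using N0 by (simp add: field_simps eval_nat_numeral)
    finally show ?thesis using small unfolding Q_def[symmetric] by linarith
  qed
  also have "\<dots> = 4 * m / \<Delta> ^ 20 * Q" by simp
  also have "\<dots> \<le> 4 * m / \<Delta> ^ 20 * (4 * s\<^sup>2 * (\<Sum>i<N. (n' i)\<^sup>2))" using lo2 by (intro mult_left_mono) auto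
  also have "\<dots> = s\<^sup>2 * (16 * m / \<Delta> ^ 20 * (\<Sum>i<N. (n' i)\<^sup>2))" by simp
  finally have "s\<^sup>2 * (\<Sum>l<m. (inner_n N (A l) n')\<^sup>2) < s\<^sup>2 * (16 * m / \<Delta> ^ 20 * (\<Sum>i<N. (n' i)\<^sup>2))" .
  then have "(\<Sum>l<m. (inner_n N (A l) n')\<^sup>2) < 16 * m / \<Delta> ^ 20 * (\<Sum>i<N. (n' i)\<^sup>2)"
    by (rule mult_left_less_imp_less[OF _ zero_le_power2])
  then show ?thesis unfolding n'_def using n0 by (intro bexI[OF _ mem] conjI) simp_all
qed

section \<open>Random matrices bounded below on sparse vectors\<close>

text \<open>If the total is small, half of the rows are at most twice the mean. Fixing these rows
  lets the independence of rows produce a power of the one-row probability.\<close>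

lemma card_small_rows:
  fixes f :: "nat \<Rightarrow> real" and t :: real
  assumes "(\<Sum>l<2 * h. f l) < 2 * h * t" "\<And>l. 0 \<le> f l" "0 \<le> t"
  shows "\<exists>R. R \<subseteq> {..<2 * h} \<and> card R = h \<and> (\<forall>l\<in>R. f l \<le> 2 * t)"
proof -
  define S where "S = {l. l < 2 * h \<and> f l \<le> 2 * t}"
  have fin: "finite S" "S \<subseteq> {..<2 * h}" by (auto simp: S_def)
  have "h \<le> card S"
  proof (rule ccontr)
    assume "\<not> h \<le> card S"
    then have c: "h \<le> card ({..<2 * h} - S)" using fin by (simp add: card_Diff_subset)
    have "2 * h * t = h * (2 * t)" by simp
    also have "\<dots> \<le> card ({..<2 * h} - S) * (2 * t)" using c assms(3) by (intro mult_right_mono) auto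
    also have "\<dots> = (\<Sum>l\<in>{..<2 * h} - S. 2 * t)" by simp
    also have "\<dots> \<le> (\<Sum>l\<in>{..<2 * h} - S. f l)" by (intro sum_mono) (auto simp: S_def)
    also have "\<dots> \<le> (\<Sum>l<2 * h. f l)" using assms(2) by (intro sum_mono2) auto
    finally show False using assms(1) by simp
  qed
  then obtain R where "R \<subseteq> S" "card R = h" using obtain_subset_with_card_n by blast
  then show ?thesis using fin by (intro exI[of _ R]) (auto simp: S_def)
qed

definition gmat :: "nat \<Rightarrow> nat \<Rightarrow> real pmf \<Rightarrow> (nat \<Rightarrow> nat \<Rightarrow> real) pmf" where
  "gmat m N p = Pi_pmf {..<m} (\<lambda>_. 0) (\<lambda>_. Pi_pmf {..<N} 0 (\<lambda>_. p))"

lemma finite_gmat: "finite (set_pmf p) \<Longrightarrow> finite (set_pmf (gmat m N p))"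
  unfolding gmat_def by (intro finite_set_Pi_pmf) auto

text \<open>For a fixed half of the rows independence gives the power \<open>h\<close>, and there
  are at most \<open>4 ^ h\<close> halves.\<close>

lemma gmat_small_rows:
  assumes fin: "finite (set_pmf p)"
    and row: "measure_pmf.prob (Pi_pmf {..<N} 0 (\<lambda>_. p)) {a. Q a} \<le> \<beta>"
  shows "measure_pmf.prob (gmat (2 * h) N p) {A. \<exists>R. R \<subseteq> {..<2 * h} \<and> card R = h \<and> (\<forall>l\<in>R. Q (A l))}
    \<le> 4 ^ h * \<beta> ^ h"
proof -
  let ?RR = "{R. R \<subseteq> {..<2 * h} \<and> card R = h}"
  have finR: "finite ?RR" by (rule finite_subset[of _ "Pow {..<2 * h}"]) auto
  have b0: "0 \<le> \<beta>" using row by (rule order_trans[rotated]) simp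
  have one: "measure_pmf.prob (gmat (2 * h) N p) {A. \<forall>l\<in>R. Q (A l)} \<le> \<beta> ^ h" if "R \<in> ?RR" for R
  proof -
    let ?B = "\<lambda>l. if l \<in> R then {a. Q a} else UNIV"
    have "measure_pmf.prob (gmat (2 * h) N p) {A. \<forall>l\<in>R. Q (A l)} = measure_pmf.prob (gmat (2 * h) N p) (Pi {..<2 * h} ?B)"
      using that by (intro arg_cong[where f = "measure_pmf.prob (gmat (2 * h) N p)"]) (auto simp: Pi_def)
    also have "\<dots> = (\<Prod>l<2 * h. measure_pmf.prob (Pi_pmf {..<N} 0 (\<lambda>_. p)) (?B l))"
      unfolding gmat_def by (rule measure_Pi_pmf_Pi) simp
    also have "\<dots> = (\<Prod>l\<in>R. measure_pmf.prob (Pi_pmf {..<N} 0 (\<lambda>_. p)) {a. Q a})"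
      using that by (intro prod.mono_neutral_cong_right) auto
    also have "\<dots> = measure_pmf.prob (Pi_pmf {..<N} 0 (\<lambda>_. p)) {a. Q a} ^ h" using that by simp
    also have "\<dots> \<le> \<beta> ^ h" using row by (intro power_mono) auto
    finally show ?thesis .
  qed
  have "measure_pmf.prob (gmat (2 * h) N p) {A. \<exists>R. R \<subseteq> {..<2 * h} \<and> card R = h \<and> (\<forall>l\<in>R. Q (A l))}
    = measure_pmf.prob (gmat (2 * h) N p) {A. \<exists>R\<in>?RR. \<forall>l\<in>R. Q (A l)}"
    by (intro arg_cong[where f = "measure_pmf.prob (gmat (2 * h) N p)"]) auto
  also have "\<dots> \<le> (\<Sum>R\<in>?RR. measure_pmf.prob (gmat (2 * h) N p) {A. \<forall>l\<in>R. Q (A l)})"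
    by (rule prob_Bex[OF finR])
  also have "\<dots> \<le> (\<Sum>R\<in>?RR. \<beta> ^ h)" by (rule sum_mono[OF one])
  also have "\<dots> = real (card ?RR) * \<beta> ^ h" by simp
  also have "\<dots> \<le> 4 ^ h * \<beta> ^ h"
  proof -
    have "card ?RR \<le> card (Pow {..<2 * h})" by (intro card_mono) auto
    also have "\<dots> = 4 ^ h" by (simp add: card_Pow power_mult)
    finally have "real (card ?RR) \<le> real (4 ^ h)" by (simp only: of_nat_le_iff)
    then show ?thesis using b0 by (intro mult_right_mono) auto
  qed
  finally show ?thesis .
qed

lemma gmat_energy:
  assumes fin: "finite (set_pmf p)" and sq: "E p (\<lambda>g. g\<^sup>2) \<le> 1" and t: "0 < (t::real)"
  shows "measure_pmf.prob (gmat m N p) {A. (\<Sum>l<m. \<Sum>i<N. (A l i)\<^sup>2) > m * N * t} \<le> 1 / t"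
proof -
  note f = finite_gmat[OF fin, of m N]
  have fP: "finite (set_pmf (Pi_pmf {..<N} 0 (\<lambda>_. p)))" using fin by (intro finite_set_Pi_pmf) auto
  have "E (gmat m N p) (\<lambda>A. \<Sum>l<m. \<Sum>i<N. (A l i)\<^sup>2) = (\<Sum>l<m. E (gmat m N p) (\<lambda>A. \<Sum>i<N. (A l i)\<^sup>2))"
    by (rule E_sum[OF f])
  also have "\<dots> = (\<Sum>l<m. E (Pi_pmf {..<N} 0 (\<lambda>_. p)) (\<lambda>a. \<Sum>i<N. (a i)\<^sup>2))"
    unfolding gmat_def by (intro sum.cong refl E_Pi_component) auto
  also have "\<dots> = (\<Sum>l<m. \<Sum>i<N. E p (\<lambda>g. g\<^sup>2))"
    unfolding E_sum[OF fP] by (intro sum.cong refl E_Pi_component) auto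
  also have "\<dots> \<le> (\<Sum>l<m. \<Sum>i<N. 1)" by (intro sum_mono sq)
  finally have "E (gmat m N p) (\<lambda>A. \<Sum>l<m. \<Sum>i<N. (A l i)\<^sup>2) \<le> m * N" by simp
  then show ?thesis using markov[OF f, of "\<lambda>A. \<Sum>l<m. \<Sum>i<N. (A l i)\<^sup>2" "m * N" t] t by (simp add: sum_nonneg)
qed

lemma gmat_noise:
  assumes fin: "finite (set_pmf p)" and z: "E p (\<lambda>g. g) = 0" and sq: "E p (\<lambda>g. g\<^sup>2) \<le> 1" and t: "0 < (t::real)"
  shows "measure_pmf.prob (gmat m N p)
    {A. (\<Sum>j\<in>J. \<Sum>l<m. (inner_n N (A l) (e j))\<^sup>2) > (m * (\<Sum>j\<in>J. \<Sum>i<N. (e j i)\<^sup>2)) * t} \<le> 1 / t"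
proof (rule markov[OF finite_gmat[OF fin]])
  note f = finite_gmat[OF fin, of m N]
  have "E (gmat m N p) (\<lambda>A. (\<Sum>j\<in>J. \<Sum>l<m. (inner_n N (A l) (e j))\<^sup>2))
     = (\<Sum>j\<in>J. \<Sum>l<m. E (gmat m N p) (\<lambda>A. (inner_n N (A l) (e j))\<^sup>2))"
    by (simp only: E_sum[OF f])
  also have "\<dots> = (\<Sum>j\<in>J. \<Sum>l<m. E (Pi_pmf {..<N} 0 (\<lambda>_. p)) (\<lambda>a. (inner_n N a (e j))\<^sup>2))"
    unfolding gmat_def by (intro sum.cong refl E_Pi_component) auto
  also have "\<dots> \<le> (\<Sum>j\<in>J. \<Sum>l<m. \<Sum>i<N. (e j i)\<^sup>2)"
    unfolding inner_n_def using fin z sq by (intro sum_mono E_weighted_sum_sq) auto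
  also have "\<dots> = m * (\<Sum>j\<in>J. \<Sum>i<N. (e j i)\<^sup>2)" by (simp add: sum_distrib_left)
  finally show "E (gmat m N p) (\<lambda>A. (\<Sum>j\<in>J. \<Sum>l<m. (inner_n N (A l) (e j))\<^sup>2)) \<le> m * (\<Sum>j\<in>J. \<Sum>i<N. (e j i)\<^sup>2)" .
qed (auto intro!: sum_nonneg t)

text \<open>The lower half of a restricted isometry property, normalised per row. The matching upper
  estimate is asked only for given noise vectors and comes from \<open>gmat_noise\<close>.\<close>

definition lower_iso :: "nat \<Rightarrow> nat \<Rightarrow> nat \<Rightarrow> real \<Rightarrow> (nat \<Rightarrow> nat \<Rightarrow> real) \<Rightarrow> bool" where
  "lower_iso m N D \<kappa> A \<longleftrightarrow>
    (\<forall>d. sparse N D d \<longrightarrow> m * \<kappa> * (\<Sum>i<N. (d i)\<^sup>2) \<le> (\<Sum>l<m. (inner_n N (A l) d)\<^sup>2))"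

text \<open>A union bound between two powers of exponent \<open>4 * K\<close>. The number of lattice
  vectors contributes \<open>\<Delta> ^ 23\<close> to the base: 15 from the norm bound and 8 from
  \<open>N / K\<close>. Half of the \<open>32 * K\<close> rows being small contributes the fourth
  power of \<open>1 / \<Delta> ^ 10\<close>. So 32 rows per unit of \<open>K\<close> win with room
  to spare. The second \<open>1 / \<Delta>\<close> is the chance that the entries of the matrix are
  too large for rounding.\<close>

lemma lower_iso_prob:
  fixes \<Delta> K :: nat
  assumes \<Delta>: "\<Delta> \<ge> 4" and K: "K \<ge> 1"
    and N: "N = \<Delta> ^ 8 * K"
    and fin: "finite (set_pmf p)" and sq: "E p (\<lambda>g. g\<^sup>2) \<le> 1"
    and sb: "\<And>d \<tau>. 1 / \<Delta> ^ 10 \<le> \<tau> \<Longrightarrow> (\<exists>i<N. d i \<noteq> 0) \<Longrightarrow>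
      measure_pmf.prob (Pi_pmf {..<N} 0 (\<lambda>_. p)) {a. (inner_n N a d)\<^sup>2 \<le> \<tau>\<^sup>2 * (\<Sum>i<N. (d i)\<^sup>2)} \<le> 2 * \<tau>"
  shows "measure_pmf.prob (gmat (32 * K) N p) {A. \<not> lower_iso (32 * K) N (4 * K) (1 / \<Delta> ^ 20) A} \<le> 2 / \<Delta>"
proof -
  let ?P = "gmat (32 * K) N p"
  define h where "h = 16 * K"
  define LV where "LV = {f \<in> lattice_vecs N (4 * K) (\<Delta> ^ 15 * (4 * K)). \<exists>i<N. f i \<noteq> 0}"
  \<comment> \<open>Half of the rows are at most twice the mean bound, that is
    \<open>32 / \<Delta> ^ 20\<close> relative to the energy; \<open>6 ^ 2\<close> is a square above
    32.\<close>
  define Q where "Q = (\<lambda>f::nat \<Rightarrow> int. \<lambda>a. (inner_n N a (\<lambda>i. real_of_int (f i)))\<^sup>2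
      \<le> (6 / \<Delta> ^ 10)\<^sup>2 * (\<Sum>i<N. (real_of_int (f i))\<^sup>2))"
  have m: "32 * K = 2 * h" by (simp add: h_def)
  have \<Delta>0: "real \<Delta> > 0" using \<Delta> by simp
  have "measure_pmf.prob ?P {A. \<not> lower_iso (32 * K) N (4 * K) (1 / \<Delta> ^ 20) A}
    \<le> measure_pmf.prob ?P {A. (\<Sum>l<32 * K. \<Sum>i<N. (A l i)\<^sup>2) > (32 * K) * N * \<Delta> \<or>
        (\<exists>f\<in>LV. \<exists>R. R \<subseteq> {..<2 * h} \<and> card R = h \<and> (\<forall>l\<in>R. Q f (A l)))}"
  proof (rule prob_mono, rule disjCI)
    fix A assume nl: "\<not> lower_iso (32 * K) N (4 * K) (1 / \<Delta> ^ 20) A"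
      and ne: "\<not> (\<exists>f\<in>LV. \<exists>R. R \<subseteq> {..<2 * h} \<and> card R = h \<and> (\<forall>l\<in>R. Q f (A l)))"
    obtain d where d: "sparse N (4 * K) d"
      "(\<Sum>l<32 * K. (inner_n N (A l) d)\<^sup>2) < real (32 * K) / \<Delta> ^ 20 * (\<Sum>i<N. (d i)\<^sup>2)"
      using nl unfolding lower_iso_def by (auto simp: not_le)
    have d0: "d \<noteq> (\<lambda>_. 0)"
    proof
      assume "d = (\<lambda>_. 0)" then show False using d(2) by (simp add: inner_n_def)
    qed
    show "(\<Sum>l<32 * K. \<Sum>i<N. (A l i)\<^sup>2) > (32 * K) * N * \<Delta>"
    proof (rule ccontr)
      assume "\<not> ?thesis"
      then have "(\<Sum>l<32 * K. \<Sum>i<N. (A l i)\<^sup>2) \<le> real (32 * K * N * \<Delta>)" by simp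
      then obtain f where f: "f \<in> LV"
        "(\<Sum>l<32 * K. (inner_n N (A l) (\<lambda>i. real_of_int (f i)))\<^sup>2) < 16 * real (32 * K) / \<Delta> ^ 20 * (\<Sum>i<N. (real_of_int (f i))\<^sup>2)"
        using sparse_lower_bound_lattice[OF \<Delta> K N refl d(1) d0, where m="32 * K" and A=A] d(2) unfolding LV_def by auto
      define t where "t = 16 / \<Delta> ^ 20 * (\<Sum>i<N. (real_of_int (f i))\<^sup>2)"
      have t0: "0 \<le> t" unfolding t_def by (intro mult_nonneg_nonneg sum_nonneg) auto
      have "(\<Sum>l<2 * h. (inner_n N (A l) (\<lambda>i. real_of_int (f i)))\<^sup>2) < 2 * real h * t"
        using f(2) unfolding m[symmetric] t_def by (simp add: h_def)
      from card_small_rows[OF this _ t0]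
      obtain R where R: "R \<subseteq> {..<2 * h}" "card R = h" "\<forall>l\<in>R. (inner_n N (A l) (\<lambda>i. real_of_int (f i)))\<^sup>2 \<le> 2 * t"
        by auto
      have "2 * t \<le> (6 / \<Delta> ^ 10)\<^sup>2 * (\<Sum>i<N. (real_of_int (f i))\<^sup>2)"
        unfolding t_def by (simp add: power_divide power_mult[symmetric] divide_right_mono sum_nonneg mult_right_mono)
      then have "\<forall>l\<in>R. Q f (A l)" using R(3) unfolding Q_def by force
      then show False using ne f(1) R(1,2) by blast
    qed
  qed
  also have "\<dots> \<le> measure_pmf.prob ?P {A. (\<Sum>l<32 * K. \<Sum>i<N. (A l i)\<^sup>2) > (32 * K) * N * \<Delta>}
     + measure_pmf.prob ?P {A. \<exists>f\<in>LV. \<exists>R. R \<subseteq> {..<2 * h} \<and> card R = h \<and> (\<forall>l\<in>R. Q f (A l))}"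
    by (rule prob_disj)
  also have "\<dots> \<le> 1 / \<Delta> + 1 / \<Delta>"
  proof (rule add_mono)
    show "measure_pmf.prob ?P {A. (\<Sum>l<32 * K. \<Sum>i<N. (A l i)\<^sup>2) > (32 * K) * N * \<Delta>} \<le> 1 / \<Delta>"
      using gmat_energy[OF fin sq \<Delta>0, of "32 * K" N] by simp
    have finLV: "finite LV" unfolding LV_def by (simp add: finite_lattice_vecs)
    have "measure_pmf.prob ?P {A. \<exists>f\<in>LV. \<exists>R. R \<subseteq> {..<2 * h} \<and> card R = h \<and> (\<forall>l\<in>R. Q f (A l))}
      \<le> (\<Sum>f\<in>LV. measure_pmf.prob ?P {A. \<exists>R. R \<subseteq> {..<2 * h} \<and> card R = h \<and> (\<forall>l\<in>R. Q f (A l))})"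
      by (rule prob_Bex[OF finLV])
    also have "\<dots> \<le> (\<Sum>f\<in>LV. 4 ^ h * (12 / \<Delta> ^ 10) ^ h)"
    proof (rule sum_mono)
      fix f assume "f \<in> LV"
      then have nz: "\<exists>i<N. real_of_int (f i) \<noteq> 0" by (auto simp: LV_def)
      have "1 / real (\<Delta> ^ 10) \<le> 6 / real (\<Delta> ^ 10)" by (intro divide_right_mono) auto
      from sb[OF this nz] have "measure_pmf.prob (Pi_pmf {..<N} 0 (\<lambda>_. p)) {a. Q f a} \<le> 12 / \<Delta> ^ 10"
        unfolding Q_def by simp
      from gmat_small_rows[OF fin this, of h]
      show "measure_pmf.prob ?P {A. \<exists>R. R \<subseteq> {..<2 * h} \<and> card R = h \<and> (\<forall>l\<in>R. Q f (A l))} \<le> 4 ^ h * (12 / \<Delta> ^ 10) ^ h"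
        unfolding m .
    qed
    also have "\<dots> = real (card LV) * (48 / \<Delta> ^ 10) ^ h"
      by (simp add: power_mult_distrib[symmetric])
    also have "\<dots> \<le> (18 * real (\<Delta> ^ 15) * real N / real (4 * K)) ^ (4 * K) * (48 / \<Delta> ^ 10) ^ h"
    proof (rule mult_right_mono)
      have "real (card LV) \<le> real (card (lattice_vecs N (4 * K) (\<Delta> ^ 15 * (4 * K))))"
        unfolding LV_def using card_mono[OF finite_lattice_vecs] by (metis (no_types, lifting) mem_Collect_eq of_nat_le_iff subsetI)
      also have "\<dots> \<le> (18 * real (\<Delta> ^ 15) * real N / real (4 * K)) ^ (4 * K)"
      proof (rule card_lattice_vecs)
        show "1 \<le> \<Delta> ^ 15" "1 \<le> 4 * K" using \<Delta> K by auto
        have "4 ^ 1 \<le> \<Delta> ^ 8" by (rule order_trans[OF _ power_mono[OF \<Delta>]]) auto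
        then show "4 * K \<le> N" unfolding N by (intro mult_right_mono) auto
      qed
      finally show "real (card LV) \<le> (18 * real (\<Delta> ^ 15) * real N / real (4 * K)) ^ (4 * K)" .
    qed simp
    also have "\<dots> = (18 * real (\<Delta> ^ 15) * real N / real (4 * K) * (48 / \<Delta> ^ 10) ^ 4) ^ (4 * K)"
    proof -
      have "h = 4 * (4 * K)" by (simp add: h_def)
      then show ?thesis by (simp only: power_mult power_mult_distrib)
    qed
    \<comment> \<open>\<open>18 / 4 * 48 ^ 4 = 23887872\<close> and
      \<open>15 + 8 - 40 = - 17\<close>.\<close>
    also have "18 * real (\<Delta> ^ 15) * real N / real (4 * K) * (48 / \<Delta> ^ 10) ^ 4 = 23887872 / real \<Delta> ^ 17"
    proof -
      have "(\<Delta>::real) ^ 23 * \<Delta> ^ 17 = \<Delta> ^ 40" by (simp add: power_add[symmetric])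
      then show ?thesis unfolding N using K \<Delta>0
        by (simp add: power_divide power_mult[symmetric] field_simps power_add[symmetric])
    qed
    also have "(23887872 / real \<Delta> ^ 17) ^ (4 * K) \<le> (23887872 / real \<Delta> ^ 17) ^ 1"
    proof (rule power_decreasing)
      have "(4::real) ^ 17 \<le> real \<Delta> ^ 17" using \<Delta> by (intro power_mono) auto
      then show "23887872 / real \<Delta> ^ 17 \<le> 1" using \<Delta>0 by simp
    qed (use K in auto)
    also have "\<dots> \<le> 1 / \<Delta>"
    proof -
      have "(4::real) ^ 16 \<le> real \<Delta> ^ 16" using \<Delta> by (intro power_mono) auto
      then have "23887872 \<le> real \<Delta> ^ 16" by simp
      then have "23887872 * real \<Delta> \<le> real \<Delta> ^ 16 * \<Delta>" using \<Delta>0 by (intro mult_right_mono) auto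
      then have "23887872 * real \<Delta> \<le> real \<Delta> ^ 17" by (simp add: power_Suc2[symmetric])
      then show ?thesis using \<Delta>0 by (simp add: field_simps)
    qed
    finally show "measure_pmf.prob ?P {A. \<exists>f\<in>LV. \<exists>R. R \<subseteq> {..<2 * h} \<and> card R = h \<and> (\<forall>l\<in>R. Q f (A l))} \<le> 1 / \<Delta>" .
  qed
  finally show ?thesis by simp
qed

section \<open>Sparse least squares\<close>

text \<open>Gram-Schmidt by induction on the support solves the normal equations even when columns
  are dependent: the new column is replaced by its residual \<open>v\<close>, orthogonal to the old
  ones, and one more coefficient is fitted along \<open>v\<close>.\<close>

lemma least_squares_support:
  fixes A :: "nat \<Rightarrow> nat \<Rightarrow> real" and b :: "nat \<Rightarrow> real"
  assumes "finite Y"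
  shows "\<exists>z. (\<forall>i. i \<notin> Y \<longrightarrow> z i = 0) \<and> (\<forall>j\<in>Y. (\<Sum>l<m. (b l - (\<Sum>i\<in>Y. A l i * z i)) * A l j) = 0)"
  using assms
proof (induction Y arbitrary: b rule: finite_induct)
  case empty then show ?case by (intro exI[of _ "\<lambda>_. 0"]) auto
next
  case (insert k Y)
  obtain z where z: "\<forall>i. i \<notin> Y \<longrightarrow> z i = 0" "\<forall>j\<in>Y. (\<Sum>l<m. (b l - (\<Sum>i\<in>Y. A l i * z i)) * A l j) = 0"
    using insert.IH[of b] by blast
  obtain u where u: "\<forall>i. i \<notin> Y \<longrightarrow> u i = 0" "\<forall>j\<in>Y. (\<Sum>l<m. (A l k - (\<Sum>i\<in>Y. A l i * u i)) * A l j) = 0"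
    using insert.IH[of "\<lambda>l. A l k"] by blast
  define v where "v = (\<lambda>l. A l k - (\<Sum>i\<in>Y. A l i * u i))"
  define r where "r = (\<lambda>l. b l - (\<Sum>i\<in>Y. A l i * z i))"
  have v: "(\<Sum>l<m. v l * A l j) = 0" if "j \<in> Y" for j using u(2) that unfolding v_def by blast
  have r: "(\<Sum>l<m. r l * A l j) = 0" if "j \<in> Y" for j using z(2) that unfolding r_def by blast
  have vY: "(\<Sum>l<m. g l * (\<Sum>i\<in>Y. A l i * u i)) = 0" if "\<And>j. j \<in> Y \<Longrightarrow> (\<Sum>l<m. g l * A l j) = 0" for g :: "nat \<Rightarrow> real"
  proof -
    have "(\<Sum>l<m. g l * (\<Sum>i\<in>Y. A l i * u i)) = (\<Sum>i\<in>Y. \<Sum>l<m. g l * (A l i * u i))"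
      unfolding sum_distrib_left by (rule sum.swap)
    also have "\<dots> = (\<Sum>i\<in>Y. u i * (\<Sum>l<m. g l * A l i))"
      unfolding sum_distrib_left by (intro sum.cong refl) (simp add: mult_ac)
    finally show ?thesis using that by simp
  qed
  \<comment> \<open>If \<open>v\<close> vanishes, the new column already lies in the span of the old
    ones and the coefficient 0 is as good as any.\<close>
  define \<alpha> where "\<alpha> = (if (\<Sum>l<m. (v l)\<^sup>2) = 0 then 0 else (\<Sum>l<m. r l * v l) / (\<Sum>l<m. (v l)\<^sup>2))"
  define w where "w = (\<lambda>i. z i + \<alpha> * ((if i = k then 1 else 0) - u i))"
  have res: "b l - (\<Sum>i\<in>insert k Y. A l i * w i) = r l - \<alpha> * v l" for l
  proof -
    have "(\<Sum>i\<in>Y. A l i * w i) = (\<Sum>i\<in>Y. A l i * z i) - \<alpha> * (\<Sum>i\<in>Y. A l i * u i)"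
      unfolding w_def sum_distrib_left sum_subtractf[symmetric] using insert.hyps
      by (intro sum.cong refl) (auto simp: algebra_simps)
    moreover have "w k = \<alpha>" using z(1) u(1) insert.hyps by (simp add: w_def)
    ultimately show ?thesis using insert.hyps by (simp add: r_def v_def algebra_simps)
  qed
  have sub: "(\<Sum>l<m. (r l - \<alpha> * v l) * g l) = (\<Sum>l<m. r l * g l) - \<alpha> * (\<Sum>l<m. v l * g l)" for g :: "nat \<Rightarrow> real"
    by (simp add: left_diff_distrib sum_subtractf sum_distrib_left mult.assoc)
  have "(\<Sum>l<m. (b l - (\<Sum>i\<in>insert k Y. A l i * w i)) * A l j) = 0" if "j \<in> insert k Y" for j
  proof (cases "j = k")
    case False
    then show ?thesis unfolding res sub using that v r by simp
  next
    case True
    have rv: "(\<Sum>l<m. r l * A l k) = (\<Sum>l<m. r l * v l)"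
      using vY[of r] r unfolding v_def by (simp add: right_diff_distrib sum_subtractf)
    have vv: "(\<Sum>l<m. v l * A l k) = (\<Sum>l<m. (v l)\<^sup>2)"
    proof -
      have "(\<Sum>l<m. v l * A l k) = (\<Sum>l<m. v l * v l) + (\<Sum>l<m. v l * (\<Sum>i\<in>Y. A l i * u i))"
        unfolding sum.distrib[symmetric] by (intro sum.cong refl) (simp add: v_def algebra_simps)
      then show ?thesis using vY[of v] v by (simp add: power2_eq_square)
    qed
    have "(\<Sum>l<m. r l * v l) = 0" if "(\<Sum>l<m. (v l)\<^sup>2) = 0"
      using that by (simp add: sum_nonneg_eq_0_iff)
    then show ?thesis unfolding res True sub rv vv by (auto simp: \<alpha>_def)
  qed
  then show ?case using z(1) u(1) by (intro exI[of _ w]) (auto simp: w_def)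
qed

text \<open>The minimum is attained: on each of the finitely many supports the normal equations give
  a minimiser, since its residual is orthogonal to every competing change, and the best support is
  then chosen.\<close>

lemma least_squares_sparse:
  fixes A :: "nat \<Rightarrow> nat \<Rightarrow> real" and b :: "nat \<Rightarrow> real"
  shows "\<exists>z. sparse N D z \<and> (\<forall>z'. sparse N D z' \<longrightarrow>
    (\<Sum>l<m. (b l - inner_n N (A l) z)\<^sup>2) \<le> (\<Sum>l<m. (b l - inner_n N (A l) z')\<^sup>2))"
proof -
  define F where "F = (\<lambda>z. \<Sum>l<m. (b l - inner_n N (A l) z)\<^sup>2)"
  define YY where "YY = {Y. Y \<subseteq> {..<N} \<and> card Y \<le> D}"
  have finYY: "finite YY" unfolding YY_def by (rule finite_subset[of _ "Pow {..<N}"]) auto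
  have "\<exists>z. (\<forall>i. i \<notin> Y \<longrightarrow> z i = 0) \<and> (\<forall>z'. (\<forall>i. i \<notin> Y \<longrightarrow> z' i = 0) \<longrightarrow> F z \<le> F z')" if Y: "Y \<in> YY" for Y
  proof -
    have fY: "finite Y" "Y \<subseteq> {..<N}" using Y finite_subset by (auto simp: YY_def)
    obtain z where z: "\<forall>i. i \<notin> Y \<longrightarrow> z i = 0" "\<forall>j\<in>Y. (\<Sum>l<m. (b l - (\<Sum>i\<in>Y. A l i * z i)) * A l j) = 0"
      using least_squares_support[OF fY(1), where m=m and b=b and A=A] by blast
    have inn: "inner_n N (A l) g = (\<Sum>i\<in>Y. A l i * g i)" if "\<forall>i. i \<notin> Y \<longrightarrow> g i = 0" for g l
      unfolding inner_n_def using fY that by (intro sum.mono_neutral_right) auto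
    have "F z \<le> F z'" if z': "\<forall>i. i \<notin> Y \<longrightarrow> z' i = 0" for z'
    proof -
      define r where "r = (\<lambda>l. b l - (\<Sum>i\<in>Y. A l i * z i))"
      define q where "q = (\<lambda>l. \<Sum>i\<in>Y. A l i * (z i - z' i))"
      have "(\<Sum>l<m. r l * q l) = (\<Sum>i\<in>Y. \<Sum>l<m. r l * (A l i * (z i - z' i)))"
        unfolding q_def sum_distrib_left by (rule sum.swap)
      also have "\<dots> = (\<Sum>i\<in>Y. (z i - z' i) * (\<Sum>l<m. r l * A l i))"
        unfolding sum_distrib_left by (intro sum.cong refl) (simp add: mult_ac)
      also have "\<dots> = 0" using z(2) unfolding r_def by simp
      finally have o: "(\<Sum>l<m. r l * q l) = 0" .
      have e: "b l - inner_n N (A l) z' = r l + q l" for l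
        unfolding inn[OF z'] r_def q_def by (simp add: right_diff_distrib sum_subtractf)
      have "F z' = (\<Sum>l<m. (r l)\<^sup>2 + 2 * (r l * q l) + (q l)\<^sup>2)"
        unfolding F_def e by (intro sum.cong refl) (simp add: power2_sum)
      also have "\<dots> = (\<Sum>l<m. (r l)\<^sup>2) + 2 * (\<Sum>l<m. r l * q l) + (\<Sum>l<m. (q l)\<^sup>2)"
        by (simp add: sum.distrib sum_distrib_left)
      also have "\<dots> \<ge> (\<Sum>l<m. (r l)\<^sup>2)" unfolding o by (simp add: sum_nonneg)
      finally show ?thesis unfolding F_def inn[OF z(1)] r_def .
    qed
    then show ?thesis using z(1) by blast
  qed
  then obtain s where s: "\<And>Y i. Y \<in> YY \<Longrightarrow> i \<notin> Y \<Longrightarrow> s Y i = 0"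
    "\<And>Y z'. Y \<in> YY \<Longrightarrow> (\<forall>i. i \<notin> Y \<longrightarrow> z' i = 0) \<Longrightarrow> F (s Y) \<le> F z'"
    by metis
  have "{} \<in> YY" by (simp add: YY_def)
  then obtain Y0 where Y0: "Y0 \<in> YY" "\<And>Y. Y \<in> YY \<Longrightarrow> F (s Y0) \<le> F (s Y)"
    using finYY arg_min_if_finite(1)[of YY "\<lambda>Y. F (s Y)"] arg_min_least[of YY _ "\<lambda>Y. F (s Y)"] by (metis empty_iff)
  have fY: "finite Y0" "Y0 \<subseteq> {..<N}" "card Y0 \<le> D" using Y0(1) finite_subset by (auto simp: YY_def)
  have "sparse N D (s Y0)"
  proof -
    have "card {c. s Y0 c \<noteq> 0} \<le> card Y0" using s(1)[OF Y0(1)] fY by (intro card_mono) auto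
    then show ?thesis using fY s(1)[OF Y0(1)] by (auto simp: sparse_def not_less[symmetric])
  qed
  moreover have "F (s Y0) \<le> F z'" if z': "sparse N D z'" for z'
  proof -
    have Y: "{c. z' c \<noteq> 0} \<in> YY" using z' by (auto simp: YY_def sparse_def not_less[symmetric])
    then have "F (s Y0) \<le> F (s {c. z' c \<noteq> 0})" by (rule Y0(2))
    also have "\<dots> \<le> F z'" by (rule s(2)[OF Y]) auto
    finally show ?thesis .
  qed
  ultimately show ?thesis unfolding F_def by blast
qed

text \<open>Only measurements and rounds are counted, so the decoder may be an exhaustive search
  over supports.\<close>

definition decode :: "nat \<Rightarrow> nat \<Rightarrow> nat \<Rightarrow> (nat \<Rightarrow> nat \<Rightarrow> real) \<Rightarrow> (nat \<Rightarrow> real) \<Rightarrow> nat \<Rightarrow> real" where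
  "decode m N D A b = (SOME z. sparse N D z \<and> (\<forall>z'. sparse N D z' \<longrightarrow>
    (\<Sum>l<m. (b l - inner_n N (A l) z)\<^sup>2) \<le> (\<Sum>l<m. (b l - inner_n N (A l) z')\<^sup>2)))"

lemma decode:
  "sparse N D (decode m N D A b)"
  "sparse N D z' \<Longrightarrow> (\<Sum>l<m. (b l - inner_n N (A l) (decode m N D A b))\<^sup>2) \<le> (\<Sum>l<m. (b l - inner_n N (A l) z')\<^sup>2)"
  using someI_ex[OF least_squares_sparse[where N=N and D=D and m=m and b=b and A=A]] unfolding decode_def by blast+

lemma sparse_diff:
  fixes f g :: "nat \<Rightarrow> real"
  assumes "sparse N D f" "sparse N D g"
  shows "sparse N (2 * D) (\<lambda>i. f i - g i)"
proof -
  have "card {c. f c - g c \<noteq> 0} \<le> card ({c. f c \<noteq> 0} \<union> {c. g c \<noteq> 0})"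
    using sparse_finite[OF assms(1)] sparse_finite[OF assms(2)] by (intro card_mono) auto
  also have "\<dots> \<le> card {c. f c \<noteq> 0} + card {c. g c \<noteq> 0}" by (rule card_Un_le)
  finally show ?thesis using assms by (auto simp: sparse_def)
qed

text \<open>The fit \<open>z\<close> is at least as good as \<open>h\<close>, whose misfit is the
  image of \<open>e\<close>. So the image of \<open>h - z\<close> has at most four times the energy
  of that misfit, and \<open>h - z\<close> is sparse enough for the lower isometry to divide it
  out.\<close>

lemma decode_error:
  fixes y h e :: "nat \<Rightarrow> real"
  assumes iso: "lower_iso m N (2 * D) \<kappa> A" and \<kappa>: "0 < \<kappa>" and m: "1 \<le> m"
    and h: "sparse N D h" and y: "\<And>i. i < N \<Longrightarrow> y i = h i + e i"
  shows "(\<Sum>i<N. (y i - decode m N D A (\<lambda>l. inner_n N (A l) y) i)\<^sup>2)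
    \<le> 2 * (\<Sum>i<N. (e i)\<^sup>2) + 8 / (m * \<kappa>) * (\<Sum>l<m. (inner_n N (A l) e)\<^sup>2)"
proof -
  define z where "z = decode m N D A (\<lambda>l. inner_n N (A l) y)"
  have sub: "inner_n N a f - inner_n N a g = inner_n N a (\<lambda>i. f i - g i)" for a f g
    by (simp add: inner_n_def right_diff_distrib sum_subtractf)
  have cong: "inner_n N a f = inner_n N a g" if "\<And>i. i < N \<Longrightarrow> f i = g i" for a f g
    unfolding inner_n_def using that by (intro sum.cong) auto
  have 1: "(\<Sum>l<m. (inner_n N (A l) y - inner_n N (A l) z)\<^sup>2) \<le> (\<Sum>l<m. (inner_n N (A l) e)\<^sup>2)"
  proof -
    have "inner_n N (A l) y - inner_n N (A l) h = inner_n N (A l) e" for l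
      unfolding sub by (rule cong) (simp add: y)
    then show ?thesis using decode(2)[OF h, where m=m and b="\<lambda>l. inner_n N (A l) y" and A=A] unfolding z_def by simp
  qed
  have "(\<Sum>l<m. (inner_n N (A l) (\<lambda>i. h i - z i))\<^sup>2)
     = (\<Sum>l<m. ((inner_n N (A l) y - inner_n N (A l) z) + - inner_n N (A l) e)\<^sup>2)"
  proof -
    have "inner_n N (A l) y = inner_n N (A l) h + inner_n N (A l) e" for l
      unfolding inner_n_def sum.distrib[symmetric] by (intro sum.cong) (auto simp: y distrib_left)
    then show ?thesis unfolding sub[symmetric] by simp
  qed
  also have "\<dots> \<le> 2 * (\<Sum>l<m. (inner_n N (A l) y - inner_n N (A l) z)\<^sup>2) + 2 * (\<Sum>l<m. (- inner_n N (A l) e)\<^sup>2)"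
    by (rule sum_square_le2)
  also have "\<dots> \<le> 4 * (\<Sum>l<m. (inner_n N (A l) e)\<^sup>2)" using 1 by simp
  finally have 2: "(\<Sum>l<m. (inner_n N (A l) (\<lambda>i. h i - z i))\<^sup>2) \<le> 4 * (\<Sum>l<m. (inner_n N (A l) e)\<^sup>2)" .
  have "sparse N (2 * D) (\<lambda>i. h i - z i)" unfolding z_def by (intro sparse_diff h decode(1))
  then have "m * \<kappa> * (\<Sum>i<N. (h i - z i)\<^sup>2) \<le> (\<Sum>l<m. (inner_n N (A l) (\<lambda>i. h i - z i))\<^sup>2)"
    using iso unfolding lower_iso_def by blast
  then have 3: "(\<Sum>i<N. (h i - z i)\<^sup>2) \<le> 4 / (m * \<kappa>) * (\<Sum>l<m. (inner_n N (A l) e)\<^sup>2)"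
    using 2 \<kappa> m by (simp add: field_simps)
  have "(\<Sum>i<N. (y i - z i)\<^sup>2) = (\<Sum>i<N. (e i + (h i - z i))\<^sup>2)" by (intro sum.cong) (auto simp: y algebra_simps)
  also have "\<dots> \<le> 2 * (\<Sum>i<N. (e i)\<^sup>2) + 2 * (\<Sum>i<N. (h i - z i)\<^sup>2)" by (rule sum_square_le2)
  finally show ?thesis using 3 unfolding z_def by simp
qed

section \<open>Hashing into cells and sketching\<close>

definition hash :: "nat \<Rightarrow> nat \<Rightarrow> (nat \<Rightarrow> nat) pmf" where
  "hash n N = Pi_pmf {..<n} 0 (\<lambda>_. pmf_of_set {..<N})"

lemma set_pmf_lessThan: "N \<ge> 1 \<Longrightarrow> set_pmf (pmf_of_set {..<N}) = {..<N :: nat}"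
  by (rule set_pmf_of_set) (auto simp: lessThan_empty_iff)

lemma finite_hash: "N \<ge> 1 \<Longrightarrow> finite (set_pmf (hash n N))"
  unfolding hash_def by (rule finite_set_Pi_pmf) (simp_all add: set_pmf_lessThan)

lemma hash_range:
  assumes "N \<ge> 1" "\<phi> \<in> set_pmf (hash n N)" "i < n"
  shows "\<phi> i < N"
proof -
  have "\<phi> i \<in> set_pmf (pmf_of_set {..<N})"
    using assms(2,3) by (simp add: hash_def set_Pi_pmf PiE_dflt_def)
  then show ?thesis using assms(1) by (simp add: set_pmf_lessThan)
qed

lemma hash_collision:
  assumes N: "N \<ge> 1" and ij: "i < n" "j < n" "i \<noteq> j"
  shows "E (hash n N) (\<lambda>\<phi>. if \<phi> i = \<phi> j then 1 else 0) \<le> 1 / N"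
proof -
  define A where "A = {..<n} - {i}"
  have A: "{..<n} = insert i A" "finite A" "i \<notin> A" "j \<in> A" using ij by (auto simp: A_def)
  have f: "finite (set_pmf (pmf_of_set {..<N}))" using N by (simp add: set_pmf_lessThan)
  have "E (hash n N) (\<lambda>\<phi>. if \<phi> i = \<phi> j then 1 else 0)
    = E (pmf_of_set {..<N}) (\<lambda>y. E (Pi_pmf A 0 (\<lambda>_. pmf_of_set {..<N})) (\<lambda>g. if y = g j then 1 else 0))"
    unfolding hash_def A(1) using A f ij(3) by (subst E_Pi_insert) auto
  also have "\<dots> = E (pmf_of_set {..<N}) (\<lambda>y. E (pmf_of_set {..<N}) (\<lambda>v. if y = v then 1 else 0))"
    using A by (subst E_Pi_component[OF A(2,4), where g = "\<lambda>v. if _ = v then 1 else 0"]) auto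
  also have "\<dots> \<le> 1 / N"
  proof (rule E_le_const[OF _ f])
    fix y assume "y \<in> set_pmf (pmf_of_set {..<N})"
    have "E (pmf_of_set {..<N}) (\<lambda>v. if y = v then 1 else 0) = pmf (pmf_of_set {..<N}) y"
      unfolding prob_eq_E_indicator[symmetric] by (simp add: pmf.rep_eq)
    also have "\<dots> \<le> 1 / N" using N by (subst pmf_of_set) (auto simp: lessThan_empty_iff indicator_def)
    finally show "E (pmf_of_set {..<N}) (\<lambda>v. if y = v then 1 else 0) \<le> 1 / N" .
  qed
  finally show ?thesis .
qed

text \<open>Every effect of hashing that matters is linear in the indicators of colliding pairs, so
  the first moment and Markov's inequality suffice.\<close>

lemma hash_pairs:
  fixes a :: "nat \<Rightarrow> nat \<Rightarrow> real" and t B :: real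
  assumes N: "N \<ge> 1" and P: "finite P" "\<And>i j. (i, j) \<in> P \<Longrightarrow> i < n \<and> j < n \<and> i \<noteq> j"
    and nn: "\<And>i j. 0 \<le> a i j" and t: "0 < t" and B: "(\<Sum>(i, j)\<in>P. a i j) \<le> B"
  shows "measure_pmf.prob (hash n N) {\<phi>. (\<Sum>(i, j)\<in>P. a i j * (if \<phi> i = \<phi> j then 1 else 0)) > B / N * t} \<le> 1 / t"
proof (rule markov[OF finite_hash[OF N] _ _ t])
  have "E (hash n N) (\<lambda>\<phi>. \<Sum>(i, j)\<in>P. a i j * (if \<phi> i = \<phi> j then 1 else 0))
    = (\<Sum>(i, j)\<in>P. a i j * E (hash n N) (\<lambda>\<phi>. if \<phi> i = \<phi> j then 1 else 0))"
    unfolding case_prod_beta by (subst E_sum[OF finite_hash[OF N]]) simp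
  also have "\<dots> \<le> (\<Sum>(i, j)\<in>P. a i j * (1 / N))"
    unfolding case_prod_beta
  proof (intro sum_mono mult_left_mono nn)
    fix p assume "p \<in> P"
    then show "E (hash n N) (\<lambda>\<phi>. if \<phi> (fst p) = \<phi> (snd p) then 1 else 0) \<le> 1 / N"
      using P(2)[of "fst p" "snd p"] by (intro hash_collision[OF N]) auto
  qed
  also have "\<dots> = (\<Sum>(i, j)\<in>P. a i j) * (1 / N)" by (simp add: sum_divide_distrib[symmetric] case_prod_beta)
  also have "\<dots> \<le> B * (1 / N)" using B by (intro mult_right_mono) auto
  finally show "E (hash n N) (\<lambda>\<phi>. \<Sum>(i, j)\<in>P. a i j * (if \<phi> i = \<phi> j then 1 else 0)) \<le> B / N" by simp
qed (use nn in \<open>auto intro!: sum_nonneg mult_nonneg_nonneg\<close>)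

section \<open>Random weightings of the coordinates\<close>

definition sign_pmf :: "real pmf" where "sign_pmf = pmf_of_set {-1, 1}"

text \<open>A discrete stand-in for the uniform law on the interval from -1 to 1, spread out down to
  the resolution \<open>1 / D\<close>.\<close>

definition grid_pmf :: "nat \<Rightarrow> real pmf" where
  "grid_pmf D = map_pmf (\<lambda>i. real_of_int i / D) (pmf_of_set {- int D..int D})"

lemma sign_pmf: "set_pmf sign_pmf = {-1, 1}" "E sign_pmf (\<lambda>u. u) = 0" "E sign_pmf (\<lambda>u. u\<^sup>2) \<le> 1"
  by (auto simp: sign_pmf_def set_pmf_of_set integral_pmf_of_set)

lemma grid_pmf:
  assumes D: "D \<ge> 1"
  shows "finite (set_pmf (grid_pmf D))" "\<And>u. u \<in> set_pmf (grid_pmf D) \<Longrightarrow> \<bar>u\<bar> \<le> 1"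
    "E (grid_pmf D) (\<lambda>u. u) = 0" "E (grid_pmf D) (\<lambda>u. u\<^sup>2) \<le> 1"
proof -
  show f: "finite (set_pmf (grid_pmf D))" by (simp add: grid_pmf_def set_pmf_of_set)
  show b: "\<bar>u\<bar> \<le> 1" if "u \<in> set_pmf (grid_pmf D)" for u
    using that D by (auto simp: grid_pmf_def set_pmf_of_set)
  have "(\<Sum>i\<in>{- int D..int D}. i) = (\<Sum>i\<in>{- int D..int D}. - i)"
    by (rule sum.reindex_bij_witness[of _ uminus uminus]) auto
  then have "(\<Sum>i\<in>{- int D..int D}. i) = 0" by (simp add: sum_negf)
  then show "E (grid_pmf D) (\<lambda>u. u) = 0"
    by (simp add: grid_pmf_def integral_pmf_of_set sum_divide_distrib[symmetric] of_int_sum[symmetric] del: of_int_sum)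
  show "E (grid_pmf D) (\<lambda>u. u\<^sup>2) \<le> 1"
    using b f by (intro E_le_const) (auto simp: abs_square_le_1)
qed

text \<open>An interval of length \<open>2 * \<tau>\<close> contains at most
  \<open>2 * D * \<tau> + 1\<close> of the \<open>2 * D + 1\<close> grid points, and the extra point
  is absorbed by \<open>D * \<tau> \<ge> 1\<close>.\<close>

lemma grid_small_ball:
  fixes v a \<tau> :: real
  assumes D: "D \<ge> 1" and \<tau>: "1 / D \<le> \<tau>" and a: "a \<noteq> 0"
  shows "measure_pmf.prob (grid_pmf D) {u. \<bar>u * a + v\<bar> \<le> \<tau> * \<bar>a\<bar>} \<le> 2 * \<tau>"
proof -
  define c where "c = - v / a"
  have D0: "real D > 0" using D by simp
  have \<tau>0: "\<tau> > 0" using less_le_trans[OF divide_pos_pos[OF zero_less_one D0] \<tau>] .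
  have eq: "\<bar>u * a + v\<bar> \<le> \<tau> * \<bar>a\<bar> \<longleftrightarrow> \<bar>u - c\<bar> \<le> \<tau>" for u
  proof -
    have "u * a + v = (u - c) * a" unfolding c_def using a by (simp add: field_simps)
    then have "\<bar>u * a + v\<bar> = \<bar>u - c\<bar> * \<bar>a\<bar>" by (simp only: abs_mult)
    then show ?thesis using a by simp
  qed
  let ?I = "{- int D..int D}" and ?L = "{i. \<bar>real_of_int i / D - c\<bar> \<le> \<tau>}"
  have sub: "?I \<inter> ?L \<subseteq> {\<lceil>D * (c - \<tau>)\<rceil>..\<lfloor>D * (c + \<tau>)\<rfloor>}"
  proof
    fix i assume "i \<in> ?I \<inter> ?L"
    then have "c - \<tau> \<le> real_of_int i / D" "real_of_int i / D \<le> c + \<tau>" by (auto simp: abs_le_iff)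
    then have "D * (c - \<tau>) \<le> real_of_int i" "real_of_int i \<le> D * (c + \<tau>)"
      using D0 by (simp_all add: pos_le_divide_eq pos_divide_le_eq mult.commute)
    then show "i \<in> {\<lceil>D * (c - \<tau>)\<rceil>..\<lfloor>D * (c + \<tau>)\<rfloor>}"
      by (simp add: ceiling_le_iff le_floor_iff)
  qed
  have "real (card (?I \<inter> ?L)) \<le> real (card {\<lceil>D * (c - \<tau>)\<rceil>..\<lfloor>D * (c + \<tau>)\<rfloor>})"
    using card_mono[OF _ sub] by simp
  also have "\<dots> \<le> 2 * D * \<tau> + 1"
  proof -
    have "real_of_int (\<lfloor>D * (c + \<tau>)\<rfloor> - \<lceil>D * (c - \<tau>)\<rceil>) \<le> D * (c + \<tau>) - D * (c - \<tau>)"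
      using of_int_floor_le[of "D * (c + \<tau>)"] le_of_int_ceiling[of "D * (c - \<tau>)"] by linarith
    also have "\<dots> = 2 * D * \<tau>" by (simp add: algebra_simps)
    finally have "real_of_int (\<lfloor>D * (c + \<tau>)\<rfloor> - \<lceil>D * (c - \<tau>)\<rceil> + 1) \<le> 2 * D * \<tau> + 1" by simp
    moreover have "0 \<le> 2 * D * \<tau> + 1" using D0 \<tau>0 by simp
    ultimately have "max 0 (real_of_int (\<lfloor>D * (c + \<tau>)\<rfloor> - \<lceil>D * (c - \<tau>)\<rceil> + 1)) \<le> 2 * D * \<tau> + 1" by (intro max.boundedI)
    moreover have "real (nat z) \<le> max 0 (real_of_int z)" for z by (cases "z \<ge> 0") auto
    ultimately show ?thesis unfolding card_atLeastAtMost_int by (rule order_trans[rotated])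
  qed
  finally have c1: "real (card (?I \<inter> ?L)) \<le> 2 * D * \<tau> + 1" .
  have "measure_pmf.prob (grid_pmf D) {u. \<bar>u * a + v\<bar> \<le> \<tau> * \<bar>a\<bar>} = measure_pmf.prob (pmf_of_set ?I) ?L"
    unfolding grid_pmf_def eq by (simp add: vimage_def)
  also have "\<dots> = real (card (?I \<inter> ?L)) / real (card ?I)"
    by (subst measure_pmf_of_set) auto
  also have "\<dots> \<le> (2 * D * \<tau> + 1) / (2 * D + 1)"
    using c1 by (intro frac_le) auto
  also have "\<dots> \<le> (2 * D * \<tau> + D * \<tau>) / (2 * D)"
  proof -
    have "1 \<le> D * \<tau>" using \<tau> D0 by (simp add: pos_divide_le_eq mult.commute)
    then show ?thesis using D0 \<tau>0 by (intro frac_le) (auto simp: mult.commute)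
  qed
  also have "\<dots> = 3 / 2 * \<tau>" using D0 by simp
  also have "\<dots> \<le> 2 * \<tau>" using \<tau>0 by simp
  finally show ?thesis .
qed

text \<open>Weighting 0 is a sign and reproduces the modulus of a coordinate that is alone in its
  cell. The grid weightings keep a cell with several large members from cancelling.\<close>

definition wt_pmf :: "nat \<Rightarrow> nat \<Rightarrow> real pmf" where
  "wt_pmf D l = (if l = 0 then sign_pmf else grid_pmf D)"

definition weights :: "nat \<Rightarrow> nat \<Rightarrow> (nat \<Rightarrow> nat \<Rightarrow> real) pmf" where
  "weights n D = Pi_pmf {..<4} (\<lambda>_. 0) (\<lambda>l. Pi_pmf {..<n} 0 (\<lambda>_. wt_pmf D l))"

lemma wt_pmf:
  assumes D: "D \<ge> 1"
  shows "finite (set_pmf (wt_pmf D l))" "E (wt_pmf D l) (\<lambda>u. u) = 0" "E (wt_pmf D l) (\<lambda>u. u\<^sup>2) \<le> 1"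
    "\<And>u. u \<in> set_pmf (wt_pmf D l) \<Longrightarrow> \<bar>u\<bar> \<le> 1" "\<And>u. u \<in> set_pmf (wt_pmf D 0) \<Longrightarrow> \<bar>u\<bar> = 1"
  using grid_pmf[OF D] sign_pmf by (auto simp: wt_pmf_def split: if_splits)

lemma finite_weights: "D \<ge> 1 \<Longrightarrow> finite (set_pmf (weights n D))"
  unfolding weights_def by (intro finite_set_Pi_pmf wt_pmf) auto

lemma weights_range:
  assumes "D \<ge> 1" "u \<in> set_pmf (weights n D)" "i < n"
  shows "l < 4 \<Longrightarrow> \<bar>u l i\<bar> \<le> 1" "\<bar>u 0 i\<bar> = 1"
proof -
  have "u l i \<in> set_pmf (wt_pmf D l)" if "l < 4" for l
    using assms(2,3) that by (auto simp: weights_def set_Pi_pmf PiE_dflt_def)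
  then show "l < 4 \<Longrightarrow> \<bar>u l i\<bar> \<le> 1" "\<bar>u 0 i\<bar> = 1"
    using wt_pmf(4,5)[OF assms(1)] by auto
qed

lemma weights_second_moment:
  fixes x :: "nat \<Rightarrow> real" and t B :: real
  assumes D: "D \<ge> 1" and C: "\<And>l c. l < 4 \<Longrightarrow> c \<in> C l \<Longrightarrow> I l c \<subseteq> {..<n}" and t: "0 < t"
    and B: "(\<Sum>l<4. \<Sum>c\<in>C l. \<Sum>i\<in>I l c. (x i)\<^sup>2) \<le> B"
  shows "measure_pmf.prob (weights n D) {u. (\<Sum>l<4. \<Sum>c\<in>C l. (\<Sum>i\<in>I l c. u l i * x i)\<^sup>2) > B * t} \<le> 1 / t"
proof (rule markov[OF finite_weights[OF D] _ _ t])
  note f = finite_weights[OF D, of n]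
  have one: "E (weights n D) (\<lambda>u. (\<Sum>i\<in>I l c. u l i * x i)\<^sup>2) \<le> (\<Sum>i\<in>I l c. (x i)\<^sup>2)"
    if l: "l < 4" and c: "c \<in> C l" for l c
  proof -
    have Il: "I l c \<subseteq> {..<n}" using C[OF l c] .
    have s: "(\<Sum>i\<in>I l c. g i * h i) = (\<Sum>i<n. g i * (if i \<in> I l c then h i else 0))" for g h :: "nat \<Rightarrow> real"
      using Il by (intro sum.mono_neutral_cong_left) auto
    have "E (weights n D) (\<lambda>u. (\<Sum>i\<in>I l c. u l i * x i)\<^sup>2)
       = E (Pi_pmf {..<n} 0 (\<lambda>_. wt_pmf D l)) (\<lambda>v. (\<Sum>i\<in>I l c. v i * x i)\<^sup>2)"
      unfolding weights_def using l by (intro E_Pi_component) auto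
    also have "\<dots> \<le> (\<Sum>i<n. (if i \<in> I l c then x i else 0)\<^sup>2)"
      unfolding s by (intro E_weighted_sum_sq wt_pmf[OF D]) auto
    also have "\<dots> = (\<Sum>i\<in>I l c. (x i)\<^sup>2)" using Il by (intro sum.mono_neutral_cong_right) auto
    finally show ?thesis .
  qed
  have "E (weights n D) (\<lambda>u. \<Sum>l<4. \<Sum>c\<in>C l. (\<Sum>i\<in>I l c. u l i * x i)\<^sup>2)
    = (\<Sum>l<4. \<Sum>c\<in>C l. E (weights n D) (\<lambda>u. (\<Sum>i\<in>I l c. u l i * x i)\<^sup>2))"
    by (simp only: E_sum[OF f])
  also have "\<dots> \<le> (\<Sum>l<4. \<Sum>c\<in>C l. \<Sum>i\<in>I l c. (x i)\<^sup>2)"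
    using one by (intro sum_mono) auto
  finally show "E (weights n D) (\<lambda>u. \<Sum>l<4. \<Sum>c\<in>C l. (\<Sum>i\<in>I l c. u l i * x i)\<^sup>2) \<le> B" using B by simp
qed (auto intro!: sum_nonneg)

text \<open>With all other weights fixed, each grid weighting confines the weight of
  \<open>j\<close> to a short interval. Three independent ones cube the probability, and an exponent
  above 2 is what makes the inverse of the energy summable over dyadic levels.\<close>

lemma weights_small_ball:
  fixes x :: "nat \<Rightarrow> real" and \<tau> :: real
  assumes D: "D \<ge> 1" and \<tau>: "1 / D \<le> \<tau>" and I: "I \<subseteq> {..<n}" "j \<in> I" and xj: "x j \<noteq> 0"
  shows "measure_pmf.prob (weights n D) {u. (\<Sum>l<4. (\<Sum>i\<in>I. u l i * x i)\<^sup>2) \<le> \<tau>\<^sup>2 * (x j)\<^sup>2} \<le> 8 * \<tau> ^ 3"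
proof -
  have "real D > 0" using D by simp
  then have \<tau>0: "\<tau> > 0" using less_le_trans[OF divide_pos_pos[OF zero_less_one] \<tau>] by blast
  define Q where "Q = (\<lambda>v::nat \<Rightarrow> real. \<bar>\<Sum>i\<in>I. v i * x i\<bar> \<le> \<tau> * \<bar>x j\<bar>)"
  have one: "measure_pmf.prob (Pi_pmf {..<n} 0 (\<lambda>_. grid_pmf D)) {v. Q v} \<le> 2 * \<tau>"
  proof -
    define A where "A = {..<n} - {j}"
    have A: "{..<n} = insert j A" "finite A" "j \<notin> A" using I by (auto simp: A_def)
    have fI: "finite I" using I finite_subset by blast
    note fg = grid_pmf(1)[OF D]
    have fA: "finite (set_pmf (Pi_pmf A 0 (\<lambda>_. grid_pmf D)))" using A fg by (intro finite_set_Pi_pmf) auto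
    have X: "(\<Sum>i\<in>I. (g(j := y)) i * x i) = y * x j + (\<Sum>i\<in>I - {j}. g i * x i)" for g y
    proof -
      have "(\<Sum>i\<in>I. (g(j := y)) i * x i) = y * x j + (\<Sum>i\<in>I - {j}. (g(j := y)) i * x i)"
        using I fI by (subst sum.remove) auto
      also have "(\<Sum>i\<in>I - {j}. (g(j := y)) i * x i) = (\<Sum>i\<in>I - {j}. g i * x i)" by (intro sum.cong) auto
      finally show ?thesis .
    qed
    have "Pi_pmf {..<n} 0 (\<lambda>_. grid_pmf D) = map_pmf (\<lambda>(g, y). g(j := y)) (pair_pmf (Pi_pmf A 0 (\<lambda>_. grid_pmf D)) (grid_pmf D))"
      unfolding A(1) using A by (subst Pi_pmf_insert, simp, simp, subst pair_commute_pmf) (simp add: pmf.map_comp comp_def case_prod_unfold)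
    then have "measure_pmf.prob (Pi_pmf {..<n} 0 (\<lambda>_. grid_pmf D)) {v. Q v}
      = measure_pmf.prob (pair_pmf (Pi_pmf A 0 (\<lambda>_. grid_pmf D)) (grid_pmf D)) {s. Q ((fst s)(j := snd s))}"
      by (simp add: vimage_def case_prod_beta)
    also have "\<dots> \<le> 2 * \<tau>"
    proof (rule prob_pair_le[OF fA fg])
      fix g
      have "{y. Q (g(j := y))} = {y. \<bar>y * x j + (\<Sum>i\<in>I - {j}. g i * x i)\<bar> \<le> \<tau> * \<bar>x j\<bar>}" unfolding Q_def X ..
      then show "measure_pmf.prob (grid_pmf D) {y. Q (g(j := y))} \<le> 2 * \<tau>"
        using grid_small_ball[OF D \<tau> xj] by simp
    qed
    finally show ?thesis .
  qed
  have "measure_pmf.prob (weights n D) {u. (\<Sum>l<4. (\<Sum>i\<in>I. u l i * x i)\<^sup>2) \<le> \<tau>\<^sup>2 * (x j)\<^sup>2}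
    \<le> measure_pmf.prob (weights n D) {u. \<forall>l\<in>{1,2,3}. Q (u l)}"
  proof (rule prob_mono, rule ballI)
    fix u :: "nat \<Rightarrow> nat \<Rightarrow> real" and l :: nat
    assume h: "(\<Sum>l<4. (\<Sum>i\<in>I. u l i * x i)\<^sup>2) \<le> \<tau>\<^sup>2 * (x j)\<^sup>2" and l: "l \<in> {1,2,3}"
    have "(\<Sum>i\<in>I. u l i * x i)\<^sup>2 \<le> (\<Sum>l<4. (\<Sum>i\<in>I. u l i * x i)\<^sup>2)"
      by (rule member_le_sum[of l "{..<4}" "\<lambda>l. (\<Sum>i\<in>I. u l i * x i)\<^sup>2"]) (use l in auto)
    also have "\<dots> \<le> (\<tau> * \<bar>x j\<bar>)\<^sup>2" using h by (simp add: power_mult_distrib)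
    finally have "\<bar>\<Sum>i\<in>I. u l i * x i\<bar> \<le> \<bar>\<tau> * \<bar>x j\<bar>\<bar>" by (simp only: abs_le_square_iff)
    then show "Q (u l)" unfolding Q_def using \<tau>0 by (simp add: abs_mult)
  qed
  also have "\<dots> = measure_pmf.prob (weights n D) (Pi {..<4} (\<lambda>l. if l \<in> {1,2,3} then {v. Q v} else UNIV))"
    by (intro arg_cong[where f = "measure_pmf.prob (weights n D)"]) (auto simp: Pi_def)
  also have "\<dots> = (\<Prod>l<4. measure_pmf.prob (Pi_pmf {..<n} 0 (\<lambda>_. wt_pmf D l)) (if l \<in> {1,2,3} then {v. Q v} else UNIV))"
    unfolding weights_def by (rule measure_Pi_pmf_Pi) simp
  also have "\<dots> = measure_pmf.prob (Pi_pmf {..<n} 0 (\<lambda>_. grid_pmf D)) {v. Q v} ^ 3"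
    by (simp add: eval_nat_numeral lessThan_Suc wt_pmf_def)
  also have "\<dots> \<le> (2 * \<tau>) ^ 3" using one by (intro power_mono) auto
  finally show ?thesis by (simp add: power_mult_distrib)
qed

text \<open>Layer cake with ratio 4: when \<open>s\<close> lies between
  \<open>a / 4 ^ (i + 1)\<close> and \<open>a / 4 ^ i\<close>, the quotient is at most
  \<open>4 ^ (i + 1)\<close>, and the term with index \<open>i\<close> pays for it.\<close>

lemma inverse_square_dyadic:
  fixes s a :: real
  assumes "(1 / 4) ^ I * a < s" "0 < a"
  shows "a / s \<le> 1 + (\<Sum>i<I. 4 ^ (i + 1) * (if s \<le> (1 / 4) ^ i * a then 1 else 0))"
  using assms
proof (induction I)
  case 0 then show ?case by simp
next
  case (Suc I)
  have "0 < (1 / 4) ^ Suc I * a" using Suc.prems by simp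
  then have s0: "0 < s" using Suc.prems by linarith
  show ?case
  proof (cases "(1 / 4) ^ I * a < s")
    case True then show ?thesis using Suc by simp
  next
    case False
    have "a \<le> 4 ^ (I + 1) * s" using Suc.prems by (simp add: field_simps power_divide)
    then have "a / s \<le> 4 ^ (I + 1)" using s0 by (simp add: field_simps)
    moreover have "0 \<le> (\<Sum>i<I. 4 ^ (i + 1) * (if s \<le> (1 / 4) ^ i * a then 1 else 0::real))" by (intro sum_nonneg) auto
    ultimately show ?thesis using False by simp
  qed
qed

text \<open>Level \<open>i\<close> contributes \<open>4 ^ (i + 1)\<close> times
  \<open>8 * (1 / 8) ^ i\<close>, that is \<open>32 / 2 ^ i\<close>; the sum is at most 64, and the
  top level adds 1. The cut-off \<open>(1 / 4) ^ m\<close> is the squared resolution of the weights,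
  below which no small ball estimate is available.\<close>

lemma weights_inverse_moment:
  fixes x :: "nat \<Rightarrow> real" and b t :: real and m :: nat
  assumes fin: "finite J" and I: "\<And>j. j \<in> J \<Longrightarrow> I j \<subseteq> {..<n} \<and> j \<in> I j \<and> x j \<noteq> 0"
    and b: "0 \<le> b" and t: "0 < t"
  shows "measure_pmf.prob (weights n (2 ^ m)) {u. (\<Sum>j\<in>J. if (1 / 4) ^ m * (x j)\<^sup>2 < (\<Sum>l<4. (\<Sum>i\<in>I j. u l i * x i)\<^sup>2)
      then (x j)\<^sup>2 * b / (\<Sum>l<4. (\<Sum>i\<in>I j. u l i * x i)\<^sup>2) else 0) > (65 * b * card J) * t} \<le> 1 / t"
proof (rule markov[OF finite_weights _ _ t])
  show D: "(1::nat) \<le> 2 ^ m" by simp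
  let ?P = "weights n (2 ^ m)"
  note f = finite_weights[OF D, of n]
  define sq where "sq = (\<lambda>j (u :: nat \<Rightarrow> nat \<Rightarrow> real). \<Sum>l<4. (\<Sum>i\<in>I j. u l i * x i)\<^sup>2 :: real)"
  have one: "E ?P (\<lambda>u. if (1 / 4) ^ m * (x j)\<^sup>2 < sq j u then (x j)\<^sup>2 * b / sq j u else 0) \<le> 65 * b" if j: "j \<in> J" for j
  proof -
    have xj: "0 < (x j)\<^sup>2" using I[OF j] by simp
    have "E ?P (\<lambda>u. if (1 / 4) ^ m * (x j)\<^sup>2 < sq j u then (x j)\<^sup>2 * b / sq j u else 0)
      \<le> E ?P (\<lambda>u. b * (1 + (\<Sum>i<m. 4 ^ (i + 1) * (if sq j u \<le> (1 / 4) ^ i * (x j)\<^sup>2 then 1 else 0))))"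
    proof (rule E_mono[OF f])
      fix u
      have nn: "0 \<le> (\<Sum>i<m. 4 ^ (i + 1) * (if sq j u \<le> (1 / 4) ^ i * (x j)\<^sup>2 then 1 else 0::real))" by (intro sum_nonneg) auto
      show "(if (1 / 4) ^ m * (x j)\<^sup>2 < sq j u then (x j)\<^sup>2 * b / sq j u else 0)
        \<le> b * (1 + (\<Sum>i<m. 4 ^ (i + 1) * (if sq j u \<le> (1 / 4) ^ i * (x j)\<^sup>2 then 1 else 0)))"
      proof (cases "(1 / 4) ^ m * (x j)\<^sup>2 < sq j u")
        case True
        have "(x j)\<^sup>2 * b / sq j u = b * ((x j)\<^sup>2 / sq j u)" by simp
        also have "\<dots> \<le> b * (1 + (\<Sum>i<m. 4 ^ (i + 1) * (if sq j u \<le> (1 / 4) ^ i * (x j)\<^sup>2 then 1 else 0)))"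
          by (intro mult_left_mono inverse_square_dyadic True xj b)
        finally show ?thesis using True by simp
      next
        case False then show ?thesis using b nn by simp
      qed
    qed
    also have "\<dots> = b * (1 + (\<Sum>i<m. 4 ^ (i + 1) * measure_pmf.prob ?P {u. sq j u \<le> (1 / 4) ^ i * (x j)\<^sup>2}))"
      unfolding prob_eq_E_indicator by (simp add: E_add[OF f] E_sum[OF f])
    also have "\<dots> \<le> b * (1 + (\<Sum>i<m. 4 ^ (i + 1) * (8 * ((1 / 2) ^ i) ^ 3)))"
    proof (intro mult_left_mono add_left_mono sum_mono b)
      fix i assume i: "i \<in> {..<m}"
      have \<tau>: "1 / real (2 ^ m) \<le> (1 / 2) ^ i"
        unfolding power_one_over[symmetric] of_nat_power of_nat_numeral using i by (intro power_decreasing) auto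
      have "((1 / 2) ^ i)\<^sup>2 = (1 / 4 :: real) ^ i" unfolding power2_eq_square power_mult_distrib[symmetric] by simp
      then show "measure_pmf.prob ?P {u. sq j u \<le> (1 / 4) ^ i * (x j)\<^sup>2} \<le> 8 * ((1 / 2) ^ i) ^ 3"
        using weights_small_ball[OF D \<tau>, of "I j" n j x] I[OF j] unfolding sq_def by simp
    qed auto
    also have "\<dots> = b * (1 + 32 * (\<Sum>i<m. (1 / 2) ^ i))"
    proof -
      have "4 ^ (i + 1) * (8 * ((1 / 2) ^ i) ^ 3) = 32 * (1 / 2 :: real) ^ i" for i
      proof -
        have "((1 / 2) ^ i) ^ 3 = ((1 / 2) ^ 3 :: real) ^ i" by (metis power_mult mult.commute)
        then have "4 ^ i * ((1 / 2) ^ i) ^ 3 = (4 * (1/2) ^ 3 :: real) ^ i"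
          by (simp only: power_mult_distrib)
        also have "(4 * (1/2) ^ 3 :: real) = 1/2" by (simp add: power3_eq_cube)
        finally show ?thesis by simp
      qed
      then show ?thesis by (simp add: sum_distrib_left)
    qed
    also have "\<dots> \<le> b * (1 + 32 * 2)"
    proof (intro mult_left_mono add_left_mono b)
      have "(\<Sum>i<m. (1 / 2 :: real) ^ i) = (1 - (1/2) ^ m) / (1 - 1/2)" by (simp add: sum_gp_strict)
      also have "\<dots> \<le> 2" by simp
      finally show "(\<Sum>i<m. (1 / 2 :: real) ^ i) \<le> 2" .
    qed simp
    finally show ?thesis by simp
  qed
  have "E ?P (\<lambda>u. \<Sum>j\<in>J. if (1 / 4) ^ m * (x j)\<^sup>2 < sq j u then (x j)\<^sup>2 * b / sq j u else 0)
     = (\<Sum>j\<in>J. E ?P (\<lambda>u. if (1 / 4) ^ m * (x j)\<^sup>2 < sq j u then (x j)\<^sup>2 * b / sq j u else 0))"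
    by (rule E_sum[OF f])
  also have "\<dots> \<le> (\<Sum>j\<in>J. 65 * b)" by (rule sum_mono[OF one])
  finally show "E ?P (\<lambda>u. \<Sum>j\<in>J. if (1 / 4) ^ m * (x j)\<^sup>2 < (\<Sum>l<4. (\<Sum>i\<in>I j. u l i * x i)\<^sup>2)
      then (x j)\<^sup>2 * b / (\<Sum>l<4. (\<Sum>i\<in>I j. u l i * x i)\<^sup>2) else 0) \<le> 65 * b * card J"
    unfolding sq_def by (simp add: mult_ac)
qed (use b in \<open>auto intro!: sum_nonneg divide_nonneg_nonneg\<close>)

text \<open>Excludes the energies below the cut-off of the inverse moment. The exponent
  \<open>m\<close> affects neither measurements nor rounds, so it can be taken as large as this
  event requires.\<close>

lemma weights_floor:
  fixes x :: "nat \<Rightarrow> real" and m :: nat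
  assumes fin: "finite J" and I: "\<And>j. j \<in> J \<Longrightarrow> I j \<subseteq> {..<n} \<and> j \<in> I j \<and> x j \<noteq> 0"
    and c: "8 * real (card J) \<le> 2 ^ m * \<delta>"
  shows "measure_pmf.prob (weights n (2 ^ m)) {u. \<exists>j\<in>J. (\<Sum>l<4. (\<Sum>i\<in>I j. u l i * x i)\<^sup>2) \<le> (1 / 4) ^ m * (x j)\<^sup>2} \<le> \<delta>"
proof -
  have D: "(1::nat) \<le> 2 ^ m" by simp
  have "measure_pmf.prob (weights n (2 ^ m)) {u. \<exists>j\<in>J. (\<Sum>l<4. (\<Sum>i\<in>I j. u l i * x i)\<^sup>2) \<le> (1 / 4) ^ m * (x j)\<^sup>2}
    \<le> (\<Sum>j\<in>J. measure_pmf.prob (weights n (2 ^ m)) {u. (\<Sum>l<4. (\<Sum>i\<in>I j. u l i * x i)\<^sup>2) \<le> (1 / 4) ^ m * (x j)\<^sup>2})"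
    by (rule prob_Bex[OF fin])
  also have "\<dots> \<le> (\<Sum>j\<in>J. 8 * (1 / 2 ^ m))"
  proof (rule sum_mono)
    fix j assume j: "j \<in> J"
    have \<tau>: "1 / real (2 ^ m) \<le> (1 / 2) ^ m" by (simp add: power_one_over)
    have "((1 / 2) ^ m)\<^sup>2 = (1 / 4 :: real) ^ m" unfolding power2_eq_square power_mult_distrib[symmetric] by simp
    then have "measure_pmf.prob (weights n (2 ^ m)) {u. (\<Sum>l<4. (\<Sum>i\<in>I j. u l i * x i)\<^sup>2) \<le> (1 / 4) ^ m * (x j)\<^sup>2} \<le> 8 * ((1 / 2) ^ m) ^ 3"
      using weights_small_ball[OF D \<tau>, of "I j" n j x] I[OF j] by simp
    also have "\<dots> \<le> 8 * ((1 / 2) ^ m) ^ 1"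
      by (intro mult_left_mono power_decreasing) (auto simp: power_le_one)
    finally show "measure_pmf.prob (weights n (2 ^ m)) {u. (\<Sum>l<4. (\<Sum>i\<in>I j. u l i * x i)\<^sup>2) \<le> (1 / 4) ^ m * (x j)\<^sup>2} \<le> 8 * (1 / 2 ^ m)"
      by (simp add: power_one_over)
  qed
  also have "\<dots> \<le> \<delta>" using c by (simp add: field_simps)
  finally show ?thesis .
qed

section \<open>Sign sketch of a residual vector\<close>

definition signs :: "nat \<Rightarrow> nat \<Rightarrow> (nat \<times> nat \<Rightarrow> real) pmf" where
  "signs m N = Pi_pmf ({..<m} \<times> {..<N}) 0 (\<lambda>_. sign_pmf)"

lemma finite_signs: "finite (set_pmf (signs m N))"
  unfolding signs_def by (intro finite_set_Pi_pmf) (auto simp: sign_pmf)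

lemma signs_square:
  assumes "s \<in> set_pmf (signs m N)" "r < m" "c < N"
  shows "(s (r, c))\<^sup>2 = 1"
proof -
  have "s (r, c) \<in> set_pmf sign_pmf"
    using assms by (simp add: signs_def set_Pi_pmf PiE_dflt_def)
  then show ?thesis by (auto simp: sign_pmf)
qed

text \<open>Deviation of the tug-of-war estimate of the entry \<open>r c\<close> from its true
  value. Since signs square to 1, the entry itself contributes exactly \<open>r c\<close>.\<close>

definition sketch_err :: "nat \<Rightarrow> nat \<Rightarrow> (nat \<times> nat \<Rightarrow> real) \<Rightarrow> (nat \<Rightarrow> real) \<Rightarrow> nat \<Rightarrow> real" where
  "sketch_err m N s r c = (\<Sum>l<m. s (l, c) * (\<Sum>c'<N. s (l, c') * r c')) / m - r c"

text \<open>After the entry \<open>c\<close> cancels, the error is a sum over the other signs with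
  coefficients that contain the signs of column \<open>c\<close>. Those lie outside the range of
  summation, which is the situation of \<open>E_weighted_sum_sq_subset\<close>.\<close>

lemma sketch_err_moment:
  fixes r :: "nat \<Rightarrow> real"
  assumes m: "m \<ge> 1" and c: "c < N"
  shows "E (signs m N) (\<lambda>s. (sketch_err m N s r c)\<^sup>2) \<le> (\<Sum>c'<N. (r c')\<^sup>2) / m"
proof -
  let ?I = "{..<m} \<times> {..<N}" and ?I' = "{..<m} \<times> ({..<N} - {c})"
  define t where "t = (\<lambda>(s :: nat \<times> nat \<Rightarrow> real) (p :: nat \<times> nat). s (fst p, c) * r (snd p) / m)"
  have eq: "sketch_err m N s r c = (\<Sum>p\<in>?I'. s p * t s p)" if s: "s \<in> set_pmf (signs m N)" for s
  proof -
    have "(\<Sum>l<m. s (l, c) * (\<Sum>c'<N. s (l, c') * r c'))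
       = (\<Sum>l<m. r c + (\<Sum>c'\<in>{..<N} - {c}. s (l, c) * (s (l, c') * r c')))"
    proof (rule sum.cong[OF refl])
      fix l assume l: "l \<in> {..<m}"
      have "s (l, c) * (\<Sum>c'<N. s (l, c') * r c')
         = s (l, c) * (s (l, c) * r c) + (\<Sum>c'\<in>{..<N} - {c}. s (l, c) * (s (l, c') * r c'))"
        using c by (subst sum.remove[of _ c]) (auto simp: distrib_left sum_distrib_left)
      also have "s (l, c) * (s (l, c) * r c) = (s (l, c))\<^sup>2 * r c" by (simp add: power2_eq_square)
      also have "\<dots> = r c" using signs_square[OF s _ c, of l] l by simp
      finally show "s (l, c) * (\<Sum>c'<N. s (l, c') * r c') = r c + (\<Sum>c'\<in>{..<N} - {c}. s (l, c) * (s (l, c') * r c'))" .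
    qed
    also have "\<dots> = m * r c + (\<Sum>l<m. \<Sum>c'\<in>{..<N} - {c}. s (l, c) * (s (l, c') * r c'))"
      by (simp add: sum.distrib)
    finally have "sketch_err m N s r c = (\<Sum>l<m. \<Sum>c'\<in>{..<N} - {c}. s (l, c) * (s (l, c') * r c')) / m"
      unfolding sketch_err_def using m by (simp add: add_divide_distrib)
    also have "\<dots> = (\<Sum>p\<in>?I'. s p * t s p)"
    proof -
      have "(\<Sum>l<m. \<Sum>c'\<in>{..<N} - {c}. s (l, c) * (s (l, c') * r c'))
        = (\<Sum>p\<in>?I'. s (fst p, c) * (s p * r (snd p)))"
        by (simp add: sum.cartesian_product case_prod_unfold)
      also have "\<dots> / m = (\<Sum>p\<in>?I'. s p * t s p)"
        unfolding sum_divide_distrib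
        by (rule sum.cong[OF refl]) (simp only: t_def times_divide_eq_right mult.left_commute)
      finally show ?thesis .
    qed
    finally show ?thesis .
  qed
  have "E (signs m N) (\<lambda>s. (sketch_err m N s r c)\<^sup>2) = E (signs m N) (\<lambda>s. (\<Sum>p\<in>?I'. s p * t s p)\<^sup>2)"
    unfolding E_finite[OF finite_signs] by (rule sum.cong[OF refl]) (simp only: eq)
  also have "\<dots> \<le> (\<Sum>c'<N. (r c')\<^sup>2) / m"
    unfolding signs_def
  proof (rule E_weighted_sum_sq_subset)
    fix u v :: "nat \<times> nat \<Rightarrow> real" and p
    assume uv: "\<And>j. j \<in> ?I - ?I' \<Longrightarrow> u j = v j" and p: "p \<in> ?I'"
    have "(fst p, c) \<in> ?I - ?I'" using p c by (auto simp: mem_Times_iff)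
    from uv[OF this] show "t u p = t v p" unfolding t_def by simp
  next
    fix u assume u: "u \<in> set_pmf (Pi_pmf ?I 0 (\<lambda>_. sign_pmf))"
    have "(\<Sum>p\<in>?I'. (t u p)\<^sup>2) = (\<Sum>l<m. \<Sum>c'\<in>{..<N} - {c}. (u (l, c))\<^sup>2 * (r c')\<^sup>2 / m\<^sup>2)"
      unfolding sum.cartesian_product t_def by (intro sum.cong) (auto simp: power_divide power_mult_distrib)
    also have "\<dots> = (\<Sum>l<m. \<Sum>c'\<in>{..<N} - {c}. (r c')\<^sup>2 / m\<^sup>2)"
    proof (intro sum.cong refl)
      fix l c' assume "l \<in> {..<m}"
      then have "(u (l, c))\<^sup>2 = 1" using u c by (intro signs_square) (auto simp: signs_def)
      then show "(u (l, c))\<^sup>2 * (r c')\<^sup>2 / m\<^sup>2 = (r c')\<^sup>2 / m\<^sup>2" by simp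
    qed
    also have "\<dots> \<le> (\<Sum>l<m. \<Sum>c'<N. (r c')\<^sup>2 / m\<^sup>2)"
      by (intro sum_mono sum_mono2) auto
    also have "\<dots> = (\<Sum>c'<N. (r c')\<^sup>2) / m"
      unfolding sum_divide_distrib[symmetric] sum_constant card_lessThan using m by (simp add: power2_eq_square)
    finally show "(\<Sum>p\<in>?I'. (t u p)\<^sup>2) \<le> (\<Sum>c'<N. (r c')\<^sup>2) / m" .
  next
    show "finite (set_pmf sign_pmf)" by (simp add: sign_pmf(1))
    show "E sign_pmf (\<lambda>u. u) = 0" "E sign_pmf (\<lambda>u. u\<^sup>2) \<le> 1" by (fact sign_pmf)+
    show "finite ?I" by simp
    show "?I' \<subseteq> ?I" by (intro Sigma_mono) auto
  qed
  finally show ?thesis .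
qed

definition err2 :: "nat \<Rightarrow> nat \<Rightarrow> (nat \<times> nat \<Rightarrow> real) \<Rightarrow> (nat \<Rightarrow> nat \<Rightarrow> real) \<Rightarrow> nat \<Rightarrow> real" where
  "err2 m N s r c = (\<Sum>l<4. (sketch_err m N s (r l) c)\<^sup>2)"

lemma err2_nonneg: "0 \<le> err2 m N s r c" unfolding err2_def by (intro sum_nonneg) auto

lemma err2_moment:
  fixes r :: "nat \<Rightarrow> nat \<Rightarrow> real"
  assumes "m \<ge> 1" "c < N"
  shows "E (signs m N) (\<lambda>s. err2 m N s r c) \<le> (\<Sum>l<4. \<Sum>c'<N. (r l c')\<^sup>2) / m"
  unfolding err2_def E_sum[OF finite_signs] sum_divide_distrib[of _ "{..<4}"]
  by (intro sum_mono sketch_err_moment assms)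

lemma err2_sum_markov:
  fixes r :: "nat \<Rightarrow> nat \<Rightarrow> real" and t :: real
  assumes "m \<ge> 1" "\<And>i. i \<in> I \<Longrightarrow> f i < N" "0 < t"
  shows "measure_pmf.prob (signs m N) {s. (\<Sum>i\<in>I. err2 m N s r (f i)) >
     (card I * ((\<Sum>l<4. \<Sum>c'<N. (r l c')\<^sup>2) / m)) * t} \<le> 1 / t"
proof (rule markov[OF finite_signs _ _ assms(3)])
  have "E (signs m N) (\<lambda>s. \<Sum>i\<in>I. err2 m N s r (f i)) \<le> (\<Sum>i\<in>I. (\<Sum>l<4. \<Sum>c'<N. (r l c')\<^sup>2) / m)"
    unfolding E_sum[OF finite_signs] by (intro sum_mono err2_moment assms)
  then show "E (signs m N) (\<lambda>s. \<Sum>i\<in>I. err2 m N s r (f i)) \<le> card I * ((\<Sum>l<4. \<Sum>c'<N. (r l c')\<^sup>2) / m)"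
    by simp
qed (auto intro: sum_nonneg err2_nonneg)

text \<open>A cell whose true energy \<open>q\<close> exceeds the threshold looks small only if its sketch error
  is comparable to \<open>q\<close>, which has probability inversely proportional to \<open>q\<close>.\<close>

lemma err2_lost_markov:
  fixes r :: "nat \<Rightarrow> nat \<Rightarrow> real" and t \<theta> R :: real and w q :: "nat \<Rightarrow> real"
  assumes m: "m \<ge> 1" and f: "\<And>j. j \<in> J \<Longrightarrow> f j < N" and t: "0 < t"
    and w: "\<And>j. j \<in> J \<Longrightarrow> 0 \<le> w j" and q: "\<And>j. j \<in> J \<Longrightarrow> 0 < q j"
    and \<theta>: "0 \<le> \<theta>" and R: "(\<Sum>l<4. \<Sum>c'<N. (r l c')\<^sup>2) \<le> R"
  shows "measure_pmf.prob (signs m N) {s. (\<Sum>j\<in>J. if q j \<le> 8 * \<theta> + 8 * err2 m N s r (f j) then w j else 0) >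
     (\<Sum>j\<in>J. w j * (16 * \<theta> + 16 * R / m) / q j) * t} \<le> 1 / t"
proof (rule markov[OF finite_signs _ _ t])
  let ?P = "signs m N"
  have one: "E ?P (\<lambda>s. if q j \<le> 8 * \<theta> + 8 * err2 m N s r (f j) then w j else 0) \<le> w j * (16 * \<theta> + 16 * R / m) / q j"
    if j: "j \<in> J" for j
  proof -
    have "E ?P (\<lambda>s. if q j \<le> 8 * \<theta> + 8 * err2 m N s r (f j) then w j else 0)
       \<le> E ?P (\<lambda>s. w j * (16 * \<theta> + 16 * err2 m N s r (f j)) / q j)"
    proof (rule E_mono[OF finite_signs])
      fix s
      show "(if q j \<le> 8 * \<theta> + 8 * err2 m N s r (f j) then w j else 0) \<le> w j * (16 * \<theta> + 16 * err2 m N s r (f j)) / q j"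
      proof (cases "q j \<le> 8 * \<theta> + 8 * err2 m N s r (f j)")
        case True
        then have "q j \<le> 16 * \<theta> + 16 * err2 m N s r (f j)" using \<theta> err2_nonneg[of m N s r "f j"] by linarith
        then have "w j * q j \<le> w j * (16 * \<theta> + 16 * err2 m N s r (f j))" using w[OF j] by (rule mult_left_mono)
        then show ?thesis using True q[OF j] by (simp add: pos_le_divide_eq)
      next
        case False
        have "0 \<le> w j * (16 * \<theta> + 16 * err2 m N s r (f j)) / q j"
          using w[OF j] q[OF j] \<theta> err2_nonneg[of m N s r "f j"] by (intro divide_nonneg_pos mult_nonneg_nonneg) auto
        then show ?thesis using False by simp
      qed
    qed
    also have "\<dots> = w j * (16 * \<theta> + 16 * E ?P (\<lambda>s. err2 m N s r (f j))) / q j"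
      by (simp add: E_add[OF finite_signs] integrable_measure_pmf_finite[OF finite_signs])
    also have "\<dots> \<le> w j * (16 * \<theta> + 16 * (R / m)) / q j"
    proof (intro divide_right_mono mult_left_mono add_left_mono w[OF j])
      have "E ?P (\<lambda>s. err2 m N s r (f j)) \<le> (\<Sum>l<4. \<Sum>c'<N. (r l c')\<^sup>2) / m" by (intro err2_moment m f j)
      also have "\<dots> \<le> R / m" using R by (intro divide_right_mono) auto
      finally show "E ?P (\<lambda>s. err2 m N s r (f j)) \<le> R / m" .
    qed (use q[OF j] in auto)
    finally show ?thesis by simp
  qed
  show "E ?P (\<lambda>s. \<Sum>j\<in>J. if q j \<le> 8 * \<theta> + 8 * err2 m N s r (f j) then w j else 0) \<le> (\<Sum>j\<in>J. w j * (16 * \<theta> + 16 * R / m) / q j)"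
    unfolding E_sum[OF finite_signs] by (rule sum_mono[OF one])
qed (auto intro!: sum_nonneg w)

section \<open>Selecting cells\<close>

definition cell :: "(nat \<Rightarrow> nat) \<Rightarrow> nat set \<Rightarrow> nat \<Rightarrow> nat set" where
  "cell \<phi> S c = {i \<in> S. \<phi> i = c}"

definition collided :: "(nat \<Rightarrow> nat) \<Rightarrow> nat set \<Rightarrow> nat set" where
  "collided \<phi> G = {i \<in> G. \<exists>j\<in>G. j \<noteq> i \<and> \<phi> i = \<phi> j}"

text \<open>Real valued, so that collision effects become weighted sums over \<open>offdiag\<close>
  pairs, the form treated by \<open>hash_pairs\<close>.\<close>

definition same_cell :: "(nat \<Rightarrow> nat) \<Rightarrow> nat \<Rightarrow> nat \<Rightarrow> real" where
  "same_cell \<phi> i j = (if \<phi> i = \<phi> j then 1 else 0)"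

definition offdiag :: "nat set \<Rightarrow> nat set \<Rightarrow> (nat \<times> nat) set" where
  "offdiag A B = {(i, j). i \<in> A \<and> j \<in> B \<and> i \<noteq> j}"

lemma finite_offdiag: "finite A \<Longrightarrow> finite B \<Longrightarrow> finite (offdiag A B)"
  by (rule finite_subset[of _ "A \<times> B"]) (auto simp: offdiag_def)

lemma offdiag_sum_le:
  fixes a b :: "nat \<Rightarrow> real"
  assumes "finite A" "finite B" "\<And>i. 0 \<le> a i" "\<And>i. 0 \<le> b i"
  shows "(\<Sum>(i, j)\<in>offdiag A B. a i * b j) \<le> (\<Sum>i\<in>A. a i) * (\<Sum>j\<in>B. b j)"
proof -
  have "(\<Sum>(i, j)\<in>offdiag A B. a i * b j) \<le> (\<Sum>(i, j)\<in>A \<times> B. a i * b j)"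
    using assms by (intro sum_mono2) (auto simp: offdiag_def)
  then show ?thesis by (simp add: sum_product sum.cartesian_product)
qed

text \<open>The member that stands for its cell. Preferring a heavy member leaves only light or
  colliding heavy ones behind; in a cell without heavy members the maximal modulus lets the others
  be bounded by products over pairs.\<close>

definition rep :: "(nat \<Rightarrow> nat) \<Rightarrow> nat set \<Rightarrow> nat set \<Rightarrow> (nat \<Rightarrow> real) \<Rightarrow> nat \<Rightarrow> nat" where
  "rep \<phi> S G x c = (SOME i. i \<in> cell \<phi> S c \<and> (cell \<phi> S c \<inter> G \<noteq> {} \<longrightarrow> i \<in> G) \<and>
     (cell \<phi> S c \<inter> G = {} \<longrightarrow> (\<forall>j\<in>cell \<phi> S c. \<bar>x j\<bar> \<le> \<bar>x i\<bar>)))"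

lemma rep:
  assumes "finite S" "cell \<phi> S c \<noteq> {}"
  shows "rep \<phi> S G x c \<in> cell \<phi> S c" "cell \<phi> S c \<inter> G \<noteq> {} \<Longrightarrow> rep \<phi> S G x c \<in> G"
    "cell \<phi> S c \<inter> G = {} \<Longrightarrow> j \<in> cell \<phi> S c \<Longrightarrow> \<bar>x j\<bar> \<le> \<bar>x (rep \<phi> S G x c)\<bar>"
proof -
  have "\<exists>i. i \<in> cell \<phi> S c \<and> (cell \<phi> S c \<inter> G \<noteq> {} \<longrightarrow> i \<in> G) \<and>
     (cell \<phi> S c \<inter> G = {} \<longrightarrow> (\<forall>j\<in>cell \<phi> S c. \<bar>x j\<bar> \<le> \<bar>x i\<bar>))"
  proof (cases "cell \<phi> S c \<inter> G = {}")
    case True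
    have f: "finite (cell \<phi> S c)" using assms(1) by (simp add: cell_def)
    have "Max ((\<lambda>i. \<bar>x i\<bar>) ` cell \<phi> S c) \<in> (\<lambda>i. \<bar>x i\<bar>) ` cell \<phi> S c" using f assms(2) by (intro Max_in) auto
    then obtain i where i: "i \<in> cell \<phi> S c" "Max ((\<lambda>i. \<bar>x i\<bar>) ` cell \<phi> S c) = \<bar>x i\<bar>" by auto
    have "\<forall>j\<in>cell \<phi> S c. \<bar>x j\<bar> \<le> \<bar>x i\<bar>" unfolding i(2)[symmetric] using f by auto
    then show ?thesis using i(1) True by blast
  next
    case False then show ?thesis by blast
  qed
  from someI_ex[OF this] show "rep \<phi> S G x c \<in> cell \<phi> S c" "cell \<phi> S c \<inter> G \<noteq> {} \<Longrightarrow> rep \<phi> S G x c \<in> G"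
    "cell \<phi> S c \<inter> G = {} \<Longrightarrow> j \<in> cell \<phi> S c \<Longrightarrow> \<bar>x j\<bar> \<le> \<bar>x (rep \<phi> S G x c)\<bar>"
    unfolding rep_def[symmetric] by blast+
qed

lemma rep_image:
  assumes "finite S" "c \<in> \<phi> ` S"
  shows "rep \<phi> S G x c \<in> S" "\<phi> (rep \<phi> S G x c) = c"
proof -
  have "cell \<phi> S c \<noteq> {}" using assms(2) by (auto simp: cell_def)
  from rep(1)[OF assms(1) this, of G x] show "rep \<phi> S G x c \<in> S" "\<phi> (rep \<phi> S G x c) = c" by (auto simp: cell_def)
qed

lemma inj_on_rep: "finite S \<Longrightarrow> C \<subseteq> \<phi> ` S \<Longrightarrow> inj_on (rep \<phi> S G x) C"
  by (rule inj_on_inverseI[of _ \<phi>]) (auto simp: rep_image)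

lemma sum_le_sqrt_card:
  fixes w :: "'a \<Rightarrow> real"
  assumes "card C \<le> K" "(\<Sum>c\<in>C. (w c)\<^sup>2) \<le> B"
  shows "(\<Sum>c\<in>C. w c) \<le> sqrt (real K * B)"
proof -
  have "(\<Sum>c\<in>C. w c) \<le> (\<Sum>c\<in>C. \<bar>w c\<bar>)" by (intro sum_mono) auto
  also have "\<dots> \<le> sqrt (card C * (\<Sum>c\<in>C. (w c)\<^sup>2))" by (rule sum_abs_le_sqrt)
  also have "\<dots> \<le> sqrt (real K * B)"
    using assms by (intro real_sqrt_le_mono mult_mono) (auto intro!: sum_nonneg)
  finally show ?thesis .
qed

text \<open>The new heavy set consists of the representatives of the selected cells and the heavy
  coordinates that collided. What remains is light: either it shares a cell with a heavy coordinate,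
  which is the first sum, or it sits in one of at most \<open>K'\<close> light cells, where
  Cauchy-Schwarz leads to the second.\<close>

lemma selected_tail:
  fixes x :: "nat \<Rightarrow> real"
  assumes fin: "finite S" and G: "G \<subseteq> S" and Y: "finite Y" "card Y \<le> K'"
    and nG: "card (collided \<phi> G) \<le> K'"
  defines "S' \<equiv> {i \<in> S. \<phi> i \<in> Y}"
  shows "\<exists>G'\<subseteq>S'. card G' \<le> 2 * K' \<and>
    (\<Sum>i\<in>S' - G'. (x i)\<^sup>2) \<le> (\<Sum>(i, j)\<in>offdiag (S - G) G. (x i)\<^sup>2 * same_cell \<phi> i j)
      + sqrt (K' * (\<Sum>(i, j)\<in>offdiag (S - G) (S - G). (x i)\<^sup>2 * (x j)\<^sup>2 * same_cell \<phi> i j))"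
proof -
  define r where "r = rep \<phi> S G x"
  define G' where "G' = r ` (Y \<inter> \<phi> ` S) \<union> (collided \<phi> G \<inter> S')"
  have finG: "finite G" using fin G finite_subset by blast
  have fc: "finite (collided \<phi> G)" using finG by (simp add: collided_def)
  have sub: "G' \<subseteq> S'"
  proof -
    have "r c \<in> S'" if "c \<in> Y \<inter> \<phi> ` S" for c
      using rep_image[OF fin, of c \<phi> G x] that unfolding S'_def r_def by simp
    then show ?thesis unfolding G'_def by blast
  qed
  have c: "card G' \<le> 2 * K'"
  proof -
    have "card G' \<le> card (r ` (Y \<inter> \<phi> ` S)) + card (collided \<phi> G \<inter> S')" unfolding G'_def by (rule card_Un_le)
    also have "card (r ` (Y \<inter> \<phi> ` S)) \<le> card Y" using Y by (meson card_image_le card_mono finite_Int inf_le1 le_trans)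
    also have "card (collided \<phi> G \<inter> S') \<le> card (collided \<phi> G)" using fc by (intro card_mono) auto
    finally show ?thesis using Y nG by linarith
  qed
  define A where "A = {i \<in> S' - G'. \<exists>g\<in>G. \<phi> i = \<phi> g}"
  define C where "C = Y \<inter> \<phi> ` S - \<phi> ` G"
  define w where "w = (\<lambda>c. \<Sum>i\<in>cell \<phi> S c - {r c}. (x i)\<^sup>2)"
  have fS': "finite S'" using fin by (simp add: S'_def)
  have notG: "i \<notin> G" if "i \<in> S' - G'" for i
  proof
    assume iG: "i \<in> G"
    have ne: "cell \<phi> S (\<phi> i) \<noteq> {}" "cell \<phi> S (\<phi> i) \<inter> G \<noteq> {}" using iG G by (auto simp: cell_def)
    have ri: "r (\<phi> i) \<in> G" "\<phi> (r (\<phi> i)) = \<phi> i" using rep(1,2)[OF fin ne(1)] ne(2) by (auto simp: r_def cell_def)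
    have "i \<notin> collided \<phi> G" using that unfolding G'_def by auto
    moreover have "i \<in> collided \<phi> G" if "r (\<phi> i) \<noteq> i"
      unfolding collided_def using that ri iG by (intro CollectI conjI bexI[of _ "r (\<phi> i)"]) simp_all
    ultimately have "r (\<phi> i) = i" by blast
    moreover have "\<phi> i \<in> Y \<inter> \<phi> ` S" using that iG G by (auto simp: S'_def)
    ultimately have "i \<in> G'" unfolding G'_def by (metis UnI1 imageI)
    then show False using that by auto
  qed
  have split: "S' - G' - A \<subseteq> (\<Union>c\<in>C. cell \<phi> S c - {r c})"
  proof
    fix i assume i: "i \<in> S' - G' - A"
    then have "i \<in> S" "\<phi> i \<in> Y" "\<phi> i \<notin> \<phi> ` G" unfolding A_def S'_def by auto
    then have "\<phi> i \<in> C" "i \<in> cell \<phi> S (\<phi> i)" unfolding C_def cell_def by auto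
    moreover have "i \<noteq> r (\<phi> i)" using i \<open>\<phi> i \<in> C\<close> unfolding G'_def C_def by auto
    ultimately show "i \<in> (\<Union>c\<in>C. cell \<phi> S c - {r c})" by blast
  qed
  have fcell: "finite (cell \<phi> S c)" for c using fin by (simp add: cell_def)
  have fC: "finite C" using Y by (simp add: C_def)
  have "(\<Sum>i\<in>S' - G'. (x i)\<^sup>2) = (\<Sum>i\<in>A. (x i)\<^sup>2) + (\<Sum>i\<in>S' - G' - A. (x i)\<^sup>2)"
    using fS' by (subst sum.subset_diff[of A]) (auto simp: A_def)
  also have "(\<Sum>i\<in>A. (x i)\<^sup>2) \<le> (\<Sum>(i, j)\<in>offdiag (S - G) G. (x i)\<^sup>2 * same_cell \<phi> i j)"
  proof -
    define p where "p = (\<lambda>i. (i, SOME g. g \<in> G \<and> \<phi> i = \<phi> g))"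
    have p: "snd (p i) \<in> G \<and> \<phi> i = \<phi> (snd (p i))" if "i \<in> A" for i
      unfolding p_def using that someI_ex[of "\<lambda>g. g \<in> G \<and> \<phi> i = \<phi> g"] by (auto simp: A_def)
    have "(\<Sum>i\<in>A. (x i)\<^sup>2) = (\<Sum>i\<in>A. (x (fst (p i)))\<^sup>2 * same_cell \<phi> (fst (p i)) (snd (p i)))"
      using p by (intro sum.cong refl) (simp add: same_cell_def p_def)
    also have "\<dots> = (\<Sum>(i, j)\<in>p ` A. (x i)\<^sup>2 * same_cell \<phi> i j)"
      by (subst sum.reindex) (auto simp: inj_on_def p_def case_prod_unfold)
    also have "\<dots> \<le> (\<Sum>(i, j)\<in>offdiag (S - G) G. (x i)\<^sup>2 * same_cell \<phi> i j)"
    proof (rule sum_mono2)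
      show "finite (offdiag (S - G) G)" using fin finG by (intro finite_offdiag) auto
      show "p ` A \<subseteq> offdiag (S - G) G"
      proof
        fix q assume "q \<in> p ` A"
        then obtain i where i: "i \<in> A" "q = p i" by auto
        have "i \<in> S - G" using i(1) notG by (auto simp: A_def S'_def)
        moreover have "fst (p i) = i" by (simp add: p_def)
        ultimately show "q \<in> offdiag (S - G) G" using p[OF i(1)] i(2) by (cases "p i") (auto simp: offdiag_def)
      qed
    qed (auto simp: same_cell_def)
    finally show ?thesis .
  qed
  also have "(\<Sum>i\<in>S' - G' - A. (x i)\<^sup>2) \<le> (\<Sum>c\<in>C. w c)"
  proof -
    have "(\<Sum>i\<in>S' - G' - A. (x i)\<^sup>2) \<le> (\<Sum>i\<in>(\<Union>c\<in>C. cell \<phi> S c - {r c}). (x i)\<^sup>2)"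
      using split fC fcell by (intro sum_mono2) auto
    also have "\<dots> = (\<Sum>c\<in>C. w c)"
      unfolding w_def using fC fcell by (intro sum.UNION_disjoint) (auto simp: cell_def)
    finally show ?thesis .
  qed
  also have "(\<Sum>c\<in>C. w c) \<le> sqrt (K' * (\<Sum>(i, j)\<in>offdiag (S - G) (S - G). (x i)\<^sup>2 * (x j)\<^sup>2 * same_cell \<phi> i j))"
  proof (rule sum_le_sqrt_card)
    have "card C \<le> card Y" using Y by (intro card_mono) (auto simp: C_def)
    then show "card C \<le> K'" using Y(2) by linarith
    have one: "(w c)\<^sup>2 \<le> (\<Sum>(i, j)\<in>offdiag (cell \<phi> S c) (cell \<phi> S c). (x i)\<^sup>2 * (x j)\<^sup>2)" if c: "c \<in> C" for c
    proof -
      let ?c = "cell \<phi> S c"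
      have ne: "?c \<noteq> {}" "?c \<inter> G = {}" using c by (auto simp: C_def cell_def) (metis imageI)
      have rc: "r c \<in> ?c" unfolding r_def by (rule rep(1)[OF fin ne(1)])
      have mx: "(x i)\<^sup>2 \<le> (x (r c))\<^sup>2" if "i \<in> ?c" for i
        using rep(3)[OF fin ne that] unfolding r_def by (simp add: abs_le_square_iff)
      have "(w c)\<^sup>2 = (\<Sum>i\<in>?c - {r c}. (x i)\<^sup>2 * w c)" by (simp add: w_def power2_eq_square sum_distrib_right)
      \<comment> \<open>In \<open>w c\<close> the term of \<open>i\<close> is exchanged for the
        larger term of the representative, so the diagonal disappears and only pairs of distinct
        members remain.\<close>
      also have "\<dots> \<le> (\<Sum>i\<in>?c - {r c}. (x i)\<^sup>2 * (\<Sum>j\<in>?c - {i}. (x j)\<^sup>2))"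
      proof (intro sum_mono mult_left_mono)
        fix i assume i: "i \<in> ?c - {r c}"
        have "w c = (x i)\<^sup>2 + (\<Sum>j\<in>?c - {r c} - {i}. (x j)\<^sup>2)"
          unfolding w_def using fcell i by (intro sum.remove) auto
        also have "\<dots> \<le> (x (r c))\<^sup>2 + (\<Sum>j\<in>?c - {i} - {r c}. (x j)\<^sup>2)"
          using mx[of i] i by (intro add_mono) (auto simp: Diff_insert2[symmetric] insert_commute)
        also have "\<dots> = (\<Sum>j\<in>?c - {i}. (x j)\<^sup>2)"
          using fcell rc i by (intro sum.remove[symmetric]) auto
        finally show "w c \<le> (\<Sum>j\<in>?c - {i}. (x j)\<^sup>2)" .
      qed auto
      also have "\<dots> \<le> (\<Sum>i\<in>?c. (x i)\<^sup>2 * (\<Sum>j\<in>?c - {i}. (x j)\<^sup>2))"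
        using fcell by (intro sum_mono2) (auto intro!: mult_nonneg_nonneg sum_nonneg)
      also have "\<dots> = (\<Sum>(i, j)\<in>Sigma ?c (\<lambda>i. ?c - {i}). (x i)\<^sup>2 * (x j)\<^sup>2)"
        using fcell by (simp add: sum_distrib_left sum.Sigma)
      also have "Sigma ?c (\<lambda>i. ?c - {i}) = offdiag ?c ?c" by (auto simp: offdiag_def)
      finally show ?thesis .
    qed
    have "(\<Sum>c\<in>C. (w c)\<^sup>2) \<le> (\<Sum>c\<in>C. \<Sum>(i, j)\<in>offdiag (cell \<phi> S c) (cell \<phi> S c). (x i)\<^sup>2 * (x j)\<^sup>2)"
      by (rule sum_mono[OF one])
    also have "\<dots> = (\<Sum>(i, j)\<in>(\<Union>c\<in>C. offdiag (cell \<phi> S c) (cell \<phi> S c)). (x i)\<^sup>2 * (x j)\<^sup>2)"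
      using fC fcell by (intro sum.UNION_disjoint[symmetric]) (auto simp: finite_offdiag, auto simp: offdiag_def cell_def)
    also have "\<dots> = (\<Sum>(i, j)\<in>(\<Union>c\<in>C. offdiag (cell \<phi> S c) (cell \<phi> S c)). (x i)\<^sup>2 * (x j)\<^sup>2 * same_cell \<phi> i j)"
      by (intro sum.cong refl) (auto simp: offdiag_def cell_def same_cell_def)
    also have "\<dots> \<le> (\<Sum>(i, j)\<in>offdiag (S - G) (S - G). (x i)\<^sup>2 * (x j)\<^sup>2 * same_cell \<phi> i j)"
      using fin by (intro sum_mono2) (auto simp: finite_offdiag same_cell_def, auto simp: offdiag_def cell_def C_def, (metis imageI)+)
    finally show "(\<Sum>c\<in>C. (w c)\<^sup>2) \<le> (\<Sum>(i, j)\<in>offdiag (S - G) (S - G). (x i)\<^sup>2 * (x j)\<^sup>2 * same_cell \<phi> i j)" .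
  qed
  finally show ?thesis using sub c by (intro exI[of _ G'] conjI) auto
qed

text \<open>Every survivor that does not represent its cell collides with the one that does.\<close>

lemma selected_card:
  assumes fin: "finite S" and Y: "finite Y" "card Y \<le> K'"
  shows "real (card {i \<in> S. \<phi> i \<in> Y}) \<le> K' + (\<Sum>(i, j)\<in>offdiag S S. same_cell \<phi> i j)"
proof -
  \<comment> \<open>Any choice of one member per cell will do, hence the empty heavy set and the
    zero vector.\<close>
  define r where "r = rep \<phi> S {} (\<lambda>_. 0)"
  define A where "A = {i \<in> S. r (\<phi> i) \<noteq> i}"
  have ri: "r (\<phi> i) \<in> S" "\<phi> (r (\<phi> i)) = \<phi> i" if "i \<in> S" for i
    using rep_image[OF fin, of "\<phi> i" \<phi>] that unfolding r_def by auto
  have fA: "finite A" using fin by (simp add: A_def)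
  have "{i \<in> S. \<phi> i \<in> Y} \<subseteq> r ` Y \<union> A" by (force simp: A_def)
  then have "card {i \<in> S. \<phi> i \<in> Y} \<le> card (r ` Y) + card A"
    using Y fA by (meson card_Un_le card_mono finite_UnI finite_imageI le_trans)
  also have "card (r ` Y) \<le> K'" using Y card_image_le[of Y r] by linarith
  finally have "real (card {i \<in> S. \<phi> i \<in> Y}) \<le> K' + real (card A)" by linarith
  also have "real (card A) = (\<Sum>i\<in>A. same_cell \<phi> i (r (\<phi> i)))"
    using ri by (simp add: same_cell_def A_def)
  also have "\<dots> = (\<Sum>(i, j)\<in>(\<lambda>i. (i, r (\<phi> i))) ` A. same_cell \<phi> i j)"
    by (subst sum.reindex) (auto simp: inj_on_def)
  also have "\<dots> \<le> (\<Sum>(i, j)\<in>offdiag S S. same_cell \<phi> i j)"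
    using fin ri by (intro sum_mono2 finite_offdiag) (auto simp: offdiag_def A_def same_cell_def)
  finally show ?thesis by simp
qed

lemma collided_card:
  assumes "finite G" "finite J"
  shows "real (card {j \<in> J. \<exists>g\<in>G. g \<noteq> j \<and> \<phi> j = \<phi> g}) \<le> (\<Sum>(i, j)\<in>offdiag J G. same_cell \<phi> i j)"
proof -
  define A where "A = {j \<in> J. \<exists>g\<in>G. g \<noteq> j \<and> \<phi> j = \<phi> g}"
  define p where "p = (\<lambda>j. SOME g. g \<in> G \<and> g \<noteq> j \<and> \<phi> j = \<phi> g)"
  have p: "p j \<in> G \<and> p j \<noteq> j \<and> \<phi> j = \<phi> (p j)" if "j \<in> A" for j
    unfolding p_def using that someI_ex[of "\<lambda>g. g \<in> G \<and> g \<noteq> j \<and> \<phi> j = \<phi> g"] by (auto simp: A_def)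
  have "real (card A) = (\<Sum>j\<in>A. same_cell \<phi> j (p j))"
    using p by (simp add: same_cell_def)
  also have "\<dots> = (\<Sum>(i, j)\<in>(\<lambda>i. (i, p i)) ` A. same_cell \<phi> i j)"
    by (subst sum.reindex) (auto simp: inj_on_def)
  also have "\<dots> \<le> (\<Sum>(i, j)\<in>offdiag J G. same_cell \<phi> i j)"
  proof (rule sum_mono2)
    show "finite (offdiag J G)" using assms by (intro finite_offdiag)
    have "(i, p i) \<in> offdiag J G" if "i \<in> A" for i
      using p[OF that] that by (metis (mono_tags, lifting) A_def case_prodI mem_Collect_eq offdiag_def)
    then show "(\<lambda>i. (i, p i)) ` A \<subseteq> offdiag J G" by blast
  qed (auto simp: same_cell_def)
  finally show ?thesis unfolding A_def .
qed

text \<open>The price of losing a coordinate of modulus at most \<open>t + f\<close> and gaining one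
  of modulus at least \<open>t - w\<close>. The squares of \<open>t\<close> cancel, so the loss is
  of first order in the errors; if \<open>w\<close> exceeds \<open>t\<close>, nothing need be
  gained, but then \<open>t * t \<le> t * w\<close>.\<close>

lemma threshold_loss:
  fixes t f w :: real
  assumes "0 \<le> t" "0 \<le> f" "0 \<le> w"
  shows "(t + f)\<^sup>2 \<le> (max 0 (t - w))\<^sup>2 + 2 * t * (f + w) + f\<^sup>2"
proof (cases "w \<le> t")
  case True
  then have "max 0 (t - w) = t - w" by simp
  then show ?thesis by (simp add: power2_eq_square algebra_simps)
next
  case False
  then have "t * t \<le> t * w" "0 \<le> t * w" using assms by (auto intro: mult_left_mono)
  moreover have "max 0 (t - w) = 0" using False by simp
  ultimately show ?thesis by (simp add: power2_eq_square algebra_simps)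
qed

text \<open>Coordinates of \<open>J\<close> whose cells are not selected are exchanged for representatives of
  selected cells with a comparable score.\<close>

lemma swap_loss:
  fixes x :: "nat \<Rightarrow> real" and sc \<omega> f :: "nat \<Rightarrow> real" and V V2 F Lc \<theta> :: real
  assumes fin: "finite S" and J: "J \<subseteq> S" "card J \<le> k" and S: "S \<subseteq> {..<n}" and \<phi>: "\<And>i. i \<in> S \<Longrightarrow> \<phi> i < N"
    and k: "1 \<le> k" "4 * k \<le> K'"
    and Y: "Y \<subseteq> {..<N}" "card Y = K'" "\<And>c c'. c \<in> Y \<Longrightarrow> c' < N \<Longrightarrow> c' \<notin> Y \<Longrightarrow> sc c' \<le> sc c"
    and sc0: "\<And>c. 0 \<le> sc c"
    and V: "(\<Sum>i\<in>S - J. (x i)\<^sup>2) \<le> V"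
    and sc: "\<And>c. c \<in> Y - \<phi> ` J \<Longrightarrow> sc c \<le> (if c \<in> \<phi> ` S then \<bar>x (rep \<phi> S G x c)\<bar> else 0) + \<omega> c"
    and \<omega>: "\<And>c. 0 \<le> \<omega> c" "(\<Sum>c\<in>Y - \<phi> ` J. (\<omega> c)\<^sup>2) \<le> V2"
    and f: "\<And>j. j \<in> J - Jc \<Longrightarrow> \<bar>x j\<bar> \<le> sc (\<phi> j) + f j" "\<And>j. 0 \<le> f j" "(\<Sum>j\<in>J - Jc. (f j)\<^sup>2) \<le> F"
    and \<theta>: "4 * (V + V2) / K' \<le> \<theta>"
    and Lc: "(\<Sum>j\<in>J \<inter> Jc. if (sc (\<phi> j))\<^sup>2 \<le> \<theta> then (x j)\<^sup>2 else 0) \<le> Lc"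
  shows "\<exists>J'\<subseteq>{i \<in> S. \<phi> i \<in> Y}. card J' \<le> k \<and>
    (\<Sum>i\<in>{..<n} - J'. (x i)\<^sup>2) \<le> (\<Sum>i\<in>{..<n} - J. (x i)\<^sup>2)
      + 2 * sqrt \<theta> * (sqrt (k * F) + k * sqrt (4 * V2 / K')) + F + Lc"
proof -
  define L where "L = {j \<in> J. \<phi> j \<notin> Y}"
  define Y' where "Y' = Y - \<phi> ` J"
  define v where "v = (\<lambda>c. if c \<in> \<phi> ` S then \<bar>x (rep \<phi> S G x c)\<bar> else 0)"
  define t where "t = Min (sc ` Y')"
  define w where "w = sqrt (4 * V2 / K')"
  have fJ: "finite J" using J fin finite_subset by blast
  have fY: "finite Y" using Y finite_subset by blast
  have fY': "finite Y'" using fY by (simp add: Y'_def)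
  have K0: "real K' > 0" using k by linarith
  have cY': "K' \<le> 2 * card Y'"
  proof -
    have "K' - card (\<phi> ` J) \<le> card Y'" unfolding Y'_def Y(2)[symmetric] using fJ by (intro diff_card_le_card_Diff) auto
    moreover have "card (\<phi> ` J) \<le> k" using card_image_le[OF fJ, of \<phi>] J by linarith
    ultimately show ?thesis using k by linarith
  qed
  have Yne: "Y' \<noteq> {}" using cY' k by force
  have t: "t \<in> sc ` Y'" "\<And>c. c \<in> Y' \<Longrightarrow> t \<le> sc c"
    unfolding t_def using fY' Yne by (auto intro: Min_in)
  have t0: "0 \<le> t" using t(1) sc0 by auto
  have \<omega>2: "(\<Sum>c\<in>Y'. (\<omega> c)\<^sup>2) \<le> V2" using \<omega>(2) by (simp add: Y'_def)
  have sc': "sc c \<le> v c + \<omega> c" if "c \<in> Y'" for c using sc that by (simp add: Y'_def v_def)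
  have V20: "0 \<le> V2" by (rule order_trans[OF _ \<omega>(2)]) (auto intro: sum_nonneg)
  have repJ: "rep \<phi> S G x c \<in> S - J" "\<phi> (rep \<phi> S G x c) = c" if "c \<in> Y' \<inter> \<phi> ` S" for c
  proof -
    have "c \<in> \<phi> ` S" "c \<notin> \<phi> ` J" using that by (auto simp: Y'_def)
    then show "rep \<phi> S G x c \<in> S - J" "\<phi> (rep \<phi> S G x c) = c"
      using rep_image[OF fin, of c \<phi> G x] by (metis DiffI imageI)+
  qed
  have sumv: "(\<Sum>c\<in>Z. (v c)\<^sup>2) = (\<Sum>i\<in>rep \<phi> S G x ` (Z \<inter> \<phi> ` S). (x i)\<^sup>2)" if "finite Z" for Z
  proof -
    have "(\<Sum>c\<in>Z. (v c)\<^sup>2) = (\<Sum>c\<in>Z \<inter> \<phi> ` S. (x (rep \<phi> S G x c))\<^sup>2)"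
      using that by (intro sum.mono_neutral_cong_right) (auto simp: v_def)
    then show ?thesis using inj_on_rep[OF fin, of "Z \<inter> \<phi> ` S" \<phi> G x] by (simp add: sum.reindex)
  qed
  \<comment> \<open>At least half of the selected cells avoid \<open>J\<close>. Each has score at
    least \<open>t\<close>, and the squares of their scores sum to at most
    \<open>2 * (V + V2)\<close>.\<close>
  have tsq: "t\<^sup>2 \<le> \<theta>"
  proof -
    have "card Y' * t\<^sup>2 = (\<Sum>c\<in>Y'. t\<^sup>2)" by simp
    also have "\<dots> \<le> (\<Sum>c\<in>Y'. (v c + \<omega> c)\<^sup>2)"
    proof (intro sum_mono power_mono t0)
      fix c assume c: "c \<in> Y'"
      show "t \<le> v c + \<omega> c" using t(2)[OF c] sc'[OF c] by linarith
    qed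
    also have "\<dots> \<le> 2 * (\<Sum>c\<in>Y'. (v c)\<^sup>2) + 2 * (\<Sum>c\<in>Y'. (\<omega> c)\<^sup>2)" by (rule sum_square_le2)
    finally have "card Y' * t\<^sup>2 \<le> 2 * (\<Sum>c\<in>Y'. (v c)\<^sup>2) + 2 * (\<Sum>c\<in>Y'. (\<omega> c)\<^sup>2)" .
    moreover have "(\<Sum>c\<in>Y'. (v c)\<^sup>2) \<le> (\<Sum>i\<in>S - J. (x i)\<^sup>2)"
      unfolding sumv[OF fY'] using fin repJ by (intro sum_mono2) auto
    moreover have "2 * a + 2 * b \<le> 2 * (V + V2)" if "a \<le> c" "c \<le> V" "b \<le> V2" for a b c :: real
      using that by simp
    ultimately have *: "card Y' * t\<^sup>2 \<le> 2 * (V + V2)" using V \<omega>2 by (meson order_trans)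
    have "K' * t\<^sup>2 \<le> (2 * card Y') * t\<^sup>2" using cY' by (intro mult_right_mono) (simp_all flip: of_nat_mult)
    then have "K' * t\<^sup>2 \<le> 4 * (V + V2)" using * by simp
    then have "t\<^sup>2 \<le> 4 * (V + V2) / K'" using K0 by (simp add: field_simps)
    then show ?thesis using \<theta> by linarith
  qed
  have \<theta>0: "0 \<le> \<theta>" using tsq by (rule order_trans[rotated]) simp
  have tle: "t \<le> sqrt \<theta>" using tsq t0 by (rule_tac real_le_rsqrt)
  \<comment> \<open>Fewer than \<open>K' / 4\<close> of the cells in \<open>Y'\<close> can have a
    squared error above \<open>4 * V2 / K'\<close>; as \<open>4 * k \<le> K'\<close>, enough
    accurate cells remain to replace every lost coordinate.\<close>
  define Good where "Good = {c \<in> Y'. (\<omega> c)\<^sup>2 \<le> 4 * V2 / K'}"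
  have cG: "k \<le> card Good"
  proof (rule ccontr)
    assume "\<not> k \<le> card Good"
    then have g: "card Good < k" by simp
    define Bad where "Bad = Y' - Good"
    have "card Bad = card Y' - card Good" unfolding Bad_def Good_def using fY' by (intro card_Diff_subset) auto
    then have b: "K' < 4 * card Bad" "card Bad \<noteq> 0" using g cY' k by linarith+
    have "V2 < (\<Sum>c\<in>Bad. (\<omega> c)\<^sup>2)"
    proof -
      have "V2 \<le> card Bad * (4 * V2 / K')"
      proof -
        have "real K' * V2 \<le> real (4 * card Bad) * V2" using b V20 by (intro mult_right_mono) auto
        then show ?thesis using K0 by (simp add: field_simps)
      qed
      also have "\<dots> = (\<Sum>c\<in>Bad. 4 * V2 / K')" by simp
      also have "\<dots> < (\<Sum>c\<in>Bad. (\<omega> c)\<^sup>2)"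
      proof (rule sum_strict_mono)
        show "finite Bad" using fY' by (simp add: Bad_def)
        show "Bad \<noteq> {}" using b(2) by auto
      qed (auto simp: Bad_def Good_def)
      finally show ?thesis .
    qed
    also have "\<dots> \<le> (\<Sum>c\<in>Y'. (\<omega> c)\<^sup>2)" using fY' by (intro sum_mono2) (auto simp: Bad_def)
    finally show False using \<omega>2 by linarith
  qed
  have fL: "finite L" "L \<subseteq> J" using fJ by (auto simp: L_def)
  have cL: "card L \<le> k" using card_mono[OF fJ fL(2)] J by linarith
  then obtain Z where Z: "Z \<subseteq> Good" "card Z = card L" using cG obtain_subset_with_card_n by (meson le_trans)
  have ZY: "Z \<subseteq> Y'" using Z by (auto simp: Good_def)
  have fZ: "finite Z" using finite_subset[OF ZY fY'] .
  define R where "R = rep \<phi> S G x ` (Z \<inter> \<phi> ` S)"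
  define J' where "J' = (J - L) \<union> R"
  have RJ: "R \<inter> J = {}" "R \<subseteq> {i \<in> S. \<phi> i \<in> Y}"
    using repJ ZY unfolding R_def Y'_def by force+
  have fR: "finite R" using fZ by (simp add: R_def)
  have sub: "J' \<subseteq> {i \<in> S. \<phi> i \<in> Y}" using RJ(2) J(1) by (auto simp: J'_def L_def)
  have card: "card J' \<le> k"
  proof -
    have "card J' \<le> card (J - L) + card R" unfolding J'_def by (rule card_Un_le)
    also have "card R \<le> card Z" unfolding R_def using fZ by (meson card_image_le card_mono finite_Int inf_le1 le_trans)
    also have "card (J - L) = card J - card L" using fL by (intro card_Diff_subset)
    finally show ?thesis using Z(2) card_mono[OF fJ fL(2)] J(2) by linarith
  qed
  have Jn: "J \<subseteq> {..<n}" "J' \<subseteq> {..<n}" using J S sub by auto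
  have "(\<Sum>i\<in>{..<n} - J'. (x i)\<^sup>2) = (\<Sum>i<n. (x i)\<^sup>2) - (\<Sum>i\<in>J'. (x i)\<^sup>2)"
    using Jn by (intro sum_diff) auto
  also have "(\<Sum>i\<in>J'. (x i)\<^sup>2) = (\<Sum>i\<in>J. (x i)\<^sup>2) - (\<Sum>i\<in>L. (x i)\<^sup>2) + (\<Sum>i\<in>R. (x i)\<^sup>2)"
  proof -
    have "(\<Sum>i\<in>J'. (x i)\<^sup>2) = (\<Sum>i\<in>J - L. (x i)\<^sup>2) + (\<Sum>i\<in>R. (x i)\<^sup>2)"
      unfolding J'_def using fJ fR RJ by (intro sum.union_disjoint) auto
    moreover have "(\<Sum>i\<in>J - L. (x i)\<^sup>2) = (\<Sum>i\<in>J. (x i)\<^sup>2) - (\<Sum>i\<in>L. (x i)\<^sup>2)"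
      using fL fJ by (intro sum_diff) auto
    ultimately show ?thesis by simp
  qed
  also have "(\<Sum>i<n. (x i)\<^sup>2) - ((\<Sum>i\<in>J. (x i)\<^sup>2) - (\<Sum>i\<in>L. (x i)\<^sup>2) + (\<Sum>i\<in>R. (x i)\<^sup>2))
     = (\<Sum>i\<in>{..<n} - J. (x i)\<^sup>2) + (\<Sum>i\<in>L. (x i)\<^sup>2) - (\<Sum>i\<in>R. (x i)\<^sup>2)"
    using Jn by (simp add: sum_diff)
  also have "\<dots> \<le> (\<Sum>i\<in>{..<n} - J. (x i)\<^sup>2) + (2 * sqrt \<theta> * (sqrt (k * F) + k * w) + F + Lc)"
  proof -
    have w0: "0 \<le> w" using V20 by (simp add: w_def)
    have vZ: "max 0 (t - w) \<le> v c" if "c \<in> Z" for c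
    proof -
      have c: "c \<in> Y'" "(\<omega> c)\<^sup>2 \<le> 4 * V2 / K'" using that Z(1) by (auto simp: Good_def)
      have "\<omega> c \<le> w" unfolding w_def by (rule real_le_rsqrt[OF c(2)])
      moreover have "t \<le> v c + \<omega> c" using t(2)[OF c(1)] sc'[OF c(1)] by linarith
      moreover have "0 \<le> v c" by (simp add: v_def)
      ultimately show ?thesis by linarith
    qed
    have RZ: "card L * (max 0 (t - w))\<^sup>2 \<le> (\<Sum>i\<in>R. (x i)\<^sup>2)"
    proof -
      have "card L * (max 0 (t - w))\<^sup>2 = (\<Sum>c\<in>Z. (max 0 (t - w))\<^sup>2)" using Z(2) by simp
      also have "\<dots> \<le> (\<Sum>c\<in>Z. (v c)\<^sup>2)" using vZ by (intro sum_mono power_mono) auto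
      finally show ?thesis unfolding sumv[OF fZ] R_def .
    qed
    have scL: "sc (\<phi> j) \<le> t" if "j \<in> L" for j
    proof -
      obtain c where c: "c \<in> Y'" "t = sc c" using t(1) by auto
      have "\<phi> j < N" using that J(1) \<phi> by (auto simp: L_def)
      then show ?thesis using Y(3)[of c "\<phi> j"] c that unfolding Y'_def L_def by auto
    qed
    \<comment> \<open>Lost coordinates in \<open>Jc\<close> are written off entirely: their score
      lies below the threshold, so \<open>Lc\<close> bounds them. Only the others are balanced
      against the replacements.\<close>
    have "(\<Sum>i\<in>L. (x i)\<^sup>2) = (\<Sum>i\<in>L - Jc. (x i)\<^sup>2) + (\<Sum>i\<in>L \<inter> Jc. (x i)\<^sup>2)"
      using sum.Int_Diff[OF fL(1), of "\<lambda>i. (x i)\<^sup>2" Jc] by simp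
    also have "(\<Sum>i\<in>L \<inter> Jc. (x i)\<^sup>2) \<le> Lc"
    proof -
      have "(\<Sum>i\<in>L \<inter> Jc. (x i)\<^sup>2) = (\<Sum>j\<in>L \<inter> Jc. if (sc (\<phi> j))\<^sup>2 \<le> \<theta> then (x j)\<^sup>2 else 0)"
      proof (rule sum.cong[OF refl])
        fix j assume "j \<in> L \<inter> Jc"
        then have "(sc (\<phi> j))\<^sup>2 \<le> t\<^sup>2" using scL sc0 by (intro power_mono) auto
        then show "(x j)\<^sup>2 = (if (sc (\<phi> j))\<^sup>2 \<le> \<theta> then (x j)\<^sup>2 else 0)" using tsq by simp
      qed
      also have "\<dots> \<le> (\<Sum>j\<in>J \<inter> Jc. if (sc (\<phi> j))\<^sup>2 \<le> \<theta> then (x j)\<^sup>2 else 0)"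
        using fJ fL by (intro sum_mono2) auto
      finally show ?thesis using Lc by linarith
    qed
    also have "(\<Sum>i\<in>L - Jc. (x i)\<^sup>2) \<le> (\<Sum>j\<in>L - Jc. (max 0 (t - w))\<^sup>2 + 2 * t * (f j + w) + (f j)\<^sup>2)"
    proof (rule sum_mono)
      fix j assume j: "j \<in> L - Jc"
      have "\<bar>x j\<bar> \<le> t + f j" using f(1)[of j] scL[of j] j fL by fastforce
      then have "(x j)\<^sup>2 \<le> (t + f j)\<^sup>2" by (metis abs_ge_zero power2_abs power_mono)
      also have "\<dots> \<le> (max 0 (t - w))\<^sup>2 + 2 * t * (f j + w) + (f j)\<^sup>2"
        by (rule threshold_loss[OF t0 f(2) w0])
      finally show "(x j)\<^sup>2 \<le> (max 0 (t - w))\<^sup>2 + 2 * t * (f j + w) + (f j)\<^sup>2" .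
    qed
    also have "\<dots> = card (L - Jc) * (max 0 (t - w))\<^sup>2 + 2 * t * ((\<Sum>j\<in>L - Jc. f j) + card (L - Jc) * w) + (\<Sum>j\<in>L - Jc. (f j)\<^sup>2)"
      by (simp add: sum.distrib sum_distrib_left[symmetric] distrib_left)
    also have "\<dots> \<le> card L * (max 0 (t - w))\<^sup>2 + 2 * sqrt \<theta> * (sqrt (k * F) + k * w) + F"
    proof (intro add_mono mult_mono)
      have cLJ: "card (L - Jc) \<le> card L" using fL by (intro card_mono) auto
      then show "real (card (L - Jc)) \<le> real (card L)" "real (card (L - Jc)) \<le> real k" using cL by simp_all
      have "(\<Sum>j\<in>L - Jc. (f j)\<^sup>2) \<le> (\<Sum>j\<in>J - Jc. (f j)\<^sup>2)" using fJ fL by (intro sum_mono2) auto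
      then show *: "(\<Sum>j\<in>L - Jc. (f j)\<^sup>2) \<le> F" using f(3) by linarith
      show "(\<Sum>j\<in>L - Jc. f j) \<le> sqrt (k * F)"
        using * cLJ cL by (intro sum_le_sqrt_card) auto
    qed (use w0 t0 tle f(2) \<theta>0 in \<open>auto intro!: add_nonneg_nonneg sum_nonneg mult_nonneg_nonneg\<close>)
    finally show ?thesis using RZ by linarith
  qed
  finally show ?thesis using sub card unfolding w_def by (intro exI[of _ J'] conjI) (auto simp: algebra_simps)
qed

section \<open>One stage\<close>

lemma top_k_set_exists:
  fixes x :: "nat \<Rightarrow> real"
  shows "\<exists>S. S \<subseteq> {..<n} \<and> card S = min k n \<and> (\<forall>i\<in>S. \<forall>j\<in>{..<n} - S. \<bar>x j\<bar> \<le> \<bar>x i\<bar>)"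
proof (induction k)
  case 0 then show ?case by (intro exI[of _ "{}"]) auto
next
  case (Suc k)
  then obtain S where S: "S \<subseteq> {..<n}" "card S = min k n" "\<And>i j. i \<in> S \<Longrightarrow> j \<in> {..<n} - S \<Longrightarrow> \<bar>x j\<bar> \<le> \<bar>x i\<bar>" by blast
  show ?case
  proof (cases "k < n")
    case False
    then have "min (Suc k) n = min k n" by simp
    then show ?thesis using S by metis
  next
    case True
    let ?R = "{..<n} - S"
    have fS: "finite S" using S(1) finite_subset by blast
    have "card ?R = n - k" using S True fS by (simp add: card_Diff_subset)
    then have ne: "?R \<noteq> {}" using True by (metis card.empty diff_is_0_eq not_less)
    have "Max ((\<lambda>i. \<bar>x i\<bar>) ` ?R) \<in> (\<lambda>i. \<bar>x i\<bar>) ` ?R" using ne by (intro Max_in) auto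
    then obtain a where a: "a \<in> ?R" "Max ((\<lambda>i. \<bar>x i\<bar>) ` ?R) = \<bar>x a\<bar>" by auto
    have mx: "\<bar>x j\<bar> \<le> \<bar>x a\<bar>" if "j \<in> ?R" for j unfolding a(2)[symmetric] using that by (intro Max_ge) auto
    have "insert a S \<subseteq> {..<n}" using S(1) a(1) by auto
    moreover have "card (insert a S) = min (Suc k) n" using a(1) fS S(2) True by simp
    moreover have "\<bar>x j\<bar> \<le> \<bar>x i\<bar>" if "i \<in> insert a S" "j \<in> {..<n} - insert a S" for i j
      using that S(3)[of i j] mx[of j] by auto
    ultimately show ?thesis by (intro exI[of _ "insert a S"]) auto
  qed
qed

lemma top_k_set:
  shows "top_k_set n k x \<subseteq> {..<n}" "card (top_k_set n k x) = min k n"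
    "i \<in> top_k_set n k x \<Longrightarrow> j < n \<Longrightarrow> j \<notin> top_k_set n k x \<Longrightarrow> \<bar>x j\<bar> \<le> \<bar>x i\<bar>"
  using someI_ex[OF top_k_set_exists[of n k x]] unfolding top_k_set_def[symmetric] by auto

lemma decode_cong: "(\<And>l. l < m \<Longrightarrow> b l = b' l) \<Longrightarrow> decode m N D A b = decode m N D A b'"
proof -
  assume e: "\<And>l. l < m \<Longrightarrow> b l = b' l"
  have "(\<Sum>l<m. (b l - g l)\<^sup>2) = (\<Sum>l<m. (b' l - g l)\<^sup>2)" for g :: "nat \<Rightarrow> real"
    using e by (intro sum.cong) auto
  then show ?thesis unfolding decode_def by presburger
qed

definition cellv :: "(nat \<Rightarrow> nat) \<Rightarrow> (nat \<Rightarrow> nat \<Rightarrow> real) \<Rightarrow> nat set \<Rightarrow> (nat \<Rightarrow> real) \<Rightarrow> nat \<Rightarrow> nat \<Rightarrow> real" where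
  "cellv \<phi> u S x l c = (\<Sum>i\<in>cell \<phi> S c. u l i * x i)"

text \<open>The adjoint of the map from \<open>x\<close> to its cell values: a row acting on cells
  becomes a measurement vector acting on coordinates.\<close>

definition lift_row :: "(nat \<Rightarrow> nat) \<Rightarrow> (nat \<Rightarrow> nat \<Rightarrow> real) \<Rightarrow> nat set \<Rightarrow> nat \<Rightarrow> (nat \<Rightarrow> real) \<Rightarrow> nat \<Rightarrow> real" where
  "lift_row \<phi> u S l a = (\<lambda>i. if i \<in> S then a (\<phi> i) * u l i else 0)"

lemma inner_lift_row:
  assumes "S \<subseteq> {..<n}" "\<And>i. i \<in> S \<Longrightarrow> \<phi> i < N"
  shows "inner_n n (lift_row \<phi> u S l a) x = inner_n N a (cellv \<phi> u S x l)"
proof -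
  have fS: "finite S" using assms(1) finite_subset by blast
  have "inner_n n (lift_row \<phi> u S l a) x = (\<Sum>i\<in>S. a (\<phi> i) * u l i * x i)"
    unfolding inner_n_def lift_row_def using assms(1) by (intro sum.mono_neutral_cong_right) auto
  also have "\<dots> = (\<Sum>c<N. \<Sum>i\<in>{i \<in> S. \<phi> i = c}. a (\<phi> i) * u l i * x i)"
    using assms fS by (intro sum.group[symmetric]) auto
  also have "\<dots> = inner_n N a (cellv \<phi> u S x l)"
    unfolding inner_n_def cellv_def cell_def sum_distrib_left by (intro sum.cong refl) (auto simp: mult.assoc)
  finally show ?thesis .
qed

type_synonym seed = "(nat \<Rightarrow> nat) \<times> (nat \<Rightarrow> nat \<Rightarrow> real) \<times> (nat \<Rightarrow> nat \<Rightarrow> real) \<times> (nat \<times> nat \<Rightarrow> real)"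

text \<open>Rows below \<open>32 * K\<close> serve the sparse recovery of the cell values, the other \<open>K\<close> rows are a sign
  sketch of its residual, which turns an error in \<open>l2\<close> norm into an error per cell.\<close>

definition stage_row :: "nat \<Rightarrow> (nat \<Rightarrow> nat \<Rightarrow> real) \<Rightarrow> (nat \<times> nat \<Rightarrow> real) \<Rightarrow> nat \<Rightarrow> nat \<Rightarrow> real" where
  "stage_row K A s r = (if r < 32 * K then A r else (\<lambda>c. s (r - 32 * K, c)))"

text \<open>One block of \<open>33 * K\<close> rows per weighting, all in one round. The four blocks
  share the matrix and the signs.\<close>

definition stage_rows :: "nat \<Rightarrow> seed \<Rightarrow> nat set \<Rightarrow> (nat \<Rightarrow> real) list" where
  "stage_rows K w S = (case w of (\<phi>, u, A, s) \<Rightarrow>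
     map (\<lambda>q. lift_row \<phi> u S (q div (33 * K)) (stage_row K A s (q mod (33 * K)))) [0..<4 * (33 * K)])"

definition estimate :: "nat \<Rightarrow> nat \<Rightarrow> (nat \<Rightarrow> nat \<Rightarrow> real) \<Rightarrow> (nat \<times> nat \<Rightarrow> real) \<Rightarrow> (nat \<Rightarrow> real) \<Rightarrow> nat \<Rightarrow> real" where
  "estimate K N A s b c = (let z = decode (32 * K) N (2 * K) A b in
     z c + (\<Sum>r<K. s (r, c) * (b (32 * K + r) - (\<Sum>c'<N. s (r, c') * z c'))) / K)"

text \<open>The maximum is small only if all four estimates are, which bounds the energy of the
  cell, and it is at least the estimate from the sign weighting, which bounds an isolated
  coordinate.\<close>

definition score :: "nat \<Rightarrow> nat \<Rightarrow> (nat \<Rightarrow> nat \<Rightarrow> real) \<Rightarrow> (nat \<times> nat \<Rightarrow> real) \<Rightarrow> (nat \<Rightarrow> nat \<Rightarrow> real) \<Rightarrow> nat \<Rightarrow> real" where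
  "score K N A s b c = Max ((\<lambda>l. \<bar>estimate K N A s (b l) c\<bar>) ` {..<4})"

definition stage_step :: "nat \<Rightarrow> nat \<Rightarrow> nat \<Rightarrow> seed \<Rightarrow> nat set \<Rightarrow> real list \<Rightarrow> nat set" where
  "stage_step K K' N w S obs = (case w of (\<phi>, u, A, s) \<Rightarrow>
     {i \<in> S. \<phi> i \<in> top_k_set N K' (score K N A s (\<lambda>l r. obs ! (l * (33 * K) + r)))})"

lemma length_stage_rows: "length (stage_rows K w S) = 132 * K"
  by (cases w) (simp add: stage_rows_def)

definition residual :: "nat \<Rightarrow> nat \<Rightarrow> (nat \<Rightarrow> nat \<Rightarrow> real) \<Rightarrow> (nat \<Rightarrow> real) \<Rightarrow> nat \<Rightarrow> real" where
  "residual K N A y c = y c - decode (32 * K) N (2 * K) A (\<lambda>r. inner_n N (A r) y) c"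

text \<open>By linearity, subtracting the sketch of the decoded vector from the measured one leaves
  a sketch of the residual.\<close>

lemma estimate_error:
  assumes K: "K \<ge> 1" and b: "\<And>r. r < 33 * K \<Longrightarrow> b r = inner_n N (stage_row K A s r) y"
  shows "estimate K N A s b c = y c + sketch_err K N s (residual K N A y) c"
proof -
  define z where "z = decode (32 * K) N (2 * K) A b"
  have z: "z = decode (32 * K) N (2 * K) A (\<lambda>r. inner_n N (A r) y)"
    unfolding z_def using b by (intro decode_cong) (auto simp: stage_row_def)
  have r: "residual K N A y c = y c - z c" for c by (simp add: residual_def z)
  have "b (32 * K + l) - (\<Sum>c'<N. s (l, c') * z c') = (\<Sum>c'<N. s (l, c') * residual K N A y c')" if "l < K" for l
  proof -
    have "b (32 * K + l) = (\<Sum>c'<N. s (l, c') * y c')" using b[of "32 * K + l"] that by (simp add: stage_row_def inner_n_def)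
    then show ?thesis unfolding r by (simp add: right_diff_distrib sum_subtractf)
  qed
  then have "(\<Sum>l<K. s (l, c) * (b (32 * K + l) - (\<Sum>c'<N. s (l, c') * z c')))
     = (\<Sum>l<K. s (l, c) * (\<Sum>c'<N. s (l, c') * residual K N A y c'))" by (intro sum.cong) auto
  then show ?thesis unfolding estimate_def Let_def z_def[symmetric] sketch_err_def r[of c] by simp
qed

lemma stage_step_eq:
  assumes K: "K \<ge> 1" and S: "S \<subseteq> {..<n}" "\<And>i. i \<in> S \<Longrightarrow> \<phi> i < N"
  shows "stage_step K K' N (\<phi>, u, A, s) S (map (\<lambda>a. inner_n n a x) (stage_rows K (\<phi>, u, A, s) S))
    = {i \<in> S. \<phi> i \<in> top_k_set N K' (\<lambda>c. Max ((\<lambda>l. \<bar>cellv \<phi> u S x l c +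
        sketch_err K N s (residual K N A (cellv \<phi> u S x l)) c\<bar>) ` {..<4}))}"
proof -
  define b where "b = (\<lambda>l r. map (\<lambda>a. inner_n n a x) (stage_rows K (\<phi>, u, A, s) S) ! (l * (33 * K) + r))"
  have "b l r = inner_n N (stage_row K A s r) (cellv \<phi> u S x l)" if "l < 4" "r < 33 * K" for l r
  proof -
    have "l * (33 * K) + r < Suc l * (33 * K)" using that by simp
    also have "\<dots> \<le> 4 * (33 * K)" using that by (intro mult_right_mono) auto
    finally have "l * (33 * K) + r < 4 * (33 * K)" .
    then have "b l r = inner_n n (lift_row \<phi> u S l (stage_row K A s r)) x"
      unfolding b_def stage_rows_def using that by simp
    then show ?thesis using inner_lift_row[OF S] by simp
  qed
  then have "estimate K N A s (b l) c = cellv \<phi> u S x l c + sketch_err K N s (residual K N A (cellv \<phi> u S x l)) c"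
    if "l < 4" for l c using that by (intro estimate_error[OF K]) auto
  then have "score K N A s b = (\<lambda>c. Max ((\<lambda>l. \<bar>cellv \<phi> u S x l c +
        sketch_err K N s (residual K N A (cellv \<phi> u S x l)) c\<bar>) ` {..<4}))"
    unfolding score_def by (intro ext arg_cong[where f = Max] image_cong) auto
  then show ?thesis unfolding stage_step_def b_def by simp
qed

section \<open>Deterministic analysis of a stage\<close>

text \<open>\<open>J\<close> is what must survive, up to exchanges, and \<open>G\<close> is what
  sparse recovery treats as signal. The condition \<open>4 * K \<le> \<Delta> ^ 7 * K'\<close> keeps
  the number of colliding heavy coordinates below \<open>K'\<close>, and \<Gamma> lets a constant
  factor enter the smallness of \<eta>. The bound 512 absorbs the numerical constants into powers of
  \<Delta>.\<close>

locale stage =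
  fixes n N K K' k \<Delta> :: nat and S J G :: "nat set" and x :: "nat \<Rightarrow> real" and V \<eta> \<Gamma> :: real
  assumes \<Delta>: "512 \<le> \<Delta>" and K: "1 \<le> K" and N: "N = \<Delta> ^ 8 * K"
    and k: "1 \<le> k" "4 * k \<le> K'" and K': "K' \<le> K" "4 * K \<le> \<Delta> ^ 7 * K'"
    and S: "S \<subseteq> {..<n}" and J: "J \<subseteq> S" "card J \<le> k" and G: "G \<subseteq> S" "card G \<le> 2 * K"
    and V: "(\<Sum>i\<in>S - J. (x i)\<^sup>2) \<le> V" and \<eta>: "(\<Sum>i\<in>S - G. (x i)\<^sup>2) \<le> \<eta>"
    and \<Gamma>: "1 \<le> \<Gamma>" "\<eta> \<le> V * \<Gamma> / \<Delta> ^ 40"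
begin

lemma fin: "finite S" "finite J" "finite G" "finite (S - G)"
  using S J(1) G(1) by (auto intro: finite_subset)

lemma pos: "real \<Delta> > 0" "real K > 0" "real K' > 0" "real N > 0" "real k > 0"
  using \<Delta> K k by (auto simp: N)

lemma V0: "0 \<le> V"
  by (rule order_trans[OF _ V]) (simp add: sum_nonneg)

lemma \<eta>0: "0 \<le> \<eta>"
  by (rule order_trans[OF _ \<eta>]) (simp add: sum_nonneg)

text \<open>Here the sign weighting no longer shows the size of the coordinate. Such coordinates are
  rare and are handled through the energy of the whole cell.\<close>

definition "crowded \<phi> = {j \<in> J. \<exists>g\<in>G. g \<noteq> j \<and> \<phi> j = \<phi> g}"

text \<open>The bounds on sums in the four \<open>good\<close> events are instances of Markov's inequality, each failing
  with probability at most \<open>1 / \<Delta>\<close>.\<close>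

definition good_hash :: "(nat \<Rightarrow> nat) \<Rightarrow> bool" where
  "good_hash \<phi> \<longleftrightarrow> (\<forall>i\<in>S. \<phi> i < N) \<and>
     (\<Sum>(i, j)\<in>offdiag G G. 1 * same_cell \<phi> i j) \<le> (2 * K) * (2 * K) / N * \<Delta> \<and>
     (\<Sum>(i, j)\<in>offdiag (S - G) G. (x i)\<^sup>2 * same_cell \<phi> i j) \<le> \<eta> * (2 * K) / N * \<Delta> \<and>
     (\<Sum>(i, j)\<in>offdiag (S - G) (S - G). ((x i)\<^sup>2 * (x j)\<^sup>2) * same_cell \<phi> i j) \<le> \<eta> * \<eta> / N * \<Delta> \<and>
     (\<Sum>(i, j)\<in>offdiag (G - J) G. (x i)\<^sup>2 * same_cell \<phi> i j) \<le> V * (2 * K) / N * \<Delta> \<and>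
     (\<Sum>(i, j)\<in>offdiag J (S - G). (x j)\<^sup>2 * same_cell \<phi> i j) \<le> k * \<eta> / N * \<Delta> \<and>
     (\<Sum>(i, j)\<in>offdiag S S. 1 * same_cell \<phi> i j) \<le> real n * n / N * \<Delta> \<and>
     (\<Sum>(i, j)\<in>offdiag J G. 1 * same_cell \<phi> i j) \<le> k * (2 * K) / N * \<Delta>"

text \<open>The part of the cell vector that sparse recovery regards as error. The remaining cells
  meet \<open>G\<close>, so they form a vector of sparsity \<open>2 * K\<close>.\<close>

definition noise :: "(nat \<Rightarrow> nat) \<Rightarrow> (nat \<Rightarrow> nat \<Rightarrow> real) \<Rightarrow> nat \<Rightarrow> nat \<Rightarrow> real" where
  "noise \<phi> u l c = (if c \<in> {..<N} - \<phi> ` G then cellv \<phi> u S x l c else 0)"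

definition energy :: "(nat \<Rightarrow> nat) \<Rightarrow> (nat \<Rightarrow> nat \<Rightarrow> real) \<Rightarrow> nat \<Rightarrow> real" where
  "energy \<phi> u j = (\<Sum>l<4. (\<Sum>i\<in>cell \<phi> S (\<phi> j). u l i * x i)\<^sup>2)"

text \<open>Bounds \<open>4 * (V + V2) / K'\<close>: the score errors satisfy
  \<open>V2 \<le> 17 * (V * \<Gamma>)\<close>, and \<open>4 * (1 + 17) = 72\<close>.\<close>

definition "\<theta> = 72 * V * \<Gamma> / K'"

definition "R2 = \<eta> * \<Delta> ^ 23"

definition "crowded' \<phi> = {j \<in> crowded \<phi>. x j \<noteq> 0}"

definition good_weights :: "nat \<Rightarrow> (nat \<Rightarrow> nat) \<Rightarrow> (nat \<Rightarrow> nat \<Rightarrow> real) \<Rightarrow> bool" where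
  "good_weights m \<phi> u \<longleftrightarrow> (\<forall>i\<in>S. (\<forall>l<4. \<bar>u l i\<bar> \<le> 1) \<and> \<bar>u 0 i\<bar> = 1) \<and>
     (\<Sum>l<4. \<Sum>c\<in>{..<N} - \<phi> ` G. (\<Sum>i\<in>cell \<phi> S c. u l i * x i)\<^sup>2) \<le> 4 * \<eta> * \<Delta> \<and>
     (\<Sum>l<4. \<Sum>c\<in>{..<N} - \<phi> ` J. (\<Sum>i\<in>cell \<phi> S c - {rep \<phi> S G x c}. u l i * x i)\<^sup>2)
       \<le> 4 * (\<eta> + (\<Sum>(i, j)\<in>offdiag (G - J) G. (x i)\<^sup>2 * same_cell \<phi> i j)) * \<Delta> \<and>
     (\<Sum>l<4. \<Sum>j\<in>(if l = 0 then J - crowded \<phi> else {}). (\<Sum>i\<in>cell \<phi> S (\<phi> j) - {j}. u l i * x i)\<^sup>2)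
       \<le> (\<Sum>(i, j)\<in>offdiag J (S - G). (x j)\<^sup>2 * same_cell \<phi> i j) * \<Delta> \<and>
     (\<forall>j\<in>crowded' \<phi>. (1 / 4) ^ m * (x j)\<^sup>2 < energy \<phi> u j) \<and>
     (\<Sum>j\<in>crowded' \<phi>. if (1 / 4) ^ m * (x j)\<^sup>2 < energy \<phi> u j
        then (x j)\<^sup>2 * (16 * \<theta> + 16 * R2 / K) / energy \<phi> u j else 0)
       \<le> 65 * (16 * \<theta> + 16 * R2 / K) * card (crowded' \<phi>) * \<Delta>"

definition good_matrix :: "(nat \<Rightarrow> nat) \<Rightarrow> (nat \<Rightarrow> nat \<Rightarrow> real) \<Rightarrow> (nat \<Rightarrow> nat \<Rightarrow> real) \<Rightarrow> bool" where
  "good_matrix \<phi> u A \<longleftrightarrow> lower_iso (32 * K) N (4 * K) (1 / \<Delta> ^ 20) A \<and>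
     (\<Sum>l<4. \<Sum>r<32 * K. (inner_n N (A r) (noise \<phi> u l))\<^sup>2)
       \<le> (32 * K) * (\<Sum>l<4. \<Sum>c<N. (noise \<phi> u l c)\<^sup>2) * \<Delta>"

definition res :: "(nat \<Rightarrow> nat) \<Rightarrow> (nat \<Rightarrow> nat \<Rightarrow> real) \<Rightarrow> (nat \<Rightarrow> nat \<Rightarrow> real) \<Rightarrow> nat \<Rightarrow> nat \<Rightarrow> real" where
  "res \<phi> u A l = residual K N A (cellv \<phi> u S x l)"

text \<open>The last clause carries its prerequisites on the earlier draws as premises, so that
  Markov's inequality over the signs alone proves it for every choice of the other parts of the
  seed.\<close>

definition good_signs :: "(nat \<Rightarrow> nat) \<Rightarrow> (nat \<Rightarrow> nat \<Rightarrow> real) \<Rightarrow> (nat \<Rightarrow> nat \<Rightarrow> real) \<Rightarrow> (nat \<times> nat \<Rightarrow> real) \<Rightarrow> bool" where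
  "good_signs \<phi> u A s \<longleftrightarrow>
     (\<Sum>c<N. err2 K N s (res \<phi> u A) c) \<le> (N * ((\<Sum>l<4. \<Sum>c<N. (res \<phi> u A l c)\<^sup>2) / K)) * \<Delta> \<and>
     (\<Sum>j\<in>J. err2 K N s (res \<phi> u A) (\<phi> j)) \<le> (card J * ((\<Sum>l<4. \<Sum>c<N. (res \<phi> u A l c)\<^sup>2) / K)) * \<Delta> \<and>
     ((\<Sum>l<4. \<Sum>c<N. (res \<phi> u A l c)\<^sup>2) \<le> R2 \<longrightarrow> (\<forall>j\<in>crowded' \<phi>. 0 < energy \<phi> u j) \<longrightarrow>
       (\<Sum>j\<in>crowded' \<phi>. if energy \<phi> u j \<le> 8 * \<theta> + 8 * err2 K N s (res \<phi> u A) (\<phi> j) then (x j)\<^sup>2 else 0)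
       \<le> (\<Sum>j\<in>crowded' \<phi>. (x j)\<^sup>2 * (16 * \<theta> + 16 * R2 / K) / energy \<phi> u j) * \<Delta>)"

text \<open>The noise has energy at most \<open>4 * \<eta> * \<Delta>\<close>; its image costs a
  further factor \<Delta>, and dividing by the isometry constant costs \<open>\<Delta> ^ 20\<close>.
  The total stays below \<open>40 * \<eta> * \<Delta> ^ 22\<close>.\<close>

lemma residual_bound:
  assumes h: "good_hash \<phi>" and w: "good_weights m \<phi> u" and a: "good_matrix \<phi> u A"
  shows "(\<Sum>l<4. \<Sum>c<N. (res \<phi> u A l c)\<^sup>2) \<le> R2"
proof -
  have noise2: "(\<Sum>l<4. \<Sum>c<N. (noise \<phi> u l c)\<^sup>2) \<le> 4 * \<eta> * \<Delta>"
  proof -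
    have "(\<Sum>c<N. (noise \<phi> u l c)\<^sup>2) = (\<Sum>c\<in>{..<N} - \<phi> ` G. (\<Sum>i\<in>cell \<phi> S c. u l i * x i)\<^sup>2)" for l
      by (intro sum.mono_neutral_cong_right) (auto simp: noise_def cellv_def)
    then show ?thesis using w by (simp add: good_weights_def)
  qed
  have one: "(\<Sum>c<N. (res \<phi> u A l c)\<^sup>2) \<le> 2 * (\<Sum>c<N. (noise \<phi> u l c)\<^sup>2)
      + 8 / (real (32 * K) * (1 / \<Delta> ^ 20)) * (\<Sum>r<32 * K. (inner_n N (A r) (noise \<phi> u l))\<^sup>2)" for l
    unfolding res_def residual_def
  proof (rule decode_error)
    show "lower_iso (32 * K) N (2 * (2 * K)) (1 / \<Delta> ^ 20) A" using a by (simp add: good_matrix_def)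
    show "sparse N (2 * K) (\<lambda>c. if c \<in> {..<N} \<inter> \<phi> ` G then cellv \<phi> u S x l c else 0)"
    proof -
      have "card {c. (if c \<in> {..<N} \<inter> \<phi> ` G then cellv \<phi> u S x l c else 0) \<noteq> 0} \<le> card (\<phi> ` G)"
        using fin(3) by (intro card_mono) auto
      also have "\<dots> \<le> 2 * K" using card_image_le[OF fin(3), of \<phi>] G(2) by linarith
      finally show ?thesis by (auto simp: sparse_def)
    qed
  qed (use pos K in \<open>auto simp: noise_def\<close>)
  have "(\<Sum>l<4. \<Sum>c<N. (res \<phi> u A l c)\<^sup>2) \<le> 2 * (\<Sum>l<4. \<Sum>c<N. (noise \<phi> u l c)\<^sup>2)
      + 8 / (real (32 * K) * (1 / \<Delta> ^ 20)) * (\<Sum>l<4. \<Sum>r<32 * K. (inner_n N (A r) (noise \<phi> u l))\<^sup>2)"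
    unfolding sum_distrib_left[of _ _ "{..<4}"] sum.distrib[symmetric] by (rule sum_mono[OF one])
  also have "\<dots> \<le> 2 * (4 * \<eta> * \<Delta>) + 8 / (real (32 * K) * (1 / \<Delta> ^ 20)) * ((32 * K) * (4 * \<eta> * \<Delta>) * \<Delta>)"
  proof (intro add_mono mult_left_mono noise2)
    have "(\<Sum>l<4. \<Sum>r<32 * K. (inner_n N (A r) (noise \<phi> u l))\<^sup>2) \<le> (32 * K) * (\<Sum>l<4. \<Sum>c<N. (noise \<phi> u l c)\<^sup>2) * \<Delta>"
      using a by (simp add: good_matrix_def)
    also have "\<dots> \<le> (32 * K) * (4 * \<eta> * \<Delta>) * \<Delta>"
      by (intro mult_right_mono mult_left_mono noise2) auto
    finally show "(\<Sum>l<4. \<Sum>r<32 * K. (inner_n N (A r) (noise \<phi> u l))\<^sup>2) \<le> (32 * K) * (4 * \<eta> * \<Delta>) * \<Delta>" .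
  qed auto
  also have "\<dots> = \<eta> * (8 * \<Delta> + 32 * \<Delta> ^ 22)"
    using pos by (simp add: field_simps power_add[symmetric] eval_nat_numeral)
  also have "\<dots> \<le> \<eta> * \<Delta> ^ 23"
  proof (intro mult_left_mono \<eta>0)
    have "real \<Delta> ^ 1 \<le> real \<Delta> ^ 22" using \<Delta> by (intro power_increasing) auto
    then have "8 * real \<Delta> + 32 * real \<Delta> ^ 22 \<le> 40 * real \<Delta> ^ 22" by simp
    also have "\<dots> \<le> real \<Delta> * real \<Delta> ^ 22" using \<Delta> by (intro mult_right_mono) auto
    also have "\<dots> = real \<Delta> ^ 23" by (simp add: power_Suc[symmetric])
    finally show "real (8 * \<Delta> + 32 * \<Delta> ^ 22) \<le> real (\<Delta> ^ 23)" by simp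
  qed
  finally show ?thesis by (simp add: R2_def)
qed

end

context stage begin

lemma \<Delta>1: "1 \<le> real \<Delta>" using \<Delta> by simp

text \<open>The exchange rate of the analysis: any power of \<Delta> up to 40 that multiplies \<eta>
  is paid from the assumed smallness of \<eta>.\<close>

lemma eta_power: "j \<le> 40 \<Longrightarrow> \<eta> * real \<Delta> ^ j \<le> V * \<Gamma> / real \<Delta> ^ (40 - j)"
proof -
  assume j: "j \<le> 40"
  have "\<eta> * real \<Delta> ^ j * real \<Delta> ^ (40 - j) = \<eta> * real \<Delta> ^ 40" using j by (simp add: mult.assoc power_add[symmetric])
  also have "\<dots> \<le> V * \<Gamma>" using \<Gamma>(2) pos by (simp add: pos_le_divide_eq)
  finally show ?thesis using pos by (simp add: pos_le_divide_eq)
qed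

lemma W: "V \<le> V * \<Gamma>" "0 \<le> V * \<Gamma>"
  using V0 \<Gamma>(1) mult_left_mono[of 1 \<Gamma> V] by auto

lemma N_real: "real N = real \<Delta> ^ 8 * real K" by (simp add: N)

lemma over_N: "a * real K / real N * real \<Delta> = a / real \<Delta> ^ 7"
  unfolding N_real using pos by (simp add: field_simps power_add[symmetric] eval_nat_numeral)

text \<open>Sixteen parts come from heavy coordinates outside \<open>J\<close> that collide, and one
  part covers all terms with \<eta>.\<close>

definition "V2 = 17 * (V * \<Gamma>) / real \<Delta> ^ 6"

lemma V20: "0 \<le> V2" unfolding V2_def using W pos by simp

lemma theta_bound: "4 * (V + V2) / K' \<le> \<theta>"
proof -
  have "1 \<le> real \<Delta> ^ 6" using \<Delta>1 by (rule one_le_power)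
  then have "V2 \<le> 17 * (V * \<Gamma>) / 1" unfolding V2_def using W pos by (intro divide_left_mono) auto
  then have "4 * (V + V2) \<le> 72 * V * \<Gamma>" using W by simp
  then show ?thesis unfolding \<theta>_def using pos by (intro divide_right_mono) auto
qed

lemma theta0: "0 \<le> \<theta>" unfolding \<theta>_def using W pos by (simp add: mult.assoc)

lemma R20: "0 \<le> R2" unfolding R2_def using \<eta>0 by simp

lemma sketch_err_le: "l < 4 \<Longrightarrow> \<bar>sketch_err K N s (r l) c\<bar> \<le> sqrt (err2 K N s r c)"
proof -
  assume l: "l < 4"
  have "(sketch_err K N s (r l) c)\<^sup>2 \<le> err2 K N s r c" unfolding err2_def
    by (rule member_le_sum[of l "{..<4}" "\<lambda>l. (sketch_err K N s (r l) c)\<^sup>2"]) (use l in auto)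
  then show ?thesis by (rule real_le_rsqrt[of "\<bar>_\<bar>", unfolded power2_abs])
qed

definition nonrep :: "(nat \<Rightarrow> nat) \<Rightarrow> (nat \<Rightarrow> nat \<Rightarrow> real) \<Rightarrow> nat \<Rightarrow> real" where
  "nonrep \<phi> u c = (\<Sum>l<4. (\<Sum>i\<in>cell \<phi> S c - {rep \<phi> S G x c}. u l i * x i)\<^sup>2)"

lemma nonrep_le: "l < 4 \<Longrightarrow> \<bar>\<Sum>i\<in>cell \<phi> S c - {rep \<phi> S G x c}. u l i * x i\<bar> \<le> sqrt (nonrep \<phi> u c)"
proof -
  assume l: "l < 4"
  have "(\<Sum>i\<in>cell \<phi> S c - {rep \<phi> S G x c}. u l i * x i)\<^sup>2 \<le> nonrep \<phi> u c" unfolding nonrep_def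
    by (rule member_le_sum[of l "{..<4}" "\<lambda>l. (\<Sum>i\<in>cell \<phi> S c - {rep \<phi> S G x c}. u l i * x i)\<^sup>2"]) (use l in auto)
  then show ?thesis by (rule real_le_rsqrt[of "\<bar>_\<bar>", unfolded power2_abs])
qed

lemma nonrep0: "0 \<le> nonrep \<phi> u c" unfolding nonrep_def by (intro sum_nonneg) auto

definition sc :: "(nat \<Rightarrow> nat) \<Rightarrow> (nat \<Rightarrow> nat \<Rightarrow> real) \<Rightarrow> (nat \<Rightarrow> nat \<Rightarrow> real) \<Rightarrow> (nat \<times> nat \<Rightarrow> real) \<Rightarrow> nat \<Rightarrow> real" where
  "sc \<phi> u A s c = Max ((\<lambda>l. \<bar>cellv \<phi> u S x l c + sketch_err K N s (res \<phi> u A l) c\<bar>) ` {..<4})"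

lemma sc_ge: "l < 4 \<Longrightarrow> \<bar>cellv \<phi> u S x l c + sketch_err K N s (res \<phi> u A l) c\<bar> \<le> sc \<phi> u A s c"
  unfolding sc_def by (intro Max_ge) auto

lemma sc_le: "(\<And>l. l < 4 \<Longrightarrow> \<bar>cellv \<phi> u S x l c + sketch_err K N s (res \<phi> u A l) c\<bar> \<le> B) \<Longrightarrow> sc \<phi> u A s c \<le> B"
  unfolding sc_def by (subst Max_le_iff) (auto simp: lessThan_empty_iff)

lemma sc_nonneg: "0 \<le> sc \<phi> u A s c"
  using sc_ge[of 0 \<phi> u c s A] by linarith

text \<open>A cell that avoids \<open>J\<close> is overrated by its members other than the
  representative and by the sketch error. Summing the latter over all \<open>N\<close> cells costs
  \<open>N / K = \<Delta> ^ 8\<close>, so the power of \<Delta> in front of \<eta> grows from 23 to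
  32.\<close>

lemma omega_bound:
  assumes h: "good_hash \<phi>" and w: "good_weights m \<phi> u" and a: "good_matrix \<phi> u A" and s: "good_signs \<phi> u A s"
  shows "(\<Sum>c\<in>{..<N} - \<phi> ` J. (sqrt (nonrep \<phi> u c) + sqrt (err2 K N s (res \<phi> u A) c))\<^sup>2) \<le> V2"
proof -
  let ?C = "{..<N} - \<phi> ` J"
  have "(\<Sum>c\<in>?C. (sqrt (nonrep \<phi> u c) + sqrt (err2 K N s (res \<phi> u A) c))\<^sup>2)
    \<le> 2 * (\<Sum>c\<in>?C. (sqrt (nonrep \<phi> u c))\<^sup>2) + 2 * (\<Sum>c\<in>?C. (sqrt (err2 K N s (res \<phi> u A) c))\<^sup>2)"
    by (rule sum_square_le2)
  also have "\<dots> = 2 * (\<Sum>c\<in>?C. nonrep \<phi> u c) + 2 * (\<Sum>c\<in>?C. err2 K N s (res \<phi> u A) c)"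
    by (simp add: nonrep0 err2_nonneg)
  also have "\<dots> \<le> 2 * (4 * \<eta> * \<Delta> + 8 * V / real \<Delta> ^ 6) + 2 * (\<eta> * real \<Delta> ^ 32)"
  proof (intro add_mono mult_left_mono)
    have "(\<Sum>c\<in>?C. nonrep \<phi> u c) = (\<Sum>l<4. \<Sum>c\<in>?C. (\<Sum>i\<in>cell \<phi> S c - {rep \<phi> S G x c}. u l i * x i)\<^sup>2)"
      unfolding nonrep_def by (rule sum.swap)
    also have "\<dots> \<le> 4 * (\<eta> + (\<Sum>(i, j)\<in>offdiag (G - J) G. (x i)\<^sup>2 * same_cell \<phi> i j)) * \<Delta>"
      using w unfolding good_weights_def by blast
    also have "\<dots> \<le> 4 * (\<eta> + 2 * V / real \<Delta> ^ 7) * \<Delta>"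
    proof (intro mult_right_mono mult_left_mono add_left_mono)
      have "(\<Sum>(i, j)\<in>offdiag (G - J) G. (x i)\<^sup>2 * same_cell \<phi> i j) \<le> V * (2 * K) / N * \<Delta>"
        using h unfolding good_hash_def by blast
      also have "\<dots> = 2 * V / real \<Delta> ^ 7" using over_N[of "2 * V"] by (simp add: mult_ac)
      finally show "(\<Sum>(i, j)\<in>offdiag (G - J) G. (x i)\<^sup>2 * same_cell \<phi> i j) \<le> 2 * V / real \<Delta> ^ 7" .
    qed auto
    also have "\<dots> = 4 * \<eta> * \<Delta> + 8 * V / real \<Delta> ^ 6"
      using pos by (simp add: field_simps power_add[symmetric] eval_nat_numeral)
    finally show "(\<Sum>c\<in>?C. nonrep \<phi> u c) \<le> 4 * \<eta> * \<Delta> + 8 * V / real \<Delta> ^ 6" .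
    have "(\<Sum>c\<in>?C. err2 K N s (res \<phi> u A) c) \<le> (\<Sum>c<N. err2 K N s (res \<phi> u A) c)"
      by (intro sum_mono2) (auto simp: err2_nonneg)
    also have "\<dots> \<le> (N * ((\<Sum>l<4. \<Sum>c<N. (res \<phi> u A l c)\<^sup>2) / K)) * \<Delta>"
      using s unfolding good_signs_def by blast
    also have "\<dots> \<le> (N * (R2 / K)) * \<Delta>"
      using residual_bound[OF h w a] by (intro mult_right_mono mult_left_mono divide_right_mono) auto
    also have "\<dots> = \<eta> * real \<Delta> ^ 32"
    proof -
      have "real \<Delta> ^ 8 * real \<Delta> ^ 23 * real \<Delta> ^ 1 = real \<Delta> ^ 32" unfolding power_add[symmetric] by simp
      then show ?thesis unfolding N_real R2_def using pos by (simp add: mult_ac)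
    qed
    finally show "(\<Sum>c\<in>?C. err2 K N s (res \<phi> u A) c) \<le> \<eta> * real \<Delta> ^ 32" .
  qed auto
  also have "\<dots> \<le> V2"
  proof -
    have "8 * \<eta> * \<Delta> + 2 * (\<eta> * real \<Delta> ^ 32) \<le> \<eta> * real \<Delta> ^ 34"
    proof -
      have "real \<Delta> ^ 1 \<le> real \<Delta> ^ 32" using \<Delta>1 by (intro power_increasing) auto
      then have "8 * real \<Delta> + 2 * real \<Delta> ^ 32 \<le> 10 * real \<Delta> ^ 32" by simp
      also have "\<dots> \<le> real \<Delta> ^ 2 * real \<Delta> ^ 32"
      proof (intro mult_right_mono)
        have "10 \<le> real \<Delta> * 1" using \<Delta> by simp
        also have "\<dots> \<le> real \<Delta> ^ 2" unfolding power2_eq_square using \<Delta>1 by (intro mult_left_mono) auto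
        finally show "10 \<le> real \<Delta> ^ 2" .
      qed auto
      also have "\<dots> = real \<Delta> ^ 34" by (simp add: power_add[symmetric])
      finally have "\<eta> * (8 * real \<Delta> + 2 * real \<Delta> ^ 32) \<le> \<eta> * real \<Delta> ^ 34" using \<eta>0 by (intro mult_left_mono)
      then show ?thesis by (simp add: algebra_simps)
    qed
    also have "\<dots> \<le> V * \<Gamma> / real \<Delta> ^ 6" using eta_power[of 34] by simp
    finally have 1: "8 * \<eta> * \<Delta> + 2 * (\<eta> * real \<Delta> ^ 32) \<le> V * \<Gamma> / real \<Delta> ^ 6" .
    have 2: "V / real \<Delta> ^ 6 \<le> V * \<Gamma> / real \<Delta> ^ 6" using W pos by (intro divide_right_mono) auto
    have "2 * (4 * \<eta> * \<Delta> + 8 * V / real \<Delta> ^ 6) + 2 * (\<eta> * real \<Delta> ^ 32)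
       = (8 * \<eta> * \<Delta> + 2 * (\<eta> * real \<Delta> ^ 32)) + 16 * (V / real \<Delta> ^ 6)" by simp
    also have "\<dots> \<le> V * \<Gamma> / real \<Delta> ^ 6 + 16 * (V * \<Gamma> / real \<Delta> ^ 6)" using 1 2 by (intro add_mono mult_left_mono) auto
    also have "\<dots> = V2" unfolding V2_def by simp
    finally show ?thesis .
  qed
  finally show ?thesis .
qed

definition "F = k * (V * \<Gamma>) / (K' * real \<Delta> ^ 14)"

text \<open>For wanted coordinates the sketch error is summed over at most \<open>k\<close> cells,
  so \<open>N / K\<close> is replaced by \<open>k / K\<close>. An uncrowded coordinate suffers
  otherwise only from light members of its cell.\<close>

lemma f_bound:
  assumes h: "good_hash \<phi>" and w: "good_weights m \<phi> u" and a: "good_matrix \<phi> u A" and s: "good_signs \<phi> u A s"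
  shows "(\<Sum>j\<in>J - crowded \<phi>. (sqrt (err2 K N s (res \<phi> u A) (\<phi> j)) + \<bar>\<Sum>i\<in>cell \<phi> S (\<phi> j) - {j}. u 0 i * x i\<bar>)\<^sup>2) \<le> F"
proof -
  let ?C = "J - crowded \<phi>"
  have "(\<Sum>j\<in>?C. (sqrt (err2 K N s (res \<phi> u A) (\<phi> j)) + \<bar>\<Sum>i\<in>cell \<phi> S (\<phi> j) - {j}. u 0 i * x i\<bar>)\<^sup>2)
    \<le> 2 * (\<Sum>j\<in>?C. (sqrt (err2 K N s (res \<phi> u A) (\<phi> j)))\<^sup>2) + 2 * (\<Sum>j\<in>?C. \<bar>\<Sum>i\<in>cell \<phi> S (\<phi> j) - {j}. u 0 i * x i\<bar>\<^sup>2)"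
    by (rule sum_square_le2)
  also have "\<dots> = 2 * (\<Sum>j\<in>?C. err2 K N s (res \<phi> u A) (\<phi> j)) + 2 * (\<Sum>j\<in>?C. (\<Sum>i\<in>cell \<phi> S (\<phi> j) - {j}. u 0 i * x i)\<^sup>2)"
    by (simp add: err2_nonneg)
  also have "\<dots> \<le> 2 * (k / K * (\<eta> * real \<Delta> ^ 24)) + 2 * (k / K * (\<eta> * real \<Delta> ^ 24))"
  proof (intro add_mono mult_left_mono)
    have "(\<Sum>j\<in>?C. err2 K N s (res \<phi> u A) (\<phi> j)) \<le> (\<Sum>j\<in>J. err2 K N s (res \<phi> u A) (\<phi> j))"
      using fin by (intro sum_mono2) (auto simp: err2_nonneg)
    also have "\<dots> \<le> (card J * ((\<Sum>l<4. \<Sum>c<N. (res \<phi> u A l c)\<^sup>2) / K)) * \<Delta>"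
      using s unfolding good_signs_def by blast
    also have "\<dots> \<le> (k * (R2 / K)) * \<Delta>"
      using residual_bound[OF h w a] J(2) R20 by (intro mult_right_mono mult_mono divide_right_mono) (auto intro!: divide_nonneg_nonneg sum_nonneg)
    also have "\<dots> = k / K * (\<eta> * real \<Delta> ^ 24)"
      unfolding R2_def by (simp add: power_Suc2[symmetric] del: power_Suc)
    finally show "(\<Sum>j\<in>?C. err2 K N s (res \<phi> u A) (\<phi> j)) \<le> k / K * (\<eta> * real \<Delta> ^ 24)" .
    have "(\<Sum>j\<in>?C. (\<Sum>i\<in>cell \<phi> S (\<phi> j) - {j}. u 0 i * x i)\<^sup>2)
       = (\<Sum>l<4. \<Sum>j\<in>(if l = 0 then J - crowded \<phi> else {}). (\<Sum>i\<in>cell \<phi> S (\<phi> j) - {j}. u l i * x i)\<^sup>2)"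
      by (simp add: eval_nat_numeral lessThan_Suc)
    also have "\<dots> \<le> (\<Sum>(i, j)\<in>offdiag J (S - G). (x j)\<^sup>2 * same_cell \<phi> i j) * \<Delta>"
      using w unfolding good_weights_def by blast
    also have "\<dots> \<le> (k * \<eta> / N * \<Delta>) * \<Delta>"
      using h unfolding good_hash_def by (intro mult_right_mono) auto
    also have "\<dots> = k / K * (\<eta> / real \<Delta> ^ 6)"
      unfolding N_real using pos by (simp add: field_simps power_add[symmetric] eval_nat_numeral)
    also have "\<dots> \<le> k / K * (\<eta> * real \<Delta> ^ 24)"
    proof (intro mult_left_mono)
      have "\<eta> / real \<Delta> ^ 6 \<le> \<eta> / 1" using \<Delta>1 \<eta>0 by (intro divide_left_mono one_le_power) auto
      also have "\<dots> \<le> \<eta> * real \<Delta> ^ 24" using \<Delta>1 \<eta>0 mult_left_mono[of 1 "real \<Delta> ^ 24" \<eta>] one_le_power[of "real \<Delta>" 24] by simp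
      finally show "\<eta> / real \<Delta> ^ 6 \<le> \<eta> * real \<Delta> ^ 24" .
    qed auto
    finally show "(\<Sum>j\<in>?C. (\<Sum>i\<in>cell \<phi> S (\<phi> j) - {j}. u 0 i * x i)\<^sup>2) \<le> k / K * (\<eta> * real \<Delta> ^ 24)" .
  qed auto
  also have "\<dots> = k / K * (4 * (\<eta> * real \<Delta> ^ 24))" by simp
  also have "\<dots> \<le> k / K' * (V * \<Gamma> / real \<Delta> ^ 14)"
  proof (intro mult_mono)
    show "real k / real K \<le> real k / real K'" using K' pos by (intro divide_left_mono) auto
    have "4 * (\<eta> * real \<Delta> ^ 24) \<le> real \<Delta> * (\<eta> * real \<Delta> ^ 24)" using \<Delta> \<eta>0 by (intro mult_right_mono) auto
    also have "\<dots> = \<eta> * real \<Delta> ^ 25" by (simp add: eval_nat_numeral)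
    also have "\<dots> \<le> \<eta> * real \<Delta> ^ 26" using \<Delta>1 \<eta>0 by (intro mult_left_mono power_increasing) auto
    also have "\<dots> \<le> V * \<Gamma> / real \<Delta> ^ 14" using eta_power[of 26] by simp
    finally show "4 * (\<eta> * real \<Delta> ^ 24) \<le> V * \<Gamma> / real \<Delta> ^ 14" .
  qed (use \<eta>0 in auto)
  also have "\<dots> = F" unfolding F_def by simp
  finally show ?thesis .
qed

definition "Lc = k * (V * \<Gamma>) / (K' * real \<Delta> ^ 3)"

text \<open>A crowded cell with low score has low energy or a large sketch error. By Markov over the
  signs the energy lost is governed by squared values divided by cell energies; the inverse moment
  of the weights bounds each such quotient by a constant on average, and at most
  \<open>2 * k / \<Delta> ^ 7\<close> coordinates are crowded.\<close>

lemma crowded_bound: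
  assumes h: "good_hash \<phi>" and w: "good_weights m \<phi> u" and a: "good_matrix \<phi> u A" and s: "good_signs \<phi> u A s"
  shows "(\<Sum>j\<in>J \<inter> crowded \<phi>. if (sc \<phi> u A s (\<phi> j))\<^sup>2 \<le> \<theta> then (x j)\<^sup>2 else 0) \<le> Lc"
proof -
  let ?e = "\<lambda>j. err2 K N s (res \<phi> u A) (\<phi> j)"
  have fC: "finite (crowded \<phi>)" "finite (crowded' \<phi>)" using fin by (auto simp: crowded_def crowded'_def)
  have en: "energy \<phi> u j \<le> 8 * \<theta> + 8 * ?e j" if "(sc \<phi> u A s (\<phi> j))\<^sup>2 \<le> \<theta>" for j
  proof -
    let ?y = "\<lambda>l. cellv \<phi> u S x l (\<phi> j)" and ?r = "\<lambda>l. sketch_err K N s (res \<phi> u A l) (\<phi> j)"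
    have "energy \<phi> u j = (\<Sum>l<4. ((?y l + ?r l) + - ?r l)\<^sup>2)" by (simp add: energy_def cellv_def)
    also have "\<dots> \<le> 2 * (\<Sum>l<4. (?y l + ?r l)\<^sup>2) + 2 * (\<Sum>l<4. (- ?r l)\<^sup>2)" by (rule sum_square_le2)
    also have "\<dots> = 2 * (\<Sum>l<4. (?y l + ?r l)\<^sup>2) + 2 * ?e j" by (simp add: err2_def)
    also have "\<dots> \<le> 2 * (\<Sum>l<4::nat. \<theta>) + 2 * ?e j"
    proof (intro add_right_mono mult_left_mono sum_mono)
      fix l :: nat assume "l \<in> {..<4}"
      then have "\<bar>?y l + ?r l\<bar> \<le> sc \<phi> u A s (\<phi> j)" by (intro sc_ge) auto
      then have "\<bar>?y l + ?r l\<bar>\<^sup>2 \<le> (sc \<phi> u A s (\<phi> j))\<^sup>2" by (intro power_mono) auto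
      then show "(?y l + ?r l)\<^sup>2 \<le> \<theta>" using that by simp
    qed auto
    also have "\<dots> \<le> 8 * \<theta> + 8 * ?e j" using err2_nonneg[of K N s "res \<phi> u A" "\<phi> j"] by simp
    finally show ?thesis .
  qed
  have epos: "\<forall>j\<in>crowded' \<phi>. 0 < energy \<phi> u j"
  proof
    fix j assume j: "j \<in> crowded' \<phi>"
    then have "(1 / 4) ^ m * (x j)\<^sup>2 < energy \<phi> u j" using w unfolding good_weights_def by blast
    then show "0 < energy \<phi> u j" by (rule le_less_trans[rotated]) simp
  qed
  have cc: "real (card (crowded' \<phi>)) \<le> 2 * k / real \<Delta> ^ 7"
  proof -
    have "real (card (crowded' \<phi>)) \<le> real (card (crowded \<phi>))" using fC by (simp add: card_mono crowded'_def)
    also have "\<dots> \<le> (\<Sum>(i, j)\<in>offdiag J G. same_cell \<phi> i j)" unfolding crowded_def by (rule collided_card) (auto simp: fin)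
    also have "\<dots> \<le> k * (2 * K) / N * \<Delta>" using h unfolding good_hash_def by simp
    also have "\<dots> = 2 * k / real \<Delta> ^ 7" using over_N[of "2 * k"] by (simp add: mult_ac)
    finally show ?thesis .
  qed
  define b where "b = 16 * \<theta> + 16 * R2 / K"
  have b0: "0 \<le> b" unfolding b_def using theta0 R20 by simp
  have "(\<Sum>j\<in>J \<inter> crowded \<phi>. if (sc \<phi> u A s (\<phi> j))\<^sup>2 \<le> \<theta> then (x j)\<^sup>2 else 0)
     = (\<Sum>j\<in>crowded' \<phi>. if (sc \<phi> u A s (\<phi> j))\<^sup>2 \<le> \<theta> then (x j)\<^sup>2 else 0)"
    using fin by (intro sum.mono_neutral_right) (auto simp: crowded'_def crowded_def)
  also have "\<dots> \<le> (\<Sum>j\<in>crowded' \<phi>. if energy \<phi> u j \<le> 8 * \<theta> + 8 * ?e j then (x j)\<^sup>2 else 0)"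
    using en by (intro sum_mono) auto
  also have "\<dots> \<le> (\<Sum>j\<in>crowded' \<phi>. (x j)\<^sup>2 * b / energy \<phi> u j) * \<Delta>"
    using s residual_bound[OF h w a] epos unfolding good_signs_def b_def by blast
  also have "(\<Sum>j\<in>crowded' \<phi>. (x j)\<^sup>2 * b / energy \<phi> u j)
     = (\<Sum>j\<in>crowded' \<phi>. if (1 / 4) ^ m * (x j)\<^sup>2 < energy \<phi> u j then (x j)\<^sup>2 * b / energy \<phi> u j else 0)"
  proof (rule sum.cong[OF refl])
    fix j assume "j \<in> crowded' \<phi>"
    then have "(1 / 4) ^ m * (x j)\<^sup>2 < energy \<phi> u j" using w unfolding good_weights_def by blast
    then show "(x j)\<^sup>2 * b / energy \<phi> u j = (if (1 / 4) ^ m * (x j)\<^sup>2 < energy \<phi> u j then (x j)\<^sup>2 * b / energy \<phi> u j else 0)" by simp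
  qed
  also have "\<dots> * \<Delta> \<le> (65 * b * card (crowded' \<phi>) * \<Delta>) * \<Delta>"
    using w unfolding good_weights_def b_def by (intro mult_right_mono) auto
  also have "\<dots> \<le> (65 * b * (2 * k / real \<Delta> ^ 7) * \<Delta>) * \<Delta>"
    using cc b0 by (intro mult_right_mono mult_left_mono) auto
  also have "\<dots> = 130 * k * b / real \<Delta> ^ 5"
    using pos by (simp add: field_simps power_add[symmetric] eval_nat_numeral)
  also have "\<dots> \<le> 130 * k * (1168 * (V * \<Gamma> / K')) / real \<Delta> ^ 5"
  proof (intro divide_right_mono mult_left_mono)
    have "R2 / K \<le> (V * \<Gamma> / real \<Delta> ^ 17) / K'"
      unfolding R2_def using eta_power[of 23] W K' pos by (intro frac_le) auto
    also have "\<dots> \<le> (V * \<Gamma> / 1) / K'"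
      using W \<Delta>1 by (intro divide_right_mono divide_left_mono one_le_power) auto
    finally have "R2 / K \<le> V * \<Gamma> / K'" by simp
    then show "b \<le> 1168 * (V * \<Gamma> / K')" unfolding b_def \<theta>_def by simp
  qed auto
  \<comment> \<open>\<open>16 * 72 + 16 = 1168\<close> and \<open>130 * 1168 = 151840\<close>, which
    is below the square of 512.\<close>
  also have "\<dots> = k * (V * \<Gamma>) / K' / real \<Delta> ^ 5 * 151840" by simp
  also have "\<dots> \<le> k * (V * \<Gamma>) / K' / real \<Delta> ^ 5 * real \<Delta> ^ 2"
  proof (intro mult_left_mono)
    have "512 ^ 2 \<le> real \<Delta> ^ 2" using \<Delta> by (intro power_mono) auto
    then show "151840 \<le> real \<Delta> ^ 2" by simp
  qed (use W pos in auto)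
  also have "\<dots> = Lc"
    unfolding Lc_def using pos by (simp add: field_simps power_add[symmetric] eval_nat_numeral)
  finally show ?thesis .
qed

text \<open>In units of \<open>g\<close>, the size of a typical threshold, every term is at most a
  multiple of \<open>k / \<Delta> ^ 3\<close> times the square of \<open>g\<close>. The multiples
  add up to \<open>18 + 162 + 1 + 1 = 182\<close>, which one factor \<Delta> absorbs.\<close>

lemma total_loss: "2 * sqrt \<theta> * (sqrt (k * F) + k * sqrt (4 * V2 / K')) + F + Lc \<le> k / K' * (V * \<Gamma> / real \<Delta> ^ 2)"
proof -
  define g where "g = sqrt (V * \<Gamma> / K')"
  define D where "D = real \<Delta>"
  have D: "1 \<le> D" "512 \<le> D" using \<Delta> by (auto simp: D_def)
  have g0: "0 \<le> g" and g2: "g\<^sup>2 = V * \<Gamma> / K'" using W pos by (auto simp: g_def)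
  have t: "sqrt \<theta> \<le> 9 * g"
  proof (rule real_le_lsqrt)
    show "\<theta> \<le> (9 * g)\<^sup>2" unfolding power_mult_distrib g2 \<theta>_def using W pos by (simp add: divide_right_mono)
  qed (use g0 in auto)
  have f: "sqrt (k * F) \<le> k * g / D ^ 7"
  proof (rule real_le_lsqrt)
    have "(k * g / D ^ 7)\<^sup>2 = k\<^sup>2 * g\<^sup>2 / D ^ 14" by (simp add: power_divide power_mult_distrib power_mult[symmetric])
    then show "k * F \<le> (k * g / D ^ 7)\<^sup>2" unfolding g2 F_def D_def by (simp add: power2_eq_square)
  qed (use g0 D in auto)
  have v: "sqrt (4 * V2 / K') \<le> 9 * g / D ^ 3"
  proof (rule real_le_lsqrt)
    have e: "(9 * g / D ^ 3)\<^sup>2 = 81 * (V * \<Gamma> / K') / D ^ 6"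
      unfolding power_divide power_mult_distrib g2 by (simp add: power_mult[symmetric])
    have "4 * V2 / K' = 68 * (V * \<Gamma> / K') / D ^ 6" unfolding V2_def D_def by simp
    also have "\<dots> \<le> 81 * (V * \<Gamma> / K') / D ^ 6" using W D by (intro divide_right_mono mult_right_mono) auto
    finally show "4 * V2 / K' \<le> (9 * g / D ^ 3)\<^sup>2" unfolding e .
  qed (use g0 D in auto)
  have D37: "1 / D ^ 7 \<le> 1 / D ^ 3" "1 / D ^ 14 \<le> 1 / D ^ 3"
    using D by (auto intro!: divide_left_mono power_increasing)
  have F: "F = k * g\<^sup>2 * (1 / D ^ 14)" and Lc: "Lc = k * g\<^sup>2 * (1 / D ^ 3)"
    unfolding F_def Lc_def g2 D_def by simp_all
  have kg: "0 \<le> k * g\<^sup>2" by simp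
  define X where "X = (k * g\<^sup>2) * (1 / D ^ 3)"
  have "2 * sqrt \<theta> * (sqrt (k * F) + k * sqrt (4 * V2 / K')) \<le> 2 * (9 * g) * (k * g / D ^ 7 + k * (9 * g / D ^ 3))"
    using t f v g0 V20 by (intro mult_mono add_mono mult_left_mono) (auto intro!: add_nonneg_nonneg mult_nonneg_nonneg simp: F_def W theta0)
  also have "\<dots> = 18 * (k * g\<^sup>2) * (1 / D ^ 7) + 162 * (k * g\<^sup>2) * (1 / D ^ 3)"
    by (simp add: power2_eq_square algebra_simps)
  also have "\<dots> \<le> 18 * (k * g\<^sup>2) * (1 / D ^ 3) + 162 * (k * g\<^sup>2) * (1 / D ^ 3)"
    using D37 kg by (intro add_mono mult_left_mono) auto
  finally have "2 * sqrt \<theta> * (sqrt (k * F) + k * sqrt (4 * V2 / K')) \<le> 180 * X" by (simp add: X_def)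
  moreover have "F \<le> X" unfolding F X_def using D37 kg by (intro mult_left_mono) auto
  ultimately have "2 * sqrt \<theta> * (sqrt (k * F) + k * sqrt (4 * V2 / K')) + F + Lc \<le> 182 * X"
    using Lc unfolding X_def[symmetric] by linarith
  also have "\<dots> \<le> D * X" using D kg unfolding X_def by (intro mult_right_mono) auto
  also have "\<dots> = (k * g\<^sup>2) * (1 / D ^ 2)" unfolding X_def using D by (simp add: power3_eq_cube power2_eq_square)
  also have "\<dots> = k / K' * (V * \<Gamma> / real \<Delta> ^ 2)" unfolding g2 D_def by simp
  finally show ?thesis .
qed

lemma good_conclusion:
  assumes h: "good_hash \<phi>" and w: "good_weights m \<phi> u" and a: "good_matrix \<phi> u A" and s: "good_signs \<phi> u A s"
  defines "S' \<equiv> stage_step K K' N (\<phi>, u, A, s) S (map (\<lambda>a. inner_n n a x) (stage_rows K (\<phi>, u, A, s) S))"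
  shows "\<exists>J'\<subseteq>S'. card J' \<le> k \<and> (\<Sum>i\<in>{..<n} - J'. (x i)\<^sup>2) \<le> (\<Sum>i\<in>{..<n} - J. (x i)\<^sup>2) + k / K' * (V * \<Gamma> / real \<Delta> ^ 2)"
    and "\<exists>G'\<subseteq>S'. card G' \<le> 2 * K' \<and> (\<Sum>i\<in>S' - G'. (x i)\<^sup>2) \<le> \<eta> / real \<Delta> ^ 2"
    and "real (card S') \<le> K' + (real n)\<^sup>2 / (K * real \<Delta> ^ 7)"
    and "S' \<subseteq> S"
proof -
  define Y where "Y = top_k_set N K' (sc \<phi> u A s)"
  have \<phi>: "\<And>i. i \<in> S \<Longrightarrow> \<phi> i < N" using h unfolding good_hash_def by blast
  have S': "S' = {i \<in> S. \<phi> i \<in> Y}"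
    unfolding S'_def Y_def sc_def res_def by (subst stage_step_eq[OF K S \<phi>]) auto
  have "K' \<le> \<Delta> ^ 8 * K" using K'(1) \<Delta> mult_le_mono[of 1 "\<Delta> ^ 8" K' K] by simp
  then have Y: "Y \<subseteq> {..<N}" "card Y = K'" "\<And>c c'. c \<in> Y \<Longrightarrow> c' < N \<Longrightarrow> c' \<notin> Y \<Longrightarrow> sc \<phi> u A s c' \<le> sc \<phi> u A s c"
    using top_k_set[where n = N and k = K' and x = "sc \<phi> u A s"] sc_nonneg[of \<phi> u A s] unfolding Y_def N by (auto simp: abs_of_nonneg)
  have fY: "finite Y" using Y(1) finite_subset by blast
  show "S' \<subseteq> S" unfolding S' by blast
  let ?\<omega> = "\<lambda>c. sqrt (nonrep \<phi> u c) + sqrt (err2 K N s (res \<phi> u A) c)"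
  let ?f = "\<lambda>j. sqrt (err2 K N s (res \<phi> u A) (\<phi> j)) + \<bar>\<Sum>i\<in>cell \<phi> S (\<phi> j) - {j}. u 0 i * x i\<bar>"
  have u1: "\<bar>u l i\<bar> \<le> 1" "\<bar>u 0 i\<bar> = 1" if "i \<in> S" "l < 4" for l i
    using w that unfolding good_weights_def by blast+
  have fcell: "finite (cell \<phi> S c)" for c using fin by (simp add: cell_def)
  have scb: "sc \<phi> u A s c \<le> (if c \<in> \<phi> ` S then \<bar>x (rep \<phi> S G x c)\<bar> else 0) + ?\<omega> c" for c
  proof (rule sc_le)
    fix l :: nat assume l: "l < 4"
    let ?m = "\<Sum>i\<in>cell \<phi> S c - {rep \<phi> S G x c}. u l i * x i"
    have "\<bar>cellv \<phi> u S x l c\<bar> \<le> (if c \<in> \<phi> ` S then \<bar>x (rep \<phi> S G x c)\<bar> else 0) + sqrt (nonrep \<phi> u c)"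
    proof (cases "c \<in> \<phi> ` S")
      case True
      note r = rep_image[OF fin(1) True, of G x]
      have "cellv \<phi> u S x l c = u l (rep \<phi> S G x c) * x (rep \<phi> S G x c) + ?m"
        unfolding cellv_def using fcell r by (intro sum.remove) (auto simp: cell_def)
      then have "\<bar>cellv \<phi> u S x l c\<bar> \<le> \<bar>u l (rep \<phi> S G x c)\<bar> * \<bar>x (rep \<phi> S G x c)\<bar> + \<bar>?m\<bar>"
        by (simp add: abs_mult[symmetric] abs_triangle_ineq)
      also have "\<dots> \<le> 1 * \<bar>x (rep \<phi> S G x c)\<bar> + sqrt (nonrep \<phi> u c)"
        using u1(1)[OF r(1) l] nonrep_le[OF l] by (intro add_mono mult_right_mono) auto
      finally show ?thesis using True by simp
    next
      case False
      then have "cell \<phi> S c = {}" by (auto simp: cell_def)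
      then show ?thesis using False nonrep0 by (simp add: cellv_def)
    qed
    moreover have "\<bar>sketch_err K N s (res \<phi> u A l) c\<bar> \<le> sqrt (err2 K N s (res \<phi> u A) c)" by (rule sketch_err_le[OF l])
    ultimately show "\<bar>cellv \<phi> u S x l c + sketch_err K N s (res \<phi> u A l) c\<bar>
        \<le> (if c \<in> \<phi> ` S then \<bar>x (rep \<phi> S G x c)\<bar> else 0) + ?\<omega> c" by linarith
  qed
  \<comment> \<open>Weighting 0 is the sign: it shows the coordinate with its full modulus,
    perturbed by the other members of the cell and the sketch error.\<close>
  have fb: "\<bar>x j\<bar> \<le> sc \<phi> u A s (\<phi> j) + ?f j" if "j \<in> J - crowded \<phi>" for j
  proof -
    have jS: "j \<in> S" using that J(1) by blast
    have "cellv \<phi> u S x 0 (\<phi> j) = u 0 j * x j + (\<Sum>i\<in>cell \<phi> S (\<phi> j) - {j}. u 0 i * x i)"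
      unfolding cellv_def using fcell jS by (intro sum.remove) (auto simp: cell_def)
    moreover have "\<bar>u 0 j * x j\<bar> = \<bar>x j\<bar>" using u1(2)[OF jS, of 0] by (simp add: abs_mult)
    moreover have "\<bar>sketch_err K N s (res \<phi> u A 0) (\<phi> j)\<bar> \<le> sqrt (err2 K N s (res \<phi> u A) (\<phi> j))" by (rule sketch_err_le) simp
    moreover have "\<bar>cellv \<phi> u S x 0 (\<phi> j) + sketch_err K N s (res \<phi> u A 0) (\<phi> j)\<bar> \<le> sc \<phi> u A s (\<phi> j)" by (rule sc_ge) simp
    ultimately show ?thesis by linarith
  qed
  have \<omega>Y: "(\<Sum>c\<in>Y - \<phi> ` J. (?\<omega> c)\<^sup>2) \<le> V2"
  proof -
    have "(\<Sum>c\<in>Y - \<phi> ` J. (?\<omega> c)\<^sup>2) \<le> (\<Sum>c\<in>{..<N} - \<phi> ` J. (?\<omega> c)\<^sup>2)" using Y(1) by (intro sum_mono2) auto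
    then show ?thesis using omega_bound[OF h w a s] by linarith
  qed
  obtain J' where J': "J' \<subseteq> {i \<in> S. \<phi> i \<in> Y}" "card J' \<le> k"
    "(\<Sum>i\<in>{..<n} - J'. (x i)\<^sup>2) \<le> (\<Sum>i\<in>{..<n} - J. (x i)\<^sup>2)
      + 2 * sqrt \<theta> * (sqrt (k * F) + k * sqrt (4 * V2 / K')) + F + Lc"
    using swap_loss[OF fin(1) J S \<phi> k Y sc_nonneg V scb _ \<omega>Y fb _ f_bound[OF h w a s] theta_bound crowded_bound[OF h w a s]]
      nonrep0 err2_nonneg by auto
  show "\<exists>J'\<subseteq>S'. card J' \<le> k \<and> (\<Sum>i\<in>{..<n} - J'. (x i)\<^sup>2) \<le> (\<Sum>i\<in>{..<n} - J. (x i)\<^sup>2) + k / K' * (V * \<Gamma> / real \<Delta> ^ 2)"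
    unfolding S' using J' total_loss by (intro exI[of _ J'] conjI) linarith+
  have nG: "card (collided \<phi> G) \<le> K'"
  proof -
    have "real (card (collided \<phi> G)) = real (card {j \<in> G. \<exists>g\<in>G. g \<noteq> j \<and> \<phi> j = \<phi> g})" by (simp add: collided_def)
    also have "\<dots> \<le> (\<Sum>(i, j)\<in>offdiag G G. same_cell \<phi> i j)" by (rule collided_card) (auto simp: fin)
    also have "\<dots> \<le> (2 * K) * (2 * K) / N * \<Delta>" using h unfolding good_hash_def by simp
    also have "\<dots> = 4 * K / real \<Delta> ^ 7" using over_N[of "4 * K"] by (simp add: mult_ac)
    also have "\<dots> \<le> K'"
    proof -
      have "real (4 * K) \<le> real (\<Delta> ^ 7 * K')" using K'(2) by (simp only: of_nat_le_iff)
      then show ?thesis using pos by (simp add: pos_divide_le_eq mult.commute)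
    qed
    finally show ?thesis by simp
  qed
  obtain G' where G': "G' \<subseteq> {i \<in> S. \<phi> i \<in> Y}" "card G' \<le> 2 * K'"
    "(\<Sum>i\<in>{i \<in> S. \<phi> i \<in> Y} - G'. (x i)\<^sup>2) \<le> (\<Sum>(i, j)\<in>offdiag (S - G) G. (x i)\<^sup>2 * same_cell \<phi> i j)
      + sqrt (K' * (\<Sum>(i, j)\<in>offdiag (S - G) (S - G). (x i)\<^sup>2 * (x j)\<^sup>2 * same_cell \<phi> i j))"
    using selected_tail[OF fin(1) G(1) fY _ nG, where x = x] Y(2) by auto
  have "(\<Sum>(i, j)\<in>offdiag (S - G) G. (x i)\<^sup>2 * same_cell \<phi> i j) \<le> \<eta> * (2 * K) / N * \<Delta>"
    using h unfolding good_hash_def by blast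
  also have "\<dots> = 2 * \<eta> / real \<Delta> ^ 7" using over_N[of "2 * \<eta>"] by (simp add: mult_ac)
  also have "\<dots> \<le> 2 * \<eta> / real \<Delta> ^ 3" using \<Delta>1 \<eta>0 by (intro divide_left_mono power_increasing) auto
  finally have t1: "(\<Sum>(i, j)\<in>offdiag (S - G) G. (x i)\<^sup>2 * same_cell \<phi> i j) \<le> 2 * \<eta> / real \<Delta> ^ 3" .
  have t2: "sqrt (K' * (\<Sum>(i, j)\<in>offdiag (S - G) (S - G). (x i)\<^sup>2 * (x j)\<^sup>2 * same_cell \<phi> i j)) \<le> \<eta> / real \<Delta> ^ 3"
  proof (rule real_le_lsqrt)
    have "K' * (\<Sum>(i, j)\<in>offdiag (S - G) (S - G). (x i)\<^sup>2 * (x j)\<^sup>2 * same_cell \<phi> i j) \<le> K * (\<eta> * \<eta> / N * \<Delta>)"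
    proof (rule mult_mono)
      show "(\<Sum>(i, j)\<in>offdiag (S - G) (S - G). (x i)\<^sup>2 * (x j)\<^sup>2 * same_cell \<phi> i j) \<le> \<eta> * \<eta> / N * \<Delta>"
        using h unfolding good_hash_def by blast
      show "0 \<le> (\<Sum>(i, j)\<in>offdiag (S - G) (S - G). (x i)\<^sup>2 * (x j)\<^sup>2 * same_cell \<phi> i j)"
        by (intro sum_nonneg) (auto simp: same_cell_def)
    qed (use K' in auto)
    also have "\<dots> = \<eta> * \<eta> / real \<Delta> ^ 7" using over_N[of "\<eta> * \<eta>"] by (simp add: mult_ac)
    also have "\<dots> \<le> \<eta> * \<eta> / real \<Delta> ^ 6" using \<Delta>1 \<eta>0 by (intro divide_left_mono power_increasing) auto
    also have "\<dots> = (\<eta> / real \<Delta> ^ 3)\<^sup>2" by (simp add: power_divide power2_eq_square power_add[symmetric])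
    finally show "K' * (\<Sum>(i, j)\<in>offdiag (S - G) (S - G). (x i)\<^sup>2 * (x j)\<^sup>2 * same_cell \<phi> i j) \<le> (\<eta> / real \<Delta> ^ 3)\<^sup>2" .
  qed (use \<eta>0 in auto)
  have "3 * \<eta> / real \<Delta> ^ 3 \<le> real \<Delta> * \<eta> / real \<Delta> ^ 3" using \<Delta> \<eta>0 by (intro divide_right_mono mult_right_mono) auto
  also have "\<dots> = \<eta> / real \<Delta> ^ 2" using pos by (simp add: power3_eq_cube power2_eq_square)
  finally have "(\<Sum>i\<in>S' - G'. (x i)\<^sup>2) \<le> \<eta> / real \<Delta> ^ 2" using G'(3) t1 t2 unfolding S' by linarith
  then show "\<exists>G'\<subseteq>S'. card G' \<le> 2 * K' \<and> (\<Sum>i\<in>S' - G'. (x i)\<^sup>2) \<le> \<eta> / real \<Delta> ^ 2"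
    using G'(1,2) unfolding S' by (intro exI[of _ G'] conjI)
  have "real (card S') \<le> K' + (\<Sum>(i, j)\<in>offdiag S S. same_cell \<phi> i j)"
    unfolding S' by (rule selected_card[OF fin(1) fY]) (simp add: Y(2))
  also have "\<dots> \<le> K' + real n * n / N * \<Delta>" using h unfolding good_hash_def by simp
  also have "real n * n / N * \<Delta> = (real n)\<^sup>2 / (K * real \<Delta> ^ 7)"
    unfolding N_real using pos by (simp add: field_simps power2_eq_square eval_nat_numeral)
  finally show "real (card S') \<le> K' + (real n)\<^sup>2 / (K * real \<Delta> ^ 7)" by simp
qed

end

section \<open>Probability of the good events\<close>

lemma cells_sum_le:
  fixes f :: "nat \<Rightarrow> real"
  assumes "finite C" "finite S" "finite T" "\<And>c. c \<in> C \<Longrightarrow> I c \<subseteq> cell \<phi> S c" "\<And>c. c \<in> C \<Longrightarrow> I c \<subseteq> T" "\<And>i. 0 \<le> f i"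
  shows "(\<Sum>c\<in>C. \<Sum>i\<in>I c. f i) \<le> (\<Sum>i\<in>T. f i)"
proof -
  have fI: "finite (I c)" if "c \<in> C" for c using assms(3,5) that finite_subset by blast
  have "I c \<inter> I c' = {}" if "c \<in> C" "c' \<in> C" "c \<noteq> c'" for c c'
    using assms(4)[OF that(1)] assms(4)[OF that(2)] that(3) by (auto simp: cell_def)
  then have "(\<Sum>c\<in>C. \<Sum>i\<in>I c. f i) = (\<Sum>i\<in>(\<Union>c\<in>C. I c). f i)"
    using fI assms(1) by (intro sum.UNION_disjoint[symmetric]) auto
  also have "\<dots> \<le> (\<Sum>i\<in>T. f i)" using assms by (intro sum_mono2) auto
  finally show ?thesis .
qed

lemma collided_sum_le:
  fixes f :: "nat \<Rightarrow> real"
  assumes "finite B" "finite G" "A \<subseteq> B" "\<And>i. i \<in> A \<Longrightarrow> \<exists>g\<in>G. g \<noteq> i \<and> \<phi> i = \<phi> g" "\<And>i. 0 \<le> f i"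
  shows "(\<Sum>i\<in>A. f i) \<le> (\<Sum>(i, j)\<in>offdiag B G. f i * same_cell \<phi> i j)"
proof -
  obtain p where p: "\<And>i. i \<in> A \<Longrightarrow> p i \<in> G \<and> p i \<noteq> i \<and> \<phi> i = \<phi> (p i)" using assms(4) by metis
  have "(\<Sum>i\<in>A. f i) = (\<Sum>i\<in>A. f i * same_cell \<phi> i (p i))"
  proof (rule sum.cong[OF refl])
    fix i assume "i \<in> A"
    then have "same_cell \<phi> i (p i) = 1" using p[of i] unfolding same_cell_def by presburger
    then show "f i = f i * same_cell \<phi> i (p i)" by simp
  qed
  also have "\<dots> = (\<Sum>(i, j)\<in>(\<lambda>i. (i, p i)) ` A. f i * same_cell \<phi> i j)"
    by (subst sum.reindex) (auto simp: inj_on_def)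
  also have "\<dots> \<le> (\<Sum>(i, j)\<in>offdiag B G. f i * same_cell \<phi> i j)"
  proof (rule sum_mono2)
    show "finite (offdiag B G)" using assms by (intro finite_offdiag)
    have "(i, p i) \<in> offdiag B G" if "i \<in> A" for i
    proof -
      have "i \<in> B" "p i \<in> G" "i \<noteq> p i" using p[OF that] that assms(3) by auto
      then show ?thesis by (simp add: offdiag_def)
    qed
    then show "(\<lambda>i. (i, p i)) ` A \<subseteq> offdiag B G" by blast
  qed (use assms(5) in \<open>auto simp: same_cell_def\<close>)
  finally show ?thesis .
qed

lemma prob_conj:
  assumes "measure_pmf.prob p {a. \<not> Q a} \<le> c" "measure_pmf.prob p {a. \<not> R a} \<le> d"
  shows "measure_pmf.prob p {a. \<not> (Q a \<and> R a)} \<le> c + d"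
proof -
  have "measure_pmf.prob p {a. \<not> (Q a \<and> R a)} = measure_pmf.prob p {a. \<not> Q a \<or> \<not> R a}" by simp
  also have "\<dots> \<le> c + d" using prob_disj[of p "\<lambda>a. \<not> Q a" "\<lambda>a. \<not> R a"] assms by linarith
  finally show ?thesis .
qed

lemma prob_sure: "(\<And>a. a \<in> set_pmf p \<Longrightarrow> Q a) \<Longrightarrow> measure_pmf.prob p {a. \<not> Q a} \<le> 0"
  using prob_mono[of p "\<lambda>a. \<not> Q a" "\<lambda>_. False"] by simp

definition stage_pmf :: "nat \<Rightarrow> nat \<Rightarrow> nat \<Rightarrow> nat \<Rightarrow> real pmf \<Rightarrow> seed pmf" where
  "stage_pmf n N K m p = pair_pmf (hash n N) (pair_pmf (weights n (2 ^ m)) (pair_pmf (gmat (32 * K) N p) (signs K N)))"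

context stage begin

lemma inv\<Delta>: "0 < real \<Delta>" using pos by simp

lemma hash_event:
  fixes a :: "nat \<Rightarrow> nat \<Rightarrow> real" and B :: real
  assumes "A \<subseteq> S" "A' \<subseteq> S" "\<And>i j. 0 \<le> a i j" "(\<Sum>(i, j)\<in>offdiag A A'. a i j) \<le> B"
  shows "measure_pmf.prob (hash n N) {\<phi>. \<not> (\<Sum>(i, j)\<in>offdiag A A'. a i j * same_cell \<phi> i j) \<le> B / N * \<Delta>} \<le> 1 / \<Delta>"
proof -
  have f: "finite A" "finite A'" using assms fin finite_subset by blast+
  have "1 \<le> N" using pos by simp
  from hash_pairs[OF this finite_offdiag[OF f] _ assms(3) inv\<Delta> assms(4), of n]
  show ?thesis using assms(1,2) S unfolding same_cell_def not_le by (auto simp: offdiag_def subset_iff)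
qed

lemma hash_good: "measure_pmf.prob (hash n N) {\<phi>. \<not> good_hash \<phi>} \<le> 0 + (1 / \<Delta> + (1 / \<Delta> + (1 / \<Delta> + (1 / \<Delta> + (1 / \<Delta> + (1 / \<Delta> + 1 / \<Delta>))))))"
  unfolding good_hash_def
proof (intro prob_conj)
  have cG: "real (card G) \<le> 2 * real K" using G(2) by linarith
  have cJ: "real (card J) \<le> real k" using J(2) by simp
  have cS: "real (card S) \<le> real n" using card_mono[OF _ S] by simp
  have "(\<Sum>i\<in>G - J. (x i)\<^sup>2) \<le> (\<Sum>i\<in>S - J. (x i)\<^sup>2)" using G(1) fin by (intro sum_mono2) auto
  then have GJ: "(\<Sum>i\<in>G - J. (x i)\<^sup>2) \<le> V" using V by (rule order_trans)
  show "measure_pmf.prob (hash n N) {\<phi>. \<not> (\<forall>i\<in>S. \<phi> i < N)} \<le> 0"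
    using hash_range[of N] pos S by (intro prob_sure) auto
  show "measure_pmf.prob (hash n N) {\<phi>. \<not> (\<Sum>(i, j)\<in>offdiag G G. 1 * same_cell \<phi> i j) \<le> (2 * K) * (2 * K) / N * \<Delta>} \<le> 1 / \<Delta>"
  proof (rule hash_event[OF G(1) G(1)])
    have "(\<Sum>(i, j)\<in>offdiag G G. 1 * 1) \<le> (\<Sum>i\<in>G. 1) * (\<Sum>j\<in>G. 1 :: real)" by (intro offdiag_sum_le fin) auto
    also have "\<dots> = real (card G) * real (card G)" by simp
    also have "\<dots> \<le> (2 * real K) * (2 * real K)" using cG by (intro mult_mono) auto
    finally show "(\<Sum>(i, j)\<in>offdiag G G. 1) \<le> real ((2 * K) * (2 * K))" by simp
  qed simp
  show "measure_pmf.prob (hash n N) {\<phi>. \<not> (\<Sum>(i, j)\<in>offdiag (S - G) G. (x i)\<^sup>2 * same_cell \<phi> i j) \<le> \<eta> * (2 * K) / N * \<Delta>} \<le> 1 / \<Delta>"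
  proof (rule hash_event[OF _ G(1)])
    have "(\<Sum>(i, j)\<in>offdiag (S - G) G. (x i)\<^sup>2 * 1) \<le> (\<Sum>i\<in>S - G. (x i)\<^sup>2) * (\<Sum>j\<in>G. 1 :: real)" by (intro offdiag_sum_le fin) auto
    also have "\<dots> \<le> \<eta> * (2 * K)" using cG \<eta> \<eta>0 by (intro mult_mono) auto
    finally show "(\<Sum>(i, j)\<in>offdiag (S - G) G. (x i)\<^sup>2) \<le> \<eta> * real (2 * K)" by simp
  qed auto
  show "measure_pmf.prob (hash n N) {\<phi>. \<not> (\<Sum>(i, j)\<in>offdiag (S - G) (S - G). ((x i)\<^sup>2 * (x j)\<^sup>2) * same_cell \<phi> i j) \<le> \<eta> * \<eta> / N * \<Delta>} \<le> 1 / \<Delta>"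
  proof (rule hash_event)
    have "(\<Sum>(i, j)\<in>offdiag (S - G) (S - G). (x i)\<^sup>2 * (x j)\<^sup>2) \<le> (\<Sum>i\<in>S - G. (x i)\<^sup>2) * (\<Sum>j\<in>S - G. (x j)\<^sup>2)" by (intro offdiag_sum_le fin) auto
    also have "\<dots> \<le> \<eta> * \<eta>" using \<eta> \<eta>0 by (intro mult_mono) (auto intro: sum_nonneg)
    finally show "(\<Sum>(i, j)\<in>offdiag (S - G) (S - G). (x i)\<^sup>2 * (x j)\<^sup>2) \<le> \<eta> * \<eta>" .
  qed auto
  show "measure_pmf.prob (hash n N) {\<phi>. \<not> (\<Sum>(i, j)\<in>offdiag (G - J) G. (x i)\<^sup>2 * same_cell \<phi> i j) \<le> V * (2 * K) / N * \<Delta>} \<le> 1 / \<Delta>"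
  proof (rule hash_event[OF _ G(1)])
    have "(\<Sum>(i, j)\<in>offdiag (G - J) G. (x i)\<^sup>2 * 1) \<le> (\<Sum>i\<in>G - J. (x i)\<^sup>2) * (\<Sum>j\<in>G. 1 :: real)" using fin by (intro offdiag_sum_le) auto
    also have "\<dots> \<le> V * (2 * K)" using cG GJ V0 by (intro mult_mono) auto
    finally show "(\<Sum>(i, j)\<in>offdiag (G - J) G. (x i)\<^sup>2) \<le> V * real (2 * K)" by simp
  qed (use G in auto)
  show "measure_pmf.prob (hash n N) {\<phi>. \<not> (\<Sum>(i, j)\<in>offdiag J (S - G). (x j)\<^sup>2 * same_cell \<phi> i j) \<le> k * \<eta> / N * \<Delta>} \<le> 1 / \<Delta>"
  proof (rule hash_event[OF J(1)])
    have "(\<Sum>(i, j)\<in>offdiag J (S - G). 1 * (x j)\<^sup>2) \<le> (\<Sum>i\<in>J. 1 :: real) * (\<Sum>j\<in>S - G. (x j)\<^sup>2)" by (intro offdiag_sum_le fin) auto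
    also have "\<dots> \<le> k * \<eta>" using cJ \<eta> \<eta>0 by (intro mult_mono) (auto intro: sum_nonneg)
    finally show "(\<Sum>(i, j)\<in>offdiag J (S - G). (x j)\<^sup>2) \<le> k * \<eta>" by simp
  qed auto
  show "measure_pmf.prob (hash n N) {\<phi>. \<not> (\<Sum>(i, j)\<in>offdiag S S. 1 * same_cell \<phi> i j) \<le> real n * n / N * \<Delta>} \<le> 1 / \<Delta>"
  proof (rule hash_event)
    have "(\<Sum>(i, j)\<in>offdiag S S. 1 * 1) \<le> (\<Sum>i\<in>S. 1) * (\<Sum>j\<in>S. 1 :: real)" by (intro offdiag_sum_le fin) auto
    also have "\<dots> \<le> real n * n" using cS by (auto intro!: mult_mono)
    finally show "(\<Sum>(i, j)\<in>offdiag S S. 1) \<le> real n * n" by simp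
  qed auto
  show "measure_pmf.prob (hash n N) {\<phi>. \<not> (\<Sum>(i, j)\<in>offdiag J G. 1 * same_cell \<phi> i j) \<le> k * (2 * K) / N * \<Delta>} \<le> 1 / \<Delta>"
  proof (rule hash_event[OF J(1) G(1)])
    have "(\<Sum>(i, j)\<in>offdiag J G. 1 * 1) \<le> (\<Sum>i\<in>J. 1) * (\<Sum>j\<in>G. 1 :: real)" by (intro offdiag_sum_le fin) auto
    also have "\<dots> \<le> k * (2 * K)" using cG cJ by (auto intro!: mult_mono)
    finally show "(\<Sum>(i, j)\<in>offdiag J G. 1) \<le> real (k * (2 * K))" by simp
  qed simp
qed

lemma weights_good:
  assumes \<phi>: "\<phi> \<in> set_pmf (hash n N)" and m: "8 * real n * \<Delta> \<le> 2 ^ m"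
  shows "measure_pmf.prob (weights n (2 ^ m)) {u. \<not> good_weights m \<phi> u} \<le> 0 + (1 / \<Delta> + (1 / \<Delta> + (1 / \<Delta> + (1 / \<Delta> + 1 / \<Delta>))))"
  unfolding good_weights_def
proof (intro prob_conj)
  have D: "(1::nat) \<le> 2 ^ m" by simp
  have cellS: "cell \<phi> S c \<subseteq> {..<n}" for c using S by (auto simp: cell_def)
  have fcr: "finite (crowded' \<phi>)" using fin by (auto simp: crowded'_def crowded_def)
  have crS: "crowded' \<phi> \<subseteq> S" using J(1) by (auto simp: crowded'_def crowded_def)
  have crI: "\<And>j. j \<in> crowded' \<phi> \<Longrightarrow> cell \<phi> S (\<phi> j) \<subseteq> {..<n} \<and> j \<in> cell \<phi> S (\<phi> j) \<and> x j \<noteq> 0"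
    using cellS crS by (auto simp: crowded'_def cell_def)
  show "measure_pmf.prob (weights n (2 ^ m)) {u. \<not> (\<forall>i\<in>S. (\<forall>l<4. \<bar>u l i\<bar> \<le> 1) \<and> \<bar>u 0 i\<bar> = 1)} \<le> 0"
    using weights_range[OF D, of _ n] S by (intro prob_sure) auto
  show "measure_pmf.prob (weights n (2 ^ m)) {u. \<not> (\<Sum>l<4. \<Sum>c\<in>{..<N} - \<phi> ` G. (\<Sum>i\<in>cell \<phi> S c. u l i * x i)\<^sup>2) \<le> 4 * \<eta> * \<Delta>} \<le> 1 / \<Delta>"
    unfolding not_le
  proof (rule weights_second_moment[OF D _ inv\<Delta>])
    have "(\<Sum>c\<in>{..<N} - \<phi> ` G. \<Sum>i\<in>cell \<phi> S c. (x i)\<^sup>2) \<le> (\<Sum>i\<in>S - G. (x i)\<^sup>2)"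
      by (rule cells_sum_le[where \<phi> = \<phi> and S = S]) (auto simp: fin cell_def)
    then have "(\<Sum>c\<in>{..<N} - \<phi> ` G. \<Sum>i\<in>cell \<phi> S c. (x i)\<^sup>2) \<le> \<eta>" using \<eta> by linarith
    then show "(\<Sum>l<4::nat. \<Sum>c\<in>{..<N} - \<phi> ` G. \<Sum>i\<in>cell \<phi> S c. (x i)\<^sup>2) \<le> 4 * \<eta>" by simp
  qed (use cellS in auto)
  show "measure_pmf.prob (weights n (2 ^ m)) {u. \<not> (\<Sum>l<4. \<Sum>c\<in>{..<N} - \<phi> ` J. (\<Sum>i\<in>cell \<phi> S c - {rep \<phi> S G x c}. u l i * x i)\<^sup>2)
       \<le> 4 * (\<eta> + (\<Sum>(i, j)\<in>offdiag (G - J) G. (x i)\<^sup>2 * same_cell \<phi> i j)) * \<Delta>} \<le> 1 / \<Delta>"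
    unfolding not_le
  proof (rule weights_second_moment[OF D _ inv\<Delta>])
    \<comment> \<open>In a cell that avoids \<open>J\<close>, a member other than the representative
      is light, or it is heavy; then the representative is heavy as well and the two
      collide.\<close>
    define A where "A = {i \<in> G - J. \<exists>g\<in>G. g \<noteq> i \<and> \<phi> i = \<phi> g}"
    have "(\<Sum>c\<in>{..<N} - \<phi> ` J. \<Sum>i\<in>cell \<phi> S c - {rep \<phi> S G x c}. (x i)\<^sup>2) \<le> (\<Sum>i\<in>(S - G) \<union> A. (x i)\<^sup>2)"
    proof (rule cells_sum_le[where \<phi> = \<phi> and S = S])
      fix c assume c: "c \<in> {..<N} - \<phi> ` J"
      show "cell \<phi> S c - {rep \<phi> S G x c} \<subseteq> (S - G) \<union> A"
      proof
        fix i assume i: "i \<in> cell \<phi> S c - {rep \<phi> S G x c}"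
        show "i \<in> (S - G) \<union> A"
        proof (cases "i \<in> G")
          case True
          have ne: "cell \<phi> S c \<noteq> {}" "cell \<phi> S c \<inter> G \<noteq> {}" using i True by auto
          have r: "rep \<phi> S G x c \<in> G" "rep \<phi> S G x c \<in> cell \<phi> S c" using rep(1,2)[OF fin(1) ne(1)] ne(2) by auto
          have "i \<notin> J" using c i by (auto simp: cell_def)
          moreover have "\<phi> i = \<phi> (rep \<phi> S G x c)" using r(2) i by (auto simp: cell_def)
          moreover have "rep \<phi> S G x c \<noteq> i" using i by auto
          ultimately have "i \<in> A" unfolding A_def using True r(1) by blast
          then show ?thesis by blast
        next
          case False then show ?thesis using i by (auto simp: cell_def)
        qed
      qed
    qed (use fin in \<open>auto simp: A_def\<close>)
    also have "\<dots> \<le> (\<Sum>i\<in>S - G. (x i)\<^sup>2) + (\<Sum>i\<in>A. (x i)\<^sup>2)"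
      using fin by (subst sum.union_disjoint) (auto simp: A_def)
    also have "\<dots> \<le> \<eta> + (\<Sum>(i, j)\<in>offdiag (G - J) G. (x i)\<^sup>2 * same_cell \<phi> i j)"
      using fin by (intro add_mono \<eta> collided_sum_le) (auto simp: A_def)
    finally show "(\<Sum>l<4::nat. \<Sum>c\<in>{..<N} - \<phi> ` J. \<Sum>i\<in>cell \<phi> S c - {rep \<phi> S G x c}. (x i)\<^sup>2)
       \<le> 4 * (\<eta> + (\<Sum>(i, j)\<in>offdiag (G - J) G. (x i)\<^sup>2 * same_cell \<phi> i j))" by simp
  qed (use cellS in auto)
  show "measure_pmf.prob (weights n (2 ^ m)) {u. \<not> (\<Sum>l<4. \<Sum>j\<in>(if l = 0 then J - crowded \<phi> else {}). (\<Sum>i\<in>cell \<phi> S (\<phi> j) - {j}. u l i * x i)\<^sup>2)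
       \<le> (\<Sum>(i, j)\<in>offdiag J (S - G). (x j)\<^sup>2 * same_cell \<phi> i j) * \<Delta>} \<le> 1 / \<Delta>"
    unfolding not_le
  proof (rule weights_second_moment[OF D _ inv\<Delta>])
    let ?I = "\<lambda>j. cell \<phi> S (\<phi> j) - {j}"
    have fI: "finite (?I j)" for j using fin by (simp add: cell_def)
    have "(\<Sum>l<4::nat. \<Sum>j\<in>(if l = 0 then J - crowded \<phi> else {}). \<Sum>i\<in>?I j. (x i)\<^sup>2) = (\<Sum>j\<in>J - crowded \<phi>. \<Sum>i\<in>?I j. (x i)\<^sup>2)"
      by (simp add: eval_nat_numeral lessThan_Suc)
    also have "\<dots> = (\<Sum>(j, i)\<in>Sigma (J - crowded \<phi>) ?I. (x i)\<^sup>2)"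
      using fin fI by (intro sum.Sigma) auto
    also have "\<dots> = (\<Sum>(j, i)\<in>Sigma (J - crowded \<phi>) ?I. (x i)\<^sup>2 * same_cell \<phi> j i)"
      by (intro sum.cong refl) (auto simp: same_cell_def cell_def)
    \<comment> \<open>Being uncrowded means that everything else in the cell is light.\<close>
    also have "\<dots> \<le> (\<Sum>(j, i)\<in>offdiag J (S - G). (x i)\<^sup>2 * same_cell \<phi> j i)"
    proof (rule sum_mono2)
      show "finite (offdiag J (S - G))" by (intro finite_offdiag fin)
      show "Sigma (J - crowded \<phi>) ?I \<subseteq> offdiag J (S - G)"
      proof
        fix q assume "q \<in> Sigma (J - crowded \<phi>) ?I"
        then obtain j i where q: "q = (j, i)" "j \<in> J" "j \<notin> crowded \<phi>" "i \<in> S" "\<phi> i = \<phi> j" "i \<noteq> j"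
          by (auto simp: cell_def)
        have "i \<notin> G"
        proof
          assume "i \<in> G"
          then have "\<exists>g\<in>G. g \<noteq> j \<and> \<phi> j = \<phi> g" using q(5,6) by (intro bexI[of _ i]) simp_all
          then show False using q(2,3) unfolding crowded_def by blast
        qed
        then show "q \<in> offdiag J (S - G)" using q by (simp add: offdiag_def)
      qed
    qed (auto simp: same_cell_def)
    finally show "(\<Sum>l<4::nat. \<Sum>j\<in>(if l = 0 then J - crowded \<phi> else {}). \<Sum>i\<in>?I j. (x i)\<^sup>2)
      \<le> (\<Sum>(i, j)\<in>offdiag J (S - G). (x j)\<^sup>2 * same_cell \<phi> i j)" .
  qed (use cellS in auto)
  show "measure_pmf.prob (weights n (2 ^ m)) {u. \<not> (\<forall>j\<in>crowded' \<phi>. (1 / 4) ^ m * (x j)\<^sup>2 < energy \<phi> u j)} \<le> 1 / \<Delta>"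
  proof -
    have "card (crowded' \<phi>) \<le> n" using card_mono[of "{..<n}" "crowded' \<phi>"] crS S by auto
    then have "8 * real (card (crowded' \<phi>)) * \<Delta> \<le> 8 * real n * \<Delta>" by (intro mult_right_mono) auto
    then have "8 * real (card (crowded' \<phi>)) * \<Delta> \<le> 2 ^ m" using m by linarith
    then have "8 * real (card (crowded' \<phi>)) \<le> 2 ^ m * (1 / \<Delta>)" using pos by (simp add: pos_le_divide_eq)
    from weights_floor[OF fcr crI this] show ?thesis unfolding energy_def by (simp add: not_less)
  qed
  show "measure_pmf.prob (weights n (2 ^ m)) {u. \<not> (\<Sum>j\<in>crowded' \<phi>. if (1 / 4) ^ m * (x j)\<^sup>2 < energy \<phi> u j
        then (x j)\<^sup>2 * (16 * \<theta> + 16 * R2 / K) / energy \<phi> u j else 0)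
       \<le> 65 * (16 * \<theta> + 16 * R2 / K) * card (crowded' \<phi>) * \<Delta>} \<le> 1 / \<Delta>"
    unfolding energy_def not_le
  proof (rule weights_inverse_moment[OF fcr crI])
    show "0 \<le> 16 * \<theta> + 16 * R2 / K" using theta0 R20 by simp
  qed (use inv\<Delta> in auto)
qed

lemma matrix_good:
  assumes p: "finite (set_pmf p)" "E p (\<lambda>g. g) = 0" "E p (\<lambda>g. g\<^sup>2) \<le> 1"
    "\<And>d \<tau>. 1 / \<Delta> ^ 10 \<le> \<tau> \<Longrightarrow> (\<exists>i<N. d i \<noteq> 0) \<Longrightarrow>
      measure_pmf.prob (Pi_pmf {..<N} 0 (\<lambda>_. p)) {a. (inner_n N a d)\<^sup>2 \<le> \<tau>\<^sup>2 * (\<Sum>i<N. (d i)\<^sup>2)} \<le> 2 * \<tau>"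
  shows "measure_pmf.prob (gmat (32 * K) N p) {A. \<not> good_matrix \<phi> u A} \<le> 2 / \<Delta> + 1 / \<Delta>"
  unfolding good_matrix_def
proof (intro prob_conj)
  have "4 \<le> \<Delta>" using \<Delta> by simp
  from lower_iso_prob[OF this K N p(1,3,4)]
  show "measure_pmf.prob (gmat (32 * K) N p) {A. \<not> lower_iso (32 * K) N (4 * K) (1 / \<Delta> ^ 20) A} \<le> 2 / \<Delta>" by simp
  show "measure_pmf.prob (gmat (32 * K) N p) {A. \<not> (\<Sum>l<4. \<Sum>r<32 * K. (inner_n N (A r) (noise \<phi> u l))\<^sup>2)
       \<le> (32 * K) * (\<Sum>l<4. \<Sum>c<N. (noise \<phi> u l c)\<^sup>2) * \<Delta>} \<le> 1 / \<Delta>"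
    unfolding not_le by (rule gmat_noise[OF p(1-3) inv\<Delta>])
qed

lemma signs_good:
  assumes \<phi>: "\<forall>i\<in>S. \<phi> i < N"
  shows "measure_pmf.prob (signs K N) {s. \<not> good_signs \<phi> u A s} \<le> 1 / \<Delta> + (1 / \<Delta> + 1 / \<Delta>)"
  unfolding good_signs_def
proof (intro prob_conj)
  let ?R = "(\<Sum>l<4. \<Sum>c<N. (res \<phi> u A l c)\<^sup>2)"
  show "measure_pmf.prob (signs K N) {s. \<not> (\<Sum>c<N. err2 K N s (res \<phi> u A) c) \<le> (N * (?R / K)) * \<Delta>} \<le> 1 / \<Delta>"
    unfolding not_le using err2_sum_markov[OF K _ inv\<Delta>, of "{..<N}" "\<lambda>c. c" N "res \<phi> u A"] by simp
  have J\<phi>: "\<And>j. j \<in> J \<Longrightarrow> \<phi> j < N" using \<phi> J(1) by blast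
  then show "measure_pmf.prob (signs K N) {s. \<not> (\<Sum>j\<in>J. err2 K N s (res \<phi> u A) (\<phi> j)) \<le> (card J * (?R / K)) * \<Delta>} \<le> 1 / \<Delta>"
    unfolding not_le by (intro err2_sum_markov[OF K _ inv\<Delta>])
  let ?Q = "\<lambda>s. (\<Sum>j\<in>crowded' \<phi>. if energy \<phi> u j \<le> 8 * \<theta> + 8 * err2 K N s (res \<phi> u A) (\<phi> j) then (x j)\<^sup>2 else 0)
       \<le> (\<Sum>j\<in>crowded' \<phi>. (x j)\<^sup>2 * (16 * \<theta> + 16 * R2 / K) / energy \<phi> u j) * \<Delta>"
  show "measure_pmf.prob (signs K N) {s. \<not> (?R \<le> R2 \<longrightarrow> (\<forall>j\<in>crowded' \<phi>. 0 < energy \<phi> u j) \<longrightarrow> ?Q s)} \<le> 1 / \<Delta>"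
  proof (cases "?R \<le> R2 \<and> (\<forall>j\<in>crowded' \<phi>. 0 < energy \<phi> u j)")
    case True
    have f: "\<And>j. j \<in> crowded' \<phi> \<Longrightarrow> \<phi> j < N" using J\<phi> by (auto simp: crowded'_def crowded_def)
    have "measure_pmf.prob (signs K N) {s. \<not> ?Q s} \<le> 1 / \<Delta>"
      unfolding not_le
      by (rule err2_lost_markov[OF K f inv\<Delta> _ _ theta0 conjunct1[OF True]]) (use True in auto)
    then show ?thesis using True by simp
  next
    case False
    then have *: "{s. \<not> (?R \<le> R2 \<longrightarrow> (\<forall>j\<in>crowded' \<phi>. 0 < energy \<phi> u j) \<longrightarrow> ?Q s)} = {}" by blast
    show ?thesis unfolding * measure_empty using inv\<Delta> by simp
  qed
qed

text \<open>The four parts of the seed fail with at most 7, 5, 3 and 3 times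
  \<open>1 / \<Delta>\<close>, each conditionally on the parts drawn before it.\<close>

lemma stage_good:
  assumes p: "finite (set_pmf p)" "E p (\<lambda>g. g) = 0" "E p (\<lambda>g. g\<^sup>2) \<le> 1"
    "\<And>d \<tau>. 1 / \<Delta> ^ 10 \<le> \<tau> \<Longrightarrow> (\<exists>i<N. d i \<noteq> 0) \<Longrightarrow>
      measure_pmf.prob (Pi_pmf {..<N} 0 (\<lambda>_. p)) {a. (inner_n N a d)\<^sup>2 \<le> \<tau>\<^sup>2 * (\<Sum>i<N. (d i)\<^sup>2)} \<le> 2 * \<tau>"
    and m: "8 * real n * \<Delta> \<le> 2 ^ m"
  shows "measure_pmf.prob (stage_pmf n N K m p) {w. \<not> (case w of (\<phi>, u, A, s) \<Rightarrow>
    good_hash \<phi> \<and> good_weights m \<phi> u \<and> good_matrix \<phi> u A \<and> good_signs \<phi> u A s)} \<le> 18 / \<Delta>"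
proof -
  let ?H = "hash n N" and ?W = "weights n (2 ^ m)" and ?M = "gmat (32 * K) N p" and ?S = "signs K N"
  have f: "finite (set_pmf ?H)" "finite (set_pmf ?W)" "finite (set_pmf ?M)" "finite (set_pmf ?S)"
    using finite_hash[of N n] pos finite_weights[of "2 ^ m" n] finite_gmat[OF p(1)] finite_signs by simp_all
  have fMS: "finite (set_pmf (pair_pmf ?M ?S))" and fWMS: "finite (set_pmf (pair_pmf ?W (pair_pmf ?M ?S)))"
    using f by simp_all
  have MS: "measure_pmf.prob (pair_pmf ?M ?S) {q. \<not> (good_matrix \<phi> u (fst q) \<and> good_signs \<phi> u (fst q) (snd q))} \<le> 3 / \<Delta> + 3 / \<Delta>"
    if \<phi>: "\<phi> \<in> set_pmf ?H" for \<phi> u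
  proof (rule prob_conj)
    have "\<forall>i\<in>S. \<phi> i < N" using hash_range[OF _ \<phi>] pos S by auto
    then show "measure_pmf.prob (pair_pmf ?M ?S) {q. \<not> good_signs \<phi> u (fst q) (snd q)} \<le> 3 / \<Delta>"
      using signs_good by (intro prob_pair_le[OF f(3,4)]) auto
    show "measure_pmf.prob (pair_pmf ?M ?S) {q. \<not> good_matrix \<phi> u (fst q)} \<le> 3 / \<Delta>"
      unfolding prob_pair_fst[of ?M ?S "\<lambda>A. \<not> good_matrix \<phi> u A"] using matrix_good[OF p, of \<phi> u] by simp
  qed
  have WMS: "measure_pmf.prob (pair_pmf ?W (pair_pmf ?M ?S)) {q. \<not> (good_weights m \<phi> (fst q) \<and>
      (good_matrix \<phi> (fst q) (fst (snd q)) \<and> good_signs \<phi> (fst q) (fst (snd q)) (snd (snd q))))} \<le> 5 / \<Delta> + 6 / \<Delta>"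
    if \<phi>: "\<phi> \<in> set_pmf ?H" for \<phi>
  proof (rule prob_conj)
    show "measure_pmf.prob (pair_pmf ?W (pair_pmf ?M ?S)) {q. \<not> good_weights m \<phi> (fst q)} \<le> 5 / \<Delta>"
      unfolding prob_pair_fst[of ?W _ "\<lambda>u. \<not> good_weights m \<phi> u"] using weights_good[OF \<phi> m] by simp
    show "measure_pmf.prob (pair_pmf ?W (pair_pmf ?M ?S)) {q. \<not> (good_matrix \<phi> (fst q) (fst (snd q)) \<and> good_signs \<phi> (fst q) (fst (snd q)) (snd (snd q)))} \<le> 6 / \<Delta>"
      using MS[OF \<phi>] by (intro prob_pair_le[OF f(2) fMS]) simp
  qed
  have "measure_pmf.prob (stage_pmf n N K m p) {w. \<not> (good_hash (fst w) \<and> (good_weights m (fst w) (fst (snd w)) \<and>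
      (good_matrix (fst w) (fst (snd w)) (fst (snd (snd w))) \<and> good_signs (fst w) (fst (snd w)) (fst (snd (snd w))) (snd (snd (snd w))))))} \<le> 7 / \<Delta> + 11 / \<Delta>"
    unfolding stage_pmf_def
  proof (rule prob_conj)
    show "measure_pmf.prob (pair_pmf ?H (pair_pmf ?W (pair_pmf ?M ?S))) {w. \<not> good_hash (fst w)} \<le> 7 / \<Delta>"
      unfolding prob_pair_fst[of ?H _ "\<lambda>\<phi>. \<not> good_hash \<phi>"] using hash_good by simp
    show "measure_pmf.prob (pair_pmf ?H (pair_pmf ?W (pair_pmf ?M ?S))) {w. \<not> (good_weights m (fst w) (fst (snd w)) \<and>
      (good_matrix (fst w) (fst (snd w)) (fst (snd (snd w))) \<and> good_signs (fst w) (fst (snd w)) (fst (snd (snd w))) (snd (snd (snd w)))))} \<le> 11 / \<Delta>"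
      using WMS by (intro prob_pair_le[OF f(1) fWMS]) simp
  qed
  then show ?thesis by (simp add: case_prod_unfold)
qed

end

text \<open>One round of the algorithm: \<open>J\<close> is a set of \<open>k\<close> coordinates to keep, \<open>G\<close> a larger set
  carrying all but \<open>\<eta>\<close> of the energy of the surviving coordinates \<open>S\<close>.\<close>

theorem stage_theorem:
  fixes \<Delta> K K' k n m :: nat and x :: "nat \<Rightarrow> real" and V \<eta> \<Gamma> D :: real
  assumes "512 \<le> \<Delta>" "1 \<le> K" "1 \<le> k" "4 * k \<le> K'" "K' \<le> K" "4 * K \<le> \<Delta> ^ 7 * K'"
    and p: "finite (set_pmf p)" "E p (\<lambda>g. g) = 0" "E p (\<lambda>g. g\<^sup>2) \<le> 1"
    "\<And>d \<tau>. 1 / \<Delta> ^ 10 \<le> \<tau> \<Longrightarrow> (\<exists>i<\<Delta> ^ 8 * K. d i \<noteq> 0) \<Longrightarrow>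
      measure_pmf.prob (Pi_pmf {..<\<Delta> ^ 8 * K} 0 (\<lambda>_. p))
        {a. (inner_n (\<Delta> ^ 8 * K) a d)\<^sup>2 \<le> \<tau>\<^sup>2 * (\<Sum>i<\<Delta> ^ 8 * K. (d i)\<^sup>2)} \<le> 2 * \<tau>"
    and m: "8 * real n * \<Delta> \<le> 2 ^ m"
    and S: "S \<subseteq> {..<n}" and J: "J \<subseteq> S" "card J \<le> k" "(\<Sum>i\<in>{..<n} - J. (x i)\<^sup>2) \<le> D" "D \<le> V"
    and G: "G \<subseteq> S" "card G \<le> 2 * K" "(\<Sum>i\<in>S - G. (x i)\<^sup>2) \<le> \<eta>"
    and \<Gamma>: "1 \<le> \<Gamma>" "\<eta> \<le> V * \<Gamma> / \<Delta> ^ 40"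
  shows "measure_pmf.prob (stage_pmf n (\<Delta> ^ 8 * K) K m p) {w. \<not> (let
      S' = stage_step K K' (\<Delta> ^ 8 * K) w S (map (\<lambda>a. inner_n n a x) (stage_rows K w S)) in
      S' \<subseteq> {..<n} \<and>
      (\<exists>J'\<subseteq>S'. card J' \<le> k \<and> (\<Sum>i\<in>{..<n} - J'. (x i)\<^sup>2) \<le> D + k / K' * (V * \<Gamma> / real \<Delta> ^ 2)) \<and>
      (\<exists>G'\<subseteq>S'. card G' \<le> 2 * K' \<and> (\<Sum>i\<in>S' - G'. (x i)\<^sup>2) \<le> \<eta> / real \<Delta> ^ 2) \<and>
      real (card S') \<le> K' + (real n)\<^sup>2 / (K * real \<Delta> ^ 7))} \<le> 18 / \<Delta>"
proof -
  have VJ: "(\<Sum>i\<in>S - J. (x i)\<^sup>2) \<le> V"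
  proof -
    have "(\<Sum>i\<in>S - J. (x i)\<^sup>2) \<le> (\<Sum>i\<in>{..<n} - J. (x i)\<^sup>2)" using S by (intro sum_mono2) auto
    then show ?thesis using J by linarith
  qed
  have JD: "(\<Sum>i\<in>{..<n} - J. (x i)\<^sup>2) \<le> D" by (rule J(3))
  interpret stage n "\<Delta> ^ 8 * K" K K' k \<Delta> S J G x V \<eta> \<Gamma>
    by unfold_locales (use assms VJ in auto)
  show ?thesis
  proof (rule order_trans[OF prob_mono stage_good[OF p m]])
    fix w assume b: "\<not> (let
      S' = stage_step K K' (\<Delta> ^ 8 * K) w S (map (\<lambda>a. inner_n n a x) (stage_rows K w S)) in
      S' \<subseteq> {..<n} \<and>
      (\<exists>J'\<subseteq>S'. card J' \<le> k \<and> (\<Sum>i\<in>{..<n} - J'. (x i)\<^sup>2) \<le> D + k / K' * (V * \<Gamma> / real \<Delta> ^ 2)) \<and>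
      (\<exists>G'\<subseteq>S'. card G' \<le> 2 * K' \<and> (\<Sum>i\<in>S' - G'. (x i)\<^sup>2) \<le> \<eta> / real \<Delta> ^ 2) \<and>
      real (card S') \<le> K' + (real n)\<^sup>2 / (K * real \<Delta> ^ 7))"
    obtain \<phi> u A s where w: "w = (\<phi>, u, A, s)" by (cases w) auto
    show "\<not> (case w of (\<phi>, u, A, s) \<Rightarrow> good_hash \<phi> \<and> good_weights m \<phi> u \<and> good_matrix \<phi> u A \<and> good_signs \<phi> u A s)"
    proof
      assume "case w of (\<phi>, u, A, s) \<Rightarrow> good_hash \<phi> \<and> good_weights m \<phi> u \<and> good_matrix \<phi> u A \<and> good_signs \<phi> u A s"
      then have g: "good_hash \<phi>" "good_weights m \<phi> u" "good_matrix \<phi> u A" "good_signs \<phi> u A s" by (auto simp: w)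
      note c = good_conclusion[OF g]
      define S' where "S' = stage_step K K' (\<Delta> ^ 8 * K) w S (map (\<lambda>a. inner_n n a x) (stage_rows K w S))"
      note c' = c[folded w, folded S'_def]
      have "S' \<subseteq> {..<n}" using c'(4) S by blast
      moreover have "\<exists>J'\<subseteq>S'. card J' \<le> k \<and> (\<Sum>i\<in>{..<n} - J'. (x i)\<^sup>2) \<le> D + k / K' * (V * \<Gamma> / real \<Delta> ^ 2)"
        using c'(1) JD by (meson add_right_mono order_trans)
      ultimately show False using b c'(2,3) unfolding S'_def[symmetric] Let_def by blast
    qed
  qed
qed

section \<open>Running the stages\<close>

primrec run_state :: "nat \<Rightarrow> (nat \<Rightarrow> 'a \<Rightarrow> nat set \<Rightarrow> (nat \<Rightarrow> real) list) \<Rightarrow> (nat \<Rightarrow> 'a \<Rightarrow> nat set \<Rightarrow> real list \<Rightarrow> nat set)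
    \<Rightarrow> (nat \<Rightarrow> real) \<Rightarrow> (nat \<Rightarrow> 'a) \<Rightarrow> nat \<Rightarrow> nat set" where
  "run_state n query step x w 0 = {..<n}"
| "run_state n query step x w (Suc t) =
     step t (w t) (run_state n query step x w t) (map (\<lambda>a. inner_n n a x) (query t (w t) (run_state n query step x w t)))"

text \<open>The protocol never sees \<open>x\<close>, only the outcomes of earlier rounds, so the
  surviving set is recomputed from the transcript.\<close>

primrec replay :: "nat \<Rightarrow> (nat \<Rightarrow> 'a \<Rightarrow> nat set \<Rightarrow> real list \<Rightarrow> nat set) \<Rightarrow> (nat \<Rightarrow> 'a) \<Rightarrow> real list list \<Rightarrow> nat \<Rightarrow> nat set" where
  "replay n step w tr 0 = {..<n}"
| "replay n step w tr (Suc t) = step t (w t) (replay n step w tr t) (tr ! t)"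

lemma run_state_cong:
  "(\<And>s. s < t \<Longrightarrow> w s = w' s) \<Longrightarrow> run_state n query step x w t = run_state n query step x w' t"
  by (induction t) auto

text \<open>A union bound over the first stage that breaks the invariant. The seed of a stage is
  independent of the state it acts on, since that state depends on earlier seeds only.\<close>

lemma run_state_prob:
  fixes P :: "nat \<Rightarrow> 'a pmf"
  assumes fin: "\<And>t. finite (set_pmf (P t))"
    and Inv0: "Inv 0 {..<n}"
    and step: "\<And>t S. t < T \<Longrightarrow> Inv t S \<Longrightarrow>
      measure_pmf.prob (P t) {w. \<not> Inv (Suc t) (step t w S (map (\<lambda>a. inner_n n a x) (query t w S)))} \<le> \<delta> t"
    and \<delta>: "\<And>t. 0 \<le> \<delta> t"
  shows "t \<le> T \<Longrightarrow> measure_pmf.prob (Pi_pmf {..<t} undefined P) {w. \<not> Inv t (run_state n query step x w t)} \<le> (\<Sum>s<t. \<delta> s)"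
proof (induction t)
  case 0
  then show ?case using Inv0 by simp
next
  case (Suc t)
  let ?Q = "Pi_pmf {..<t} undefined P" and ?st = "run_state n query step x"
  let ?next = "\<lambda>g y. step t y (?st g t) (map (\<lambda>a. inner_n n a x) (query t y (?st g t)))"
  have fQ: "finite (set_pmf ?Q)" using fin by (intro finite_set_Pi_pmf) auto
  have up: "?st (g(t := y)) (Suc t) = ?next g y" for g y
  proof -
    have "?st (g(t := y)) t = ?st g t" by (rule run_state_cong) simp
    then show ?thesis by simp
  qed
  have "Pi_pmf {..<Suc t} undefined P = map_pmf (\<lambda>(g, y). g(t := y)) (pair_pmf ?Q (P t))"
    unfolding lessThan_Suc by (subst Pi_pmf_insert, simp, simp, subst pair_commute_pmf) (simp add: pmf.map_comp comp_def case_prod_unfold)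
  then have "measure_pmf.prob (Pi_pmf {..<Suc t} undefined P) {w. \<not> Inv (Suc t) (?st w (Suc t))}
     = measure_pmf.prob (pair_pmf ?Q (P t)) {q. \<not> Inv (Suc t) (?next (fst q) (snd q))}"
    by (simp only: measure_map_pmf vimage_def mem_Collect_eq case_prod_unfold up)
  also have "\<dots> \<le> measure_pmf.prob (pair_pmf ?Q (P t)) {q. \<not> Inv t (?st (fst q) t) \<or>
      (Inv t (?st (fst q) t) \<and> \<not> Inv (Suc t) (?next (fst q) (snd q)))}"
    by (rule prob_mono) blast
  also have "\<dots> \<le> measure_pmf.prob (pair_pmf ?Q (P t)) {q. \<not> Inv t (?st (fst q) t)}
      + measure_pmf.prob (pair_pmf ?Q (P t)) {q. Inv t (?st (fst q) t) \<and> \<not> Inv (Suc t) (?next (fst q) (snd q))}"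
    by (rule prob_disj)
  also have "\<dots> \<le> (\<Sum>s<t. \<delta> s) + \<delta> t"
  proof (rule add_mono)
    show "measure_pmf.prob (pair_pmf ?Q (P t)) {q. \<not> Inv t (?st (fst q) t)} \<le> (\<Sum>s<t. \<delta> s)"
      unfolding prob_pair_fst[of ?Q "P t" "\<lambda>g. \<not> Inv t (?st g t)"] using Suc by simp
    show "measure_pmf.prob (pair_pmf ?Q (P t)) {q. Inv t (?st (fst q) t) \<and> \<not> Inv (Suc t) (?next (fst q) (snd q))} \<le> \<delta> t"
    proof (rule prob_pair_le[OF fQ fin])
      fix g
      show "measure_pmf.prob (P t) {y. Inv t (?st g t) \<and> \<not> Inv (Suc t) (?next g y)} \<le> \<delta> t"
      proof (cases "Inv t (?st g t)")
        case True
        then show ?thesis using step[of t "?st g t"] Suc.prems by simp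
      next
        case False then show ?thesis using \<delta> by simp
      qed
    qed
  qed
  finally show ?case by simp
qed

lemma inner_unit: "i < n \<Longrightarrow> inner_n n (\<lambda>j. if j = i then 1 else 0) x = x i"
proof -
  assume "i < n"
  then have "inner_n n (\<lambda>j. if j = i then 1 else 0) x = (\<Sum>j<n. if j = i then x j else 0)"
    unfolding inner_n_def by (intro sum.cong) auto
  then show ?thesis using \<open>i < n\<close> by simp
qed

text \<open>The invariant may mention \<open>x\<close>, because it is chosen after \<open>x\<close>
  and serves the analysis only. A last round reads the survivors exactly, so the error is
  \<open>x\<close> outside them.\<close>

theorem adaptive_alg:
  fixes P :: "nat \<Rightarrow> 'a pmf" and L :: "nat \<Rightarrow> nat" and T F n k :: nat and eps :: real
  assumes fin: "\<And>t. finite (set_pmf (P t))"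
    and len: "\<And>t w S. length (query t w S) \<le> L t"
    and chain: "\<And>x. \<exists>Inv \<delta>. Inv 0 {..<n} \<and> (\<forall>t. 0 \<le> \<delta> t) \<and>
      (\<forall>t<T. \<forall>S. Inv t S \<longrightarrow>
        measure_pmf.prob (P t) {w. \<not> Inv (Suc t) (step t w S (map (\<lambda>a. inner_n n a x) (query t w S)))} \<le> \<delta> t) \<and>
      (\<forall>S. Inv T S \<longrightarrow> S \<subseteq> {..<n} \<and> card S \<le> F \<and>
        l2 n (\<lambda>i. if i \<in> S then 0 else x i) \<le> (1 + eps) * l2 n (drop_top n k x)) \<and>
      (\<Sum>t<T. \<delta> t) \<le> 1 / 2"
  shows "good_alg n k eps (1 / 2) (real ((\<Sum>t<T. L t) + F)) (real (T + 1))"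
proof -
  define Q where "Q = Pi_pmf {..<T} undefined P"
  txt \<open>\<open>good_alg\<close> asks for seeds of type \<open>nat \<Rightarrow> real\<close>: a seed is the number of a point of the countable
    support, stored in coordinate \<open>0\<close>.\<close>
  define enc where "enc = (\<lambda>w. (\<lambda>_::nat. real (to_nat_on (set_pmf Q) w)))"
  define dec where "dec = (\<lambda>v::nat \<Rightarrow> real. from_nat_into (set_pmf Q) (nat \<lfloor>v 0\<rfloor>))"
  have dec: "dec (enc w) = w" if "w \<in> set_pmf Q" for w
    unfolding dec_def enc_def using that by (simp add: from_nat_into_to_nat_on countable_set_pmf)
  define M where "M = measure_pmf (map_pmf enc Q)"
  define units :: "nat set \<Rightarrow> (nat \<Rightarrow> real) list" where "units = (\<lambda>S. map (\<lambda>i j. if j = i then 1 else 0 :: real) (sorted_list_of_set S))"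
  \<comment> \<open>The test against \<open>F\<close> makes the bound on the number of measurements
    hold for every seed, also after a failure.\<close>
  define meas where "meas = (\<lambda>v r tr. if r < T then query r (dec v r) (replay n step (dec v) tr r)
     else if card (replay n step (dec v) tr T) \<le> F then units (replay n step (dec v) tr T) else [])"
  define out where "out = (\<lambda>v tr i. case map_of (zip (sorted_list_of_set (replay n step (dec v) tr T)) (tr ! T)) i of
     None \<Rightarrow> 0 | Some a \<Rightarrow> a)"
  let ?st = "\<lambda>x w. run_state n query step x w"
  have tr_len: "length (transcript n meas v x r) = r" for v x r by (induction r) auto
  have tr_nth: "transcript n meas v x r ! t = map (\<lambda>a. inner_n n a x) (meas v t (transcript n meas v x t))" if "t < r" for v x r t
    using that by (induction r) (auto simp: nth_append tr_len less_Suc_eq)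
  have rep: "t \<le> T \<Longrightarrow> t \<le> r \<Longrightarrow> replay n step (dec v) (transcript n meas v x r) t = ?st x (dec v) t" for v x r t
  proof (induction t arbitrary: r)
    case 0 then show ?case by simp
  next
    case (Suc t)
    have "meas v t (transcript n meas v x t) = query t (dec v t) (?st x (dec v) t)"
      using Suc.IH[of t] Suc.prems by (simp add: meas_def)
    then show ?case using Suc.IH[of r] Suc.prems by (simp add: tr_nth)
  qed
  have measT: "meas v T (transcript n meas v x T) = (if card (?st x (dec v) T) \<le> F then units (?st x (dec v) T) else [])" for v x
    using rep[of T T v x] by (simp add: meas_def)
  have nm: "real (num_meas n meas v x (T + 1)) \<le> real ((\<Sum>t<T. L t) + F)" for v x
  proof -
    have "num_meas n meas v x (T + 1) = (\<Sum>r<T. length (meas v r (transcript n meas v x r))) + length (meas v T (transcript n meas v x T))"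
      by (simp add: num_meas_def)
    also have "\<dots> \<le> (\<Sum>t<T. L t) + F"
    proof (rule add_mono)
      show "(\<Sum>r<T. length (meas v r (transcript n meas v x r))) \<le> (\<Sum>t<T. L t)"
        by (intro sum_mono) (simp add: meas_def len)
      show "length (meas v T (transcript n meas v x T)) \<le> F" unfolding measT by (simp add: units_def)
    qed
    finally show ?thesis by (simp only: of_nat_le_iff)
  qed
  have outv: "out v (transcript n meas v x (T + 1)) i = (if i \<in> ?st x (dec v) T then x i else 0)"
    if S: "?st x (dec v) T \<subseteq> {..<n}" "card (?st x (dec v) T) \<le> F" for v x i
  proof -
    let ?S = "?st x (dec v) T"
    let ?l = "sorted_list_of_set ?S"
    have fS: "finite ?S" using S(1) finite_subset by blast
    have r: "replay n step (dec v) (transcript n meas v x (T + 1)) T = ?S" by (rule rep) auto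
    have "transcript n meas v x (T + 1) ! T = map (\<lambda>a. inner_n n a x) (units ?S)"
      using measT[of v x] S(2) by (simp add: nth_append tr_len)
    also have "\<dots> = map x ?l"
      unfolding units_def map_map comp_def using S(1) fS by (intro map_cong refl inner_unit) auto
    finally have "zip ?l (transcript n meas v x (T + 1) ! T) = map (\<lambda>i. (i, x i)) ?l"
      by (simp add: zip_map2 zip_same_conv_map)
    moreover have "map_of (map (\<lambda>i. (i, x i)) ?l) i = (if i \<in> ?S then Some (x i) else None)"
      using fS by (simp add: map_of_map_restrict restrict_map_def)
    ultimately show ?thesis unfolding out_def r by simp
  qed
  have succ: "measure M {v \<in> space M. l2 n (\<lambda>i. x i - out v (transcript n meas v x (T + 1)) i) \<le> (1 + eps) * l2 n (drop_top n k x)} \<ge> 1 / 2" for x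
  proof -
    obtain Inv \<delta> where Inv: "Inv 0 {..<n}" "\<And>t. 0 \<le> \<delta> t"
      "\<And>t S. t < T \<Longrightarrow> Inv t S \<Longrightarrow> measure_pmf.prob (P t) {w. \<not> Inv (Suc t) (step t w S (map (\<lambda>a. inner_n n a x) (query t w S)))} \<le> \<delta> t"
      "\<And>S. Inv T S \<Longrightarrow> S \<subseteq> {..<n} \<and> card S \<le> F \<and> l2 n (\<lambda>i. if i \<in> S then 0 else x i) \<le> (1 + eps) * l2 n (drop_top n k x)"
      "(\<Sum>t<T. \<delta> t) \<le> 1 / 2" using chain[of x] by blast
    have "measure_pmf.prob Q {w. \<not> Inv T (?st x w T)} \<le> (\<Sum>s<T. \<delta> s)"
      unfolding Q_def
      by (rule run_state_prob[where Inv = Inv and P = P and T = T and t = T and \<delta> = \<delta> and n = n and x = x and query = query and step = step])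
        (use fin Inv in auto)
    then have "1 / 2 \<le> measure_pmf.prob Q {w. Inv T (?st x w T)}"
      using Inv(5) prob_not_le[of Q "\<lambda>w. Inv T (?st x w T)"] by linarith
    also have "\<dots> \<le> measure_pmf.prob Q {w. l2 n (\<lambda>i. x i - out (enc w) (transcript n meas (enc w) x (T + 1)) i) \<le> (1 + eps) * l2 n (drop_top n k x)}"
    proof (rule prob_mono)
      fix w assume w: "w \<in> set_pmf Q" and I: "Inv T (?st x w T)"
      have "(\<lambda>i. x i - out (enc w) (transcript n meas (enc w) x (T + 1)) i) = (\<lambda>i. if i \<in> ?st x w T then 0 else x i)"
        using outv[of x "enc w"] Inv(4)[OF I] by (simp add: dec[OF w] fun_eq_iff)
      then show "l2 n (\<lambda>i. x i - out (enc w) (transcript n meas (enc w) x (T + 1)) i) \<le> (1 + eps) * l2 n (drop_top n k x)"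
        using Inv(4)[OF I] by simp
    qed
    also have "\<dots> = measure M {v \<in> space M. l2 n (\<lambda>i. x i - out v (transcript n meas v x (T + 1)) i) \<le> (1 + eps) * l2 n (drop_top n k x)}"
      unfolding M_def by (simp add: vimage_def)
    finally show ?thesis .
  qed
  have "prob_space M" unfolding M_def by (rule measure_pmf.prob_space_axioms)
  then show ?thesis unfolding good_alg_def using nm succ
    by (intro exI[of _ M] exI[of _ "T + 1"] exI[of _ meas] exI[of _ out] conjI ballI allI) auto
qed

text \<open>A stage divides \<open>\<eta>\<close> by \<open>scale t ^ 2\<close>, so the next scale can be the power \<open>21 / 20\<close> of the
  current one while \<open>\<eta>\<close> stays proportional to \<open>scale t ^ (- 40)\<close>. The doubly exponential growth is the
  source of the iterated logarithms in the round and measurement bounds.\<close>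

fun scale_exp :: "nat \<Rightarrow> nat" where
  "scale_exp 0 = 20"
| "scale_exp (Suc t) = scale_exp t + scale_exp t div 20"

definition scale :: "nat \<Rightarrow> nat" where "scale t = 2 ^ scale_exp t"

definition gam :: real where "gam = 2 ^ 800"

text \<open>\<open>gam\<close> is \<open>scale 0 ^ 40\<close>: initially \<open>\<eta>\<close> is the whole tail energy.\<close>

lemma gam: "1 \<le> gam" unfolding gam_def by (rule one_le_power) simp

lemma scale_exp_ge: "20 + t \<le> scale_exp t"
  by (induction t) auto

text \<open>Rounding in the division loses at most \<open>19 / 20\<close>, so the exponent minus 19
  grows at least by the factor \<open>21 / 20\<close>.\<close>

lemma scale_exp_growth: "19 + (21 / 20) ^ t \<le> real (scale_exp t)"
proof (induction t)
  case 0 then show ?case by simp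
next
  case (Suc t)
  have d: "scale_exp t \<le> 20 * (scale_exp t div 20) + 19"
    by presburger
  have "real (scale_exp t) \<le> 20 * real (scale_exp t div 20) + 19"
    using d by (simp only: of_nat_le_iff[symmetric, where 'a = real] of_nat_add of_nat_mult of_nat_numeral)
  then show ?case using Suc by simp
qed

lemma scale_ge: "2 ^ 20 * 2 ^ t \<le> real (scale t)"
proof -
  have "(2::real) ^ (20 + t) \<le> 2 ^ scale_exp t" by (intro power_increasing scale_exp_ge) simp
  then show ?thesis by (simp add: scale_def power_add)
qed

lemma scale_512: "512 \<le> scale t"
proof -
  have "(2::nat) ^ 9 \<le> 2 ^ scale_exp t" using scale_exp_ge[of t] by (intro power_increasing) auto
  then show ?thesis by (simp add: scale_def)
qed

lemma scale_mono_step: "real (scale (Suc t)) ^ 40 \<le> real (scale t) ^ 42"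
proof -
  have "40 * scale_exp (Suc t) \<le> 42 * scale_exp t" by simp
  then have "(2::real) ^ (scale_exp (Suc t) * 40) \<le> 2 ^ (scale_exp t * 42)" by (intro power_increasing) auto
  then show ?thesis by (simp only: scale_def power_mult of_nat_power of_nat_numeral)
qed

lemma sum_inverse_scale: "(\<Sum>t<T. 1 / real (scale t)) \<le> 2 / 2 ^ 20"
proof -
  have "(\<Sum>t<T. 1 / real (scale t)) \<le> (\<Sum>t<T. 1 / 2 ^ 20 * (1 / 2) ^ t)"
  proof (rule sum_mono)
    fix t
    have "1 / real (scale t) \<le> 1 / (2 ^ 20 * 2 ^ t)" using scale_ge[of t] scale_512[of t] by (intro divide_left_mono mult_pos_pos) auto
    then show "1 / real (scale t) \<le> 1 / 2 ^ 20 * (1 / 2) ^ t" by (simp add: power_divide)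
  qed
  also have "\<dots> = 1 / 2 ^ 20 * ((1 - (1 / 2) ^ T) / (1 - 1 / 2))" by (simp only: sum_distrib_left[symmetric] sum_gp_strict) simp
  also have "\<dots> \<le> 1 / 2 ^ 20 * (1 / (1 - 1 / 2))" by (intro mult_left_mono divide_right_mono) auto
  finally show ?thesis by simp
qed

text \<open>\<open>loss\<close> makes stage \<open>t\<close> cost at most \<open>eps / 2\<close> of
  the optimal tail energy, divided by the scale. The scales grow at least geometrically, so all
  stages together cost less than a fraction \<open>eps\<close>. This keeps the tail below twice the
  optimum, so one fixed \<open>V\<close> serves all stages.\<close>

theorem run_alg:
  fixes Kf :: "nat \<Rightarrow> nat" and n k T F :: nat and eps :: real
  assumes k: "1 \<le> k" and eps: "0 < eps" and T: "1 \<le> T"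
    and Kf: "\<And>t. 4 * k \<le> Kf t" "\<And>t. Kf (Suc t) \<le> Kf t" "\<And>t. 4 * Kf t \<le> scale t ^ 7 * Kf (Suc t)"
    and loss: "\<And>t. real k / real (Kf (Suc t)) * (2 * gam / real (scale t)) \<le> eps / 2"
    and F: "real (Kf T) + (real n)\<^sup>2 / (real (Kf (T - 1)) * real (scale (T - 1)) ^ 7) \<le> real F"
    and eps1: "eps < 1"
  shows "good_alg n k eps (1 / 2) (real ((\<Sum>t<T. 132 * Kf t) + F)) (real (T + 1))"
proof -
  have K1: "1 \<le> Kf t" for t using Kf(1)[of t] k by linarith
  have "\<exists>p :: real pmf. finite (set_pmf p) \<and> E p (\<lambda>g. g) = 0 \<and> E p (\<lambda>g. g\<^sup>2) \<le> 1 \<and>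
    (\<forall>d \<tau>. 1 / real (scale t ^ 10) \<le> \<tau> \<longrightarrow> (\<exists>i<scale t ^ 8 * Kf t. d i \<noteq> 0) \<longrightarrow>
      measure_pmf.prob (Pi_pmf {..<scale t ^ 8 * Kf t} 0 (\<lambda>_. p))
        {a. (inner_n (scale t ^ 8 * Kf t) a d)\<^sup>2 \<le> \<tau>\<^sup>2 * (\<Sum>i<scale t ^ 8 * Kf t. (d i)\<^sup>2)} \<le> 2 * \<tau>)" for t
  proof -
    have "1 / real (scale t ^ 10) > 0" using scale_512[of t] by simp
    from small_ball_pmf[OF this, where N = "scale t ^ 8 * Kf t"] show ?thesis by metis
  qed
  then obtain pf :: "nat \<Rightarrow> real pmf" where pf: "\<And>t. finite (set_pmf (pf t))" "\<And>t. E (pf t) (\<lambda>g. g) = 0" "\<And>t. E (pf t) (\<lambda>g. g\<^sup>2) \<le> 1"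
    "\<And>t d \<tau>. 1 / real (scale t ^ 10) \<le> \<tau> \<Longrightarrow> (\<exists>i<scale t ^ 8 * Kf t. d i \<noteq> 0) \<Longrightarrow>
      measure_pmf.prob (Pi_pmf {..<scale t ^ 8 * Kf t} 0 (\<lambda>_. pf t))
        {a. (inner_n (scale t ^ 8 * Kf t) a d)\<^sup>2 \<le> \<tau>\<^sup>2 * (\<Sum>i<scale t ^ 8 * Kf t. (d i)\<^sup>2)} \<le> 2 * \<tau>"
    by metis
  \<comment> \<open>A crude exponent is enough: it enters only the resolution of the
    weights.\<close>
  define mf where "mf = (\<lambda>t. 8 * n * scale t)"
  have mf: "8 * real n * scale t \<le> 2 ^ mf t" for t
  proof -
    have "real (8 * n * scale t) \<le> 2 ^ (8 * n * scale t)" by (rule less_imp_le[OF of_nat_less_two_power])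
    then show ?thesis by (simp add: mf_def)
  qed
  define P where "P = (\<lambda>t. stage_pmf n (scale t ^ 8 * Kf t) (Kf t) (mf t) (pf t))"
  define query where "query = (\<lambda>t w S. stage_rows (Kf t) w S)"
  define step where "step = (\<lambda>t w S obs. stage_step (Kf t) (Kf (Suc t)) (scale t ^ 8 * Kf t) w S obs)"
  show ?thesis
  proof (rule adaptive_alg[where P = P and query = query and step = step and L = "\<lambda>t. 132 * Kf t"])
    show "finite (set_pmf (P t))" for t
    proof -
      have "1 \<le> scale t ^ 8 * Kf t" using K1[of t] scale_512[of t] by simp
      then show ?thesis
        unfolding P_def stage_pmf_def using finite_hash finite_weights[of "2 ^ mf t" n] finite_gmat[OF pf(1)] finite_signs by simp
    qed
    show "length (query t w S) \<le> 132 * Kf t" for t w S by (simp add: query_def length_stage_rows)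
  next
    fix x :: "nat \<Rightarrow> real"
    define e where "e = (\<Sum>i<n. (drop_top n k x i)\<^sup>2)"
    have e0: "0 \<le> e" unfolding e_def by (intro sum_nonneg) auto
    \<comment> \<open>The losses are accumulated with \<open>V\<close> frozen at
      \<open>2 * e\<close>; that the tail really stays below this value is checked in
      \<open>DV\<close>.\<close>
    define D where "D = (\<lambda>t. e + (\<Sum>s<t. real k / real (Kf (Suc s)) * ((2 * e) * gam / real (scale s) ^ 2)))"
    define \<eta> where "\<eta> = (\<lambda>t. (2 * e) * gam / real (scale t) ^ 40)"
    define Inv where "Inv = (\<lambda>t S. S \<subseteq> {..<n} \<and>
      (\<exists>J\<subseteq>S. card J \<le> k \<and> (\<Sum>i\<in>{..<n} - J. (x i)\<^sup>2) \<le> D t) \<and>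
      (\<exists>G\<subseteq>S. card G \<le> 2 * Kf t \<and> (\<Sum>i\<in>S - G. (x i)\<^sup>2) \<le> \<eta> t) \<and> (t = T \<longrightarrow> card S \<le> F))"
    have sc0: "0 < real (scale t)" for t using scale_512[of t] by simp
    have Dle: "D t \<le> e * (1 + eps)" for t
    proof -
      have "(\<Sum>s<t. real k / real (Kf (Suc s)) * ((2 * e) * gam / real (scale s) ^ 2)) \<le> (\<Sum>s<t. e * (eps / 2) * (1 / real (scale s)))"
      proof (rule sum_mono)
        fix s
        have "real k / real (Kf (Suc s)) * ((2 * e) * gam / real (scale s) ^ 2)
          = e * (real k / real (Kf (Suc s)) * (2 * gam / real (scale s))) * (1 / real (scale s))"
          by (simp add: power2_eq_square mult_ac)
        also have "\<dots> \<le> e * (eps / 2) * (1 / real (scale s))"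
          using loss[of s] e0 sc0[of s] by (intro mult_right_mono mult_left_mono) auto
        finally show "real k / real (Kf (Suc s)) * ((2 * e) * gam / real (scale s) ^ 2) \<le> e * (eps / 2) * (1 / real (scale s))" .
      qed
      also have "\<dots> = e * (eps / 2) * (\<Sum>s<t. 1 / real (scale s))" by (simp add: sum_distrib_left)
      also have "\<dots> \<le> e * (eps / 2) * 1"
        using sum_inverse_scale[of t] e0 eps by (intro mult_left_mono) auto
      finally show ?thesis using mult_nonneg_nonneg[OF e0, of eps] eps unfolding D_def by (simp add: algebra_simps)
    qed
    have DV: "D t \<le> 2 * e" for t
    proof -
      have "e * (1 + eps) \<le> e * 2" using eps1 e0 by (intro mult_left_mono) auto
      then show ?thesis using Dle[of t] by linarith
    qed
    have J0: "(\<Sum>i\<in>{..<n} - top_k_set n k x. (x i)\<^sup>2) = e"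
      unfolding e_def drop_top_def by (intro sum.mono_neutral_cong_left) auto
    have e_le: "e \<le> 2 * e * gam / real (scale 0) ^ 40"
    proof -
      have "real (scale 0) ^ 40 = gam" by (simp add: scale_def gam_def power_mult[symmetric])
      then show ?thesis using gam e0 by simp
    qed
    have "Inv 0 {..<n}"
      unfolding Inv_def
    proof (intro conjI exI[of _ "top_k_set n k x"])
      show "card (top_k_set n k x) \<le> 2 * Kf 0" using top_k_set(2)[where n = n and k = k and x = x] Kf(1)[of 0] by linarith
      show "(\<Sum>i\<in>{..<n} - top_k_set n k x. (x i)\<^sup>2) \<le> \<eta> 0" unfolding J0 \<eta>_def using e_le by simp
    qed (use top_k_set[where n = n and k = k and x = x] T J0 in \<open>auto simp: D_def\<close>)
    moreover have "\<forall>t<T. \<forall>S. Inv t S \<longrightarrow>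
        measure_pmf.prob (P t) {w. \<not> Inv (Suc t) (step t w S (map (\<lambda>a. inner_n n a x) (query t w S)))} \<le> 18 / scale t"
    proof (intro allI impI)
      fix t S assume t: "t < T" and I: "Inv t S"
      obtain J where J: "J \<subseteq> S" "card J \<le> k" "(\<Sum>i\<in>{..<n} - J. (x i)\<^sup>2) \<le> D t" using I unfolding Inv_def by blast
      obtain G where G: "G \<subseteq> S" "card G \<le> 2 * Kf t" "(\<Sum>i\<in>S - G. (x i)\<^sup>2) \<le> \<eta> t" using I unfolding Inv_def by blast
      have S: "S \<subseteq> {..<n}" using I unfolding Inv_def by blast
      have \<eta>step: "\<eta> t / real (scale t) ^ 2 \<le> \<eta> (Suc t)"
      proof -
        have "\<eta> t / real (scale t) ^ 2 = (2 * e) * gam / real (scale t) ^ 42" by (simp add: \<eta>_def power_add[symmetric])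
        also have "\<dots> \<le> \<eta> (Suc t)"
          unfolding \<eta>_def using scale_mono_step[of t] e0 gam sc0 by (intro divide_left_mono) auto
        finally show ?thesis .
      qed
      have "measure_pmf.prob (P t) {w. \<not> Inv (Suc t) (step t w S (map (\<lambda>a. inner_n n a x) (query t w S)))}
        \<le> measure_pmf.prob (P t) {w. \<not> (let
          S' = stage_step (Kf t) (Kf (Suc t)) (scale t ^ 8 * Kf t) w S (map (\<lambda>a. inner_n n a x) (stage_rows (Kf t) w S)) in
          S' \<subseteq> {..<n} \<and>
          (\<exists>J'\<subseteq>S'. card J' \<le> k \<and> (\<Sum>i\<in>{..<n} - J'. (x i)\<^sup>2) \<le> D t + k / Kf (Suc t) * ((2 * e) * gam / real (scale t) ^ 2)) \<and>
          (\<exists>G'\<subseteq>S'. card G' \<le> 2 * Kf (Suc t) \<and> (\<Sum>i\<in>S' - G'. (x i)\<^sup>2) \<le> \<eta> t / real (scale t) ^ 2) \<and>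
          real (card S') \<le> Kf (Suc t) + (real n)\<^sup>2 / (Kf t * real (scale t) ^ 7))}"
      proof (rule prob_mono, rule notI)
        fix w assume ni: "\<not> Inv (Suc t) (step t w S (map (\<lambda>a. inner_n n a x) (query t w S)))"
        define S' where "S' = step t w S (map (\<lambda>a. inner_n n a x) (query t w S))"
        assume "let S' = stage_step (Kf t) (Kf (Suc t)) (scale t ^ 8 * Kf t) w S (map (\<lambda>a. inner_n n a x) (stage_rows (Kf t) w S)) in
          S' \<subseteq> {..<n} \<and>
          (\<exists>J'\<subseteq>S'. card J' \<le> k \<and> (\<Sum>i\<in>{..<n} - J'. (x i)\<^sup>2) \<le> D t + k / Kf (Suc t) * ((2 * e) * gam / real (scale t) ^ 2)) \<and>
          (\<exists>G'\<subseteq>S'. card G' \<le> 2 * Kf (Suc t) \<and> (\<Sum>i\<in>S' - G'. (x i)\<^sup>2) \<le> \<eta> t / real (scale t) ^ 2) \<and>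
          real (card S') \<le> Kf (Suc t) + (real n)\<^sup>2 / (Kf t * real (scale t) ^ 7)"
        then have c: "S' \<subseteq> {..<n}"
          "\<exists>J'\<subseteq>S'. card J' \<le> k \<and> (\<Sum>i\<in>{..<n} - J'. (x i)\<^sup>2) \<le> D t + k / Kf (Suc t) * ((2 * e) * gam / real (scale t) ^ 2)"
          "\<exists>G'\<subseteq>S'. card G' \<le> 2 * Kf (Suc t) \<and> (\<Sum>i\<in>S' - G'. (x i)\<^sup>2) \<le> \<eta> t / real (scale t) ^ 2"
          "real (card S') \<le> Kf (Suc t) + (real n)\<^sup>2 / (Kf t * real (scale t) ^ 7)"
          unfolding S'_def step_def query_def Let_def by blast+
        have "Inv (Suc t) S'"
          unfolding Inv_def
        proof (intro conjI)
          show "S' \<subseteq> {..<n}" by (rule c(1))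
          show "\<exists>J\<subseteq>S'. card J \<le> k \<and> (\<Sum>i\<in>{..<n} - J. (x i)\<^sup>2) \<le> D (Suc t)" using c(2) by (simp add: D_def add.assoc)
          show "\<exists>G\<subseteq>S'. card G \<le> 2 * Kf (Suc t) \<and> (\<Sum>i\<in>S' - G. (x i)\<^sup>2) \<le> \<eta> (Suc t)" using c(3) \<eta>step order_trans by blast
          show "Suc t = T \<longrightarrow> card S' \<le> F"
          proof
            assume "Suc t = T"
            then have "real (card S') \<le> real F" using c(4) F by (auto intro: order_trans)
            then show "card S' \<le> F" by simp
          qed
        qed
        then show False using ni unfolding S'_def by blast
      qed
      also have "\<dots> \<le> 18 / scale t"
        unfolding P_def
        by (rule stage_theorem[OF scale_512 K1 k Kf(1,2,3) pf mf S J DV G gam]) (simp_all add: \<eta>_def)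
      finally show "measure_pmf.prob (P t) {w. \<not> Inv (Suc t) (step t w S (map (\<lambda>a. inner_n n a x) (query t w S)))} \<le> 18 / scale t" .
    qed
    moreover have "\<forall>S. Inv T S \<longrightarrow> S \<subseteq> {..<n} \<and> card S \<le> F \<and>
        l2 n (\<lambda>i. if i \<in> S then 0 else x i) \<le> (1 + eps) * l2 n (drop_top n k x)"
    proof (intro allI impI conjI)
      fix S assume I: "Inv T S"
      then show "S \<subseteq> {..<n}" "card S \<le> F" unfolding Inv_def by blast+
      obtain J where J: "J \<subseteq> S" "(\<Sum>i\<in>{..<n} - J. (x i)\<^sup>2) \<le> D T" using I unfolding Inv_def by blast
      have "(\<Sum>i<n. (if i \<in> S then 0 else x i)\<^sup>2) \<le> (\<Sum>i\<in>{..<n} - J. (x i)\<^sup>2)"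
      proof -
        have "(\<Sum>i<n. (if i \<in> S then 0 else x i)\<^sup>2) = (\<Sum>i\<in>{..<n} - S. (x i)\<^sup>2)"
          by (intro sum.mono_neutral_cong_right) auto
        also have "\<dots> \<le> (\<Sum>i\<in>{..<n} - J. (x i)\<^sup>2)" using J(1) by (intro sum_mono2) auto
        finally show ?thesis .
      qed
      also have "\<dots> \<le> e * (1 + eps)" using J(2) Dle[of T] by linarith
      also have "\<dots> \<le> (1 + eps)\<^sup>2 * e"
        using e0 eps mult_nonneg_nonneg[OF e0, of eps] mult_nonneg_nonneg[OF e0, of "eps * eps"]
        by (simp add: power2_eq_square algebra_simps)
      finally have "l2 n (\<lambda>i. if i \<in> S then 0 else x i) \<le> sqrt ((1 + eps)\<^sup>2 * e)"
        unfolding l2_def by (rule real_sqrt_le_mono)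
      then show "l2 n (\<lambda>i. if i \<in> S then 0 else x i) \<le> (1 + eps) * l2 n (drop_top n k x)"
        using eps by (simp add: real_sqrt_mult l2_def e_def)
    qed
    moreover have "(\<Sum>t<T. 18 / real (scale t)) \<le> 1 / 2"
    proof -
      have "(\<Sum>t<T. 18 / real (scale t)) = 18 * (\<Sum>t<T. 1 / real (scale t))" by (simp add: sum_distrib_left)
      also have "\<dots> \<le> 18 * (2 / 2 ^ 20)" by (intro mult_left_mono sum_inverse_scale) simp
      finally show ?thesis by simp
    qed
    ultimately show "\<exists>Inv \<delta>. Inv 0 {..<n} \<and> (\<forall>t. 0 \<le> \<delta> t) \<and>
      (\<forall>t<T. \<forall>S. Inv t S \<longrightarrow>
        measure_pmf.prob (P t) {w. \<not> Inv (Suc t) (step t w S (map (\<lambda>a. inner_n n a x) (query t w S)))} \<le> \<delta> t) \<and>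
      (\<forall>S. Inv T S \<longrightarrow> S \<subseteq> {..<n} \<and> card S \<le> F \<and>
        l2 n (\<lambda>i. if i \<in> S then 0 else x i) \<le> (1 + eps) * l2 n (drop_top n k x)) \<and>
      (\<Sum>t<T. \<delta> t) \<le> 1 / 2"
      by (intro exI[of _ Inv] exI[of _ "\<lambda>t. 18 / scale t"] conjI) auto
  qed
qed

lemma good_alg_mono:
  assumes "good_alg n k eps c M0 R" "M0 \<le> M'" "R \<le> R'"
  shows "good_alg n k eps c M' R'"
proof -
  obtain M :: "(nat \<Rightarrow> real) measure" and r meas out where a: "prob_space M" "real r \<le> R"
    "\<forall>w\<in>space M. \<forall>x. real (num_meas n meas w x r) \<le> M0"
    "\<forall>x. measure M {w \<in> space M. l2 n (\<lambda>i. x i - out w (transcript n meas w x r) i) \<le> (1 + eps) * l2 n (drop_top n k x)} \<ge> c"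
    using assms(1) unfolding good_alg_def by blast
  have "real r \<le> R'" using a(2) assms(3) by (rule order_trans)
  moreover have "\<forall>w\<in>space M. \<forall>x. real (num_meas n meas w x r) \<le> M'"
    using a(3) assms(2) order_trans by blast
  ultimately show ?thesis unfolding good_alg_def using a(1,4) by blast
qed

section \<open>Iterated logarithms and the number of stages\<close>

lemma clog_ge_1: "1 \<le> clog y"
  unfolding clog_def by simp

lemma clog_mono: "x \<le> y \<Longrightarrow> clog x \<le> clog y"
  unfolding clog_def by simp

lemma clog_le_2: "y \<le> 2 \<Longrightarrow> clog y = 1"
  unfolding clog_def by (simp add: max_absorb1)

lemma powr_clog_ge: "y \<le> 2 powr clog y"
  unfolding clog_def by simp

lemma clog_mult:
  assumes "0 \<le> a" "0 \<le> b"
  shows "clog (a * b) \<le> clog a + clog b"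
proof -
  have "a * b \<le> max 2 a * max 2 b" using assms by (intro mult_mono) auto
  moreover have "2 * 2 \<le> max 2 a * max 2 b" by (intro mult_mono) auto
  ultimately have "max 2 (a * b) \<le> max 2 a * max 2 b" by linarith
  then have "log 2 (max 2 (a * b)) \<le> log 2 (max 2 a * max 2 b)" by simp
  also have "\<dots> = log 2 (max 2 a) + log 2 (max 2 b)" by (subst log_mult) auto
  finally show ?thesis unfolding clog_def .
qed

lemma cloglog_ge_1: "1 \<le> cloglog y"
  unfolding cloglog_def by (rule clog_ge_1)

lemma cloglog_mono: "x \<le> y \<Longrightarrow> cloglog x \<le> cloglog y"
  unfolding cloglog_def by (intro clog_mono)

text \<open>All clipped logarithms are at least 1, so sums are bounded by products, and a constant
  factor inside becomes a constant factor outside.\<close>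

lemma cloglog_mult:
  assumes "0 \<le> a" "0 \<le> y"
  shows "cloglog (a * y) \<le> (clog (2 * clog a) + 1) * cloglog y"
proof -
  have a: "1 \<le> clog a" and y: "1 \<le> clog y" by (rule clog_ge_1)+
  have "clog (a * y) \<le> clog a + clog y" using assms by (rule clog_mult)
  also have "\<dots> \<le> 2 * clog a * clog y"
    using mult_nonneg_nonneg[of "clog a - 1" "clog y - 1"] mult_mono[OF a y] a y by (simp add: algebra_simps)
  finally have "cloglog (a * y) \<le> clog (2 * clog a * clog y)" unfolding cloglog_def by (rule clog_mono)
  also have "\<dots> \<le> clog (2 * clog a) + cloglog y"
    unfolding cloglog_def using a y by (intro clog_mult) auto
  also have "\<dots> \<le> clog (2 * clog a) * cloglog y + cloglog y"
    using mult_left_mono[OF cloglog_ge_1, of "clog (2 * clog a)" y] clog_ge_1[of "2 * clog a"] by simp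
  finally show ?thesis by (simp add: distrib_right)
qed

text \<open>The factor 15 is chosen because \<open>(21 / 20) ^ 15 \<ge> 2\<close>.\<close>

definition num_stages :: "real \<Rightarrow> nat" where "num_stages y = 15 * nat \<lceil>cloglog y\<rceil>"

lemma num_stages_le: "real (num_stages y) \<le> 30 * cloglog y"
  using cloglog_ge_1[of y] unfolding num_stages_def by simp linarith

text \<open>With \<open>m\<close> the rounded up double logarithm, \<open>15 * m\<close> stages
  raise the exponent of the scale above \<open>2 ^ m\<close>, hence above
  \<open>clog y\<close>.\<close>

lemma le_scale_if_num_stages:
  assumes "num_stages y \<le> t"
  shows "y \<le> real (scale t)"
proof -
  define m where "m = nat \<lceil>cloglog y\<rceil>"
  have m: "cloglog y \<le> real m" unfolding m_def by linarith
  have "clog y \<le> 2 powr cloglog y" unfolding cloglog_def by (rule powr_clog_ge)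
  also have "\<dots> \<le> 2 powr real m" using m by simp
  also have "\<dots> = 2 ^ m" by (simp add: powr_realpow)
  also have "\<dots> \<le> ((21 / 20) ^ 15) ^ m" by (intro power_mono) (simp_all add: power_divide)
  also have "\<dots> = (21 / 20 :: real) ^ (15 * m)" by (simp only: power_mult)
  also have "\<dots> \<le> (21 / 20) ^ t" using assms by (intro power_increasing) (simp_all add: num_stages_def m_def)
  finally have "clog y \<le> real (scale_exp t)" using scale_exp_growth[of t] by linarith
  then have "2 powr clog y \<le> 2 powr real (scale_exp t)" by simp
  then show ?thesis using powr_clog_ge[of y] by (simp add: scale_def powr_realpow)
qed

lemma gap_const: "4 * K \<le> scale t ^ 7 * K"
proof -
  have "scale t ^ 1 \<le> scale t ^ 7" using scale_512[of t] by (intro power_increasing) auto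
  then show ?thesis using scale_512[of t] by simp
qed

section \<open>Numbers of cells and the final bounds\<close>

text \<open>Once the scale reaches \<open>n / K\<close>, the expected number of collisions among all
  coordinates is small enough that only order \<open>K\<close> of them survive the last
  stage.\<close>

lemma final_card:
  assumes "0 < K" "K \<le> L" "real n / real K \<le> real s" "1 \<le> s"
  shows "(real n)\<^sup>2 / (real L * real s ^ 7) \<le> real K"
proof -
  have s: "1 \<le> real s" using assms by simp
  have "real n \<le> real K * real s" using assms by (simp add: divide_le_eq mult.commute)
  then have "(real n)\<^sup>2 \<le> (real K * real s)\<^sup>2" by (intro power_mono) auto
  also have "\<dots> = real K * (real K * real s ^ 2)" by (simp add: power2_eq_square)
  also have "\<dots> \<le> real K * (real L * real s ^ 7)"
    using assms s by (intro mult_left_mono mult_mono power_increasing) auto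
  finally show ?thesis using assms s by (simp add: divide_le_eq)
qed

text \<open>Large enough that \<open>k / K * (2 * gam) \<le> eps / 2\<close>, so the loss condition
  already holds without help from the scale.\<close>

definition width :: "nat \<Rightarrow> real \<Rightarrow> nat" where
  "width k eps = nat \<lceil>4 * gam * real k / eps\<rceil>"

lemma width:
  assumes "1 \<le> k" "0 < eps" "eps < 1"
  shows "4 * gam * real k / eps \<le> real (width k eps)" "real (width k eps) \<le> 5 * gam * real k / eps"
    "real k / eps \<le> real (width k eps)" "4 * k \<le> width k eps"
proof -
  have ke: "real k \<le> real k / eps" using assms by (simp add: le_divide_eq)
  have g: "real k / eps \<le> gam * (real k / eps)" using gam assms mult_right_mono[OF gam, of "real k / eps"] by simp
  show lower: "4 * gam * real k / eps \<le> real (width k eps)" unfolding width_def by linarith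
  have "4 * gam * real k / eps = 4 * (gam * (real k / eps))" "5 * gam * real k / eps = 5 * (gam * (real k / eps))" by simp_all
  moreover have "0 \<le> gam * (real k / eps)" using gam assms by simp
  ultimately show "real (width k eps) \<le> 5 * gam * real k / eps"
    using ke g assms(1) unfolding width_def by linarith
  show "real k / eps \<le> real (width k eps)" "4 * k \<le> width k eps"
    using lower ke g by (simp_all only: of_nat_le_iff[symmetric, where 'a = real] of_nat_mult of_nat_numeral) (use gam assms in simp_all)
qed

text \<open>Order \<open>k / eps\<close> cells in all stages. As \<open>K\<close> exceeds
  \<open>k / eps\<close>, the double logarithm of \<open>n / K\<close> is at most that of
  \<open>n * eps / k\<close>; 155 is \<open>5 * 31\<close> and 134 is
  \<open>132 + 2\<close>.\<close>

lemma constant_width_alg: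
  assumes "1 \<le> k" "0 < eps" "eps < 1"
  shows "good_alg n k eps (1 / 2) (134 * 155 * gam * (real k / eps * cloglog (real n * eps / real k)))
    (32 * cloglog (real n * eps / real k))"
proof -
  define K where "K = width k eps"
  \<comment> \<open>The extra stage makes \<open>T - 1\<close>, the index of the last stage, reach
    \<open>num_stages\<close>, so that its own scale is at least \<open>n / K\<close>.\<close>
  define T where "T = num_stages (real n / real K) + 1"
  let ?c = "cloglog (real n * eps / real k)"
  note K = width[OF assms, folded K_def]
  have K0: "0 < K" using K(4) assms(1) by simp
  have c: "1 \<le> ?c" by (rule cloglog_ge_1)
  have "real n / real K \<le> real n / (real k / eps)"
    using K(3) K0 assms by (intro divide_left_mono mult_pos_pos) auto
  then have "cloglog (real n / real K) \<le> ?c" by (intro cloglog_mono) (simp add: mult.commute)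
  then have T: "real T \<le> 31 * ?c" using num_stages_le[of "real n / real K"] c unfolding T_def by simp
  have "good_alg n k eps (1 / 2) (real ((\<Sum>t<T. 132 * K) + 2 * K)) (real (T + 1))"
  proof (rule run_alg[where Kf = "\<lambda>_. K"])
    fix t
    have "real k / real K * (2 * gam / real (scale t)) \<le> real k / real K * (2 * gam)"
      using gam scale_512[of t] by (intro mult_left_mono) (auto simp: divide_le_eq mult_le_cancel_left1)
    also have "\<dots> \<le> eps / 2" using K(1) K0 assms by (simp add: field_simps)
    finally show "real k / real K * (2 * gam / real (scale t)) \<le> eps / 2" .
  next
    have "real n / real K \<le> real (scale (T - 1))" by (rule le_scale_if_num_stages) (simp add: T_def)
    then have "(real n)\<^sup>2 / (real K * real (scale (T - 1)) ^ 7) \<le> real K"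
      using K0 scale_512[of "T - 1"] by (intro final_card) auto
    then show "real K + (real n)\<^sup>2 / (real K * real (scale (T - 1)) ^ 7) \<le> real (2 * K)" by simp
  qed (use assms K(4) gap_const in \<open>auto simp: T_def\<close>)
  then show ?thesis
  proof (rule good_alg_mono)
    have "real ((\<Sum>t<T. 132 * K) + 2 * K) \<le> 134 * (real K * real T)"
    proof -
      have "real K * 1 \<le> real K * real T" by (intro mult_left_mono) (simp_all add: T_def)
      then show ?thesis by (simp add: mult.commute)
    qed
    also have "\<dots> \<le> 134 * (5 * gam * real k / eps * (31 * ?c))"
      using K(2) T by (intro mult_left_mono mult_mono) auto
    finally show "real ((\<Sum>t<T. 132 * K) + 2 * K) \<le> 134 * 155 * gam * (real k / eps * ?c)" by simp
    show "real (T + 1) \<le> 32 * ?c" using T c by simp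
  qed
qed

text \<open>The factor by which \<open>4 * gam\<close> inside the double logarithm enlarges it, as
  given by \<open>cloglog_mult\<close>.\<close>

definition gam_log :: real where "gam_log = clog (2 * clog (4 * gam)) + 1"

lemma sum_two_phase: "(\<Sum>t<u + s. if t < u then a else b) = u * a + s * (b :: nat)"
proof (induction s)
  case 0
  have "(\<Sum>t<u. if t < u then a else b) = (\<Sum>t<u. a)" by (intro sum.cong) auto
  then show ?case by simp
qed simp

text \<open>The first phase selects of the order of \<open>k / eps\<close> cells. Once the scale exceeds \<open>4 * gam / eps\<close>,
  even \<open>4 * k\<close> cells lose only a fraction \<open>eps\<close> of the tail energy.\<close>

lemma two_phase_alg:
  assumes "1 \<le> k" "0 < eps" "eps < 1" and big: "1 / eps \<le> real n / real k"
  shows "good_alg n k eps (1 / 2)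
    (132 * 155 * gam * gam_log * (real k / eps * cloglog (1 / eps)) + 17000 * (real k * cloglog (real n / real k)))
    ((31 * gam_log + 32) * cloglog (real n / real k))"
proof -
  define K where "K = width k eps"
  \<comment> \<open>The width drops at the end of stage \<open>u - 1\<close>, whose scale must
    already be at least \<open>4 * gam / eps\<close>; hence the added 1.\<close>
  define u where "u = num_stages (4 * gam / eps) + 1"
  define s where "s = num_stages (real n / real k) + 1"
  define Kf where "Kf = (\<lambda>t. if t < u then K else 4 * k)"
  let ?c1 = "cloglog (1 / eps)" and ?c2 = "cloglog (real n / real k)"
  note K = width[OF assms(1-3), folded K_def]
  have c: "1 \<le> ?c1" "1 \<le> ?c2" by (rule cloglog_ge_1)+
  have A: "1 \<le> gam_log" unfolding gam_log_def using clog_ge_1[of "2 * clog (4 * gam)"] by simp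
  have A1: "1 \<le> gam_log * ?c1" using mult_mono[OF A c(1)] A by simp
  have "cloglog (4 * gam / eps) \<le> gam_log * ?c1"
    unfolding gam_log_def using cloglog_mult[of "4 * gam" "1 / eps"] gam assms by simp
  then have u: "real u \<le> 31 * (gam_log * ?c1)"
    using num_stages_le[of "4 * gam / eps"] A1 unfolding u_def by simp
  have s: "real s \<le> 31 * ?c2" using num_stages_le[of "real n / real k"] c unfolding s_def by simp
  have late: "4 * gam / eps \<le> real (scale t)" if "u \<le> Suc t" for t
    using that by (intro le_scale_if_num_stages) (simp add: u_def)
  have "good_alg n k eps (1 / 2) (real ((\<Sum>t<u + s. 132 * Kf t) + 5 * k)) (real (u + s + 1))"
  proof (rule run_alg)
    show "4 * k \<le> Kf t" "Kf (Suc t) \<le> Kf t" for t using K(4) by (auto simp: Kf_def)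
    \<comment> \<open>The width changes only at the switch, where \<open>4 * K\<close> is at most
      \<open>20 * gam * k / eps\<close>. The scale there already exceeds
      \<open>4 * gam / eps\<close>, so two of its seven powers suffice.\<close>
    show "4 * Kf t \<le> scale t ^ 7 * Kf (Suc t)" for t
    proof (cases "Suc t = u")
      case True
      have "real (4 * K) \<le> 4 * (5 * gam * real k / eps)" using K(2) by simp
      also have "\<dots> = 5 * (4 * gam / eps) * real k" by simp
      also have "\<dots> \<le> 5 * real (scale t) * real k"
        using late[of t] True by (intro mult_right_mono mult_left_mono) auto
      also have "\<dots> \<le> real (scale t) ^ 2 * (4 * real k)"
      proof -
        have "5 * real (scale t) \<le> 4 * real (scale t) ^ 2" using scale_512[of t] by (simp add: power2_eq_square)
        then show ?thesis using mult_right_mono[of "5 * real (scale t)" "4 * real (scale t) ^ 2" "real k"] by simp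
      qed
      also have "\<dots> \<le> real (scale t) ^ 7 * (4 * real k)"
        using scale_512[of t] by (intro mult_right_mono power_increasing) auto
      finally have "real (4 * K) \<le> real (scale t ^ 7 * (4 * k))" by simp
      then have "4 * K \<le> scale t ^ 7 * (4 * k)" by (simp only: of_nat_le_iff)
      then show ?thesis using True by (auto simp: Kf_def)
    next
      case False
      then have "Kf (Suc t) = Kf t" by (auto simp: Kf_def)
      then show ?thesis using gap_const[of "Kf t" t] by (simp only:)
    qed
    show "real k / real (Kf (Suc t)) * (2 * gam / real (scale t)) \<le> eps / 2" for t
    proof (cases "Suc t < u")
      case True
      have "real k / real K * (2 * gam / real (scale t)) \<le> real k / real K * (2 * gam)"
        using gam scale_512[of t] by (intro mult_left_mono) (auto simp: divide_le_eq mult_le_cancel_left1)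
      also have "\<dots> \<le> eps / 2" using K(1,4) assms by (simp add: field_simps)
      finally show ?thesis using True by (simp add: Kf_def)
    next
      case False
      then have "4 * gam / eps \<le> real (scale t)" by (intro late) simp
      then have "4 * gam \<le> eps * real (scale t)" using assms by (simp add: divide_le_eq mult.commute)
      then have "2 * gam / (4 * real (scale t)) \<le> eps / 2" using scale_512[of t] gam by (simp add: field_simps)
      then show ?thesis using False assms(1) by (simp add: Kf_def)
    qed
    have "real n / real k \<le> real (scale (u + s - 1))" by (rule le_scale_if_num_stages) (simp add: s_def)
    then have "(real n)\<^sup>2 / (real (4 * k) * real (scale (u + s - 1)) ^ 7) \<le> real k"
      using assms scale_512[of "u + s - 1"] by (intro final_card) auto
    moreover have "Kf (u + s) = 4 * k" "Kf (u + s - 1) = 4 * k" by (auto simp: Kf_def s_def)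
    ultimately show "real (Kf (u + s)) + (real n)\<^sup>2 / (real (Kf (u + s - 1)) * real (scale (u + s - 1)) ^ 7) \<le> real (5 * k)" by simp
  qed (use assms in \<open>auto simp: s_def\<close>)
  then show ?thesis
  proof (rule good_alg_mono)
    have "real ((\<Sum>t<u + s. 132 * Kf t) + 5 * k) = 132 * (real K * real u) + (528 * (real k * real s) + 5 * real k)"
      unfolding sum_distrib_left[symmetric] Kf_def sum_two_phase by simp
    also have "\<dots> \<le> 132 * (5 * gam * real k / eps * (31 * (gam_log * ?c1))) + (528 * (real k * (31 * ?c2)) + 5 * (real k * ?c2))"
      using K(2) u s c mult_left_mono[OF c(2), of "real k"] by (intro add_mono mult_left_mono mult_mono) auto
    also have "\<dots> \<le> 132 * 155 * gam * gam_log * (real k / eps * ?c1) + 17000 * (real k * ?c2)"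
    proof -
      have "0 \<le> real k * ?c2" using c by simp
      moreover have "132 * (5 * gam * real k / eps * (31 * (gam_log * ?c1))) = 132 * 155 * gam * gam_log * (real k / eps * ?c1)" by simp
      ultimately show ?thesis by linarith
    qed
    finally show "real ((\<Sum>t<u + s. 132 * Kf t) + 5 * k) \<le> 132 * 155 * gam * gam_log * (real k / eps * ?c1) + 17000 * (real k * ?c2)" .
    \<comment> \<open>By \<open>big\<close>, the rounds of the first phase are charged to the
      second.\<close>
    have "gam_log * ?c1 \<le> gam_log * ?c2" using A big by (intro mult_left_mono cloglog_mono) auto
    then show "real (u + s + 1) \<le> (31 * gam_log + 32) * ?c2" using u s c by (simp add: distrib_right)
  qed
qed

theorem theorem4:
  shows "(\<exists>C c. c > 0 \<and> (\<forall>n k (eps::real). k \<ge> 1 \<and> 0 < eps \<and> eps < 1 \<longrightarrow>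
            good_alg n k eps c
              (C * (real k / eps * cloglog (1 / eps) + real k * cloglog (real n / real k)))
              (C * cloglog (real n / real k) * clog_star (real k))))
       \<and> (\<exists>C c. c > 0 \<and> (\<forall>n k (eps::real). k \<ge> 1 \<and> 0 < eps \<and> eps < 1 \<longrightarrow>
            good_alg n k eps c
              (C * (real k / eps * cloglog (real n * clog (real n * eps) / real k)))
              (C * cloglog (eps * real n * clog (real n / real k)))))"
proof (rule conjI)
  define C where "C = 134 * 155 * gam * gam_log + 17000"
  have A: "1 \<le> gam_log" unfolding gam_log_def using clog_ge_1[of "2 * clog (4 * gam)"] by simp
  have gA: "gam \<le> gam * gam_log" "gam_log \<le> gam * gam_log"
    using mult_left_mono[OF A, of gam] mult_right_mono[OF gam, of gam_log] gam A by simp_all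
  have C1: "134 * 155 * gam \<le> C" "32 \<le> C" "132 * 155 * gam * gam_log \<le> C" "17000 \<le> C" "31 * gam_log + 32 \<le> C"
    using gA gam A unfolding C_def by linarith+
  have C0: "0 \<le> C" using C1(2) by simp
  show "\<exists>C c. c > 0 \<and> (\<forall>n k (eps::real). k \<ge> 1 \<and> 0 < eps \<and> eps < 1 \<longrightarrow>
            good_alg n k eps c
              (C * (real k / eps * cloglog (1 / eps) + real k * cloglog (real n / real k)))
              (C * cloglog (real n / real k) * clog_star (real k)))"
  proof (rule exI[of _ C], rule exI[of _ "1 / 2"], intro conjI allI impI)
    fix n k :: nat and eps :: real
    assume "k \<ge> 1 \<and> 0 < eps \<and> eps < 1"
    then have a: "1 \<le> k" "0 < eps" "eps < 1" by simp_all
    let ?c1 = "cloglog (1 / eps)" and ?c2 = "cloglog (real n / real k)"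
    have c: "1 \<le> ?c1" "1 \<le> ?c2" by (rule cloglog_ge_1)+
    have st: "C * ?c2 * 1 \<le> C * ?c2 * clog_star (real k)"
      using C0 c by (intro mult_left_mono) (simp_all add: clog_star_def)
    \<comment> \<open>If \<open>n / k\<close> is below \<open>1 / eps\<close>, the first phase could
      last longer than the round bound allows; but then \<open>n * eps / k\<close> is below 1 and
      the constant width needs only a constant number of rounds.\<close>
    show "good_alg n k eps (1 / 2) (C * (real k / eps * ?c1 + real k * ?c2)) (C * ?c2 * clog_star (real k))"
    proof (cases "1 / eps \<le> real n / real k")
      case True
      show ?thesis
      proof (rule good_alg_mono[OF two_phase_alg[OF a True]])
        have "132 * 155 * gam * gam_log * (real k / eps * ?c1) + 17000 * (real k * ?c2)
          \<le> C * (real k / eps * ?c1) + C * (real k * ?c2)"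
          using C1(3,4) a c by (intro add_mono mult_right_mono) auto
        then show "132 * 155 * gam * gam_log * (real k / eps * ?c1) + 17000 * (real k * ?c2) \<le> C * (real k / eps * ?c1 + real k * ?c2)"
          by (simp only: distrib_left)
        have "(31 * gam_log + 32) * ?c2 \<le> C * ?c2" using C1(5) c by (intro mult_right_mono) auto
        then show "(31 * gam_log + 32) * ?c2 \<le> C * ?c2 * clog_star (real k)" using st by linarith
      qed
    next
      case False
      then have "real n * eps / real k \<le> 1" using a by (simp add: field_simps)
      then have one: "cloglog (real n * eps / real k) = 1" by (simp add: cloglog_def clog_le_2)
      show ?thesis
      proof (rule good_alg_mono[OF constant_width_alg[OF a]], unfold one)
        have "134 * 155 * gam * (real k / eps * 1) \<le> C * (real k / eps * ?c1 + real k * ?c2)"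
        proof (intro mult_mono)
          have "real k / eps * 1 \<le> real k / eps * ?c1" using c a by (intro mult_left_mono) auto
          moreover have "0 \<le> real k * ?c2" using c by simp
          ultimately show "real k / eps * 1 \<le> real k / eps * ?c1 + real k * ?c2" by linarith
        qed (use C0 C1(1) a in auto)
        then show "134 * 155 * gam * (real k / eps * 1) \<le> C * (real k / eps * ?c1 + real k * ?c2)" .
        have "32 * 1 \<le> C * ?c2" using C1(2) c by (intro mult_mono) auto
        then show "32 * 1 \<le> C * ?c2 * clog_star (real k)" using st by linarith
      qed
    qed
  qed simp
  show "\<exists>C c. c > 0 \<and> (\<forall>n k (eps::real). k \<ge> 1 \<and> 0 < eps \<and> eps < 1 \<longrightarrow>
            good_alg n k eps c
              (C * (real k / eps * cloglog (real n * clog (real n * eps) / real k)))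
              (C * cloglog (eps * real n * clog (real n / real k))))"
  proof (rule exI[of _ C], rule exI[of _ "1 / 2"], intro conjI allI impI)
    fix n k :: nat and eps :: real
    assume "k \<ge> 1 \<and> 0 < eps \<and> eps < 1"
    then have a: "1 \<le> k" "0 < eps" "eps < 1" by simp_all
    let ?c0 = "cloglog (real n * eps / real k)"
    have c: "1 \<le> ?c0" by (rule cloglog_ge_1)
    \<comment> \<open>For the second pair of bounds the constant width suffices: both arguments
      dominate \<open>n * eps / k\<close>, as \<open>eps < 1\<close>, \<open>k \<ge> 1\<close> and
      clipped logarithms are at least 1.\<close>
    have m1: "?c0 \<le> cloglog (real n * clog (real n * eps) / real k)"
      using a clog_ge_1[of "real n * eps"] by (intro cloglog_mono divide_right_mono mult_left_mono) auto
    have m2: "?c0 \<le> cloglog (eps * real n * clog (real n / real k))"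
    proof (rule cloglog_mono)
      have "eps * real n / real k \<le> eps * real n / 1" using a by (intro divide_left_mono) auto
      then have "real n * eps / real k \<le> eps * real n * 1" by (simp add: mult.commute)
      also have "\<dots> \<le> eps * real n * clog (real n / real k)" using a clog_ge_1 by (intro mult_left_mono) auto
      finally show "real n * eps / real k \<le> eps * real n * clog (real n / real k)" .
    qed
    show "good_alg n k eps (1 / 2) (C * (real k / eps * cloglog (real n * clog (real n * eps) / real k)))
              (C * cloglog (eps * real n * clog (real n / real k)))"
    proof (rule good_alg_mono[OF constant_width_alg[OF a]])
      show "134 * 155 * gam * (real k / eps * ?c0) \<le> C * (real k / eps * cloglog (real n * clog (real n * eps) / real k))"
        using C0 C1(1) a m1 c by (intro mult_mono mult_left_mono) auto
      show "32 * ?c0 \<le> C * cloglog (eps * real n * clog (real n / real k))"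
        using C0 C1(2) m2 c by (intro mult_mono) auto
    qed
  qed simp
qed

end
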